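(* For $m\in\{5,6,7,8\}$ let $S^{(m)}$ be the closed hyperbolic surface of genus $g_m=1+(m-4)2^{m-3}$ tessellated by $2^m$ regular right-angled hyperbolic $m$-gons as described in the context, and let $C$ be the set of its $m2^{m-3}$ closed geodesics contained in the union of the edges of the tessellation (these are the systoles of $S^{(m)}$). Then the dimension of the subspace of $H_1(S^{(m)};\mathbb{Q})$ spanned by the homology classes of the geodesics in $C$ (with arbitrary orientations) is $$10\ \text{ for } m=5,\qquad 31\ \text{ for } m=6,\qquad 84\ \text{ for } m=7,\qquad 210\ \text{ for } m=8 .$$
   Context: The surface $S^{(m)}$: let $P$ be a regular right-angled hyperbolic $m$-gon ($m\ge 5$) with sides labelled cyclically $1,\dots,m$. Take copies $P_v$ of $P$, one for each $v\in(\mathbb{Z}_2)^m$, and for each $v$ and each $i\in\{1,\dots,m\}$ glue side $i$ of $P_v$ to side $i$ of $P_{v+e_i}$ by the identity map of $P$, where $e_i$ is the $i$-th standard basis vector. The result is a closed connected orientable hyperbolic surface $S^{(m)}$ of genus $1+(m-4)2^{m-3}$, tessellated by the polygons $P_v$, four meeting at each vertex, with dual graph the 1-skeleton of the $m$-dimensional cube. *)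

theory Defs
  imports
    "HOL-Analysis.Analysis"
    "HOL-Homology.Homology"
    "Jordan_Normal_Form.Missing_VectorSpace"
begin

section \<open>The regular right-angled hyperbolic polygon\<close>

text \<open>
  The hyperbolic plane is the open unit disc with the Beltrami--Klein metric. In this model
  hyperbolic geodesics are Euclidean segments, so hyperbolic convex hulls are Euclidean ones.
\<close>

definition hyp_dist :: "complex \<Rightarrow> complex \<Rightarrow> real" where
  "hyp_dist x y =
     arcosh ((1 - x \<bullet> y) / (sqrt (1 - (norm x)\<^sup>2) * sqrt (1 - (norm y)\<^sup>2)))"

text \<open>
  The regular polygon with vertices on the circle of Euclidean radius \<open>r\<close> around the centre is
  right-angled exactly for the following value of \<open>r\<close>; see the facts
  \<open>side_length\<close> and \<open>right_angle\<close> below.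
\<close>

definition vertex_radius :: "nat \<Rightarrow> real" where
  "vertex_radius m = sqrt (cos (2 * pi / real m)) / cos (pi / real m)"

definition vertex :: "nat \<Rightarrow> nat \<Rightarrow> complex" where
  "vertex m k = vertex_radius m *\<^sub>R cis (2 * pi * real k / real m)"

text \<open>Sides and vertices are indexed by \<open>0, \<dots>, m - 1\<close>; note \<open>vertex m m = vertex m 0\<close>.\<close>

definition polygon :: "nat \<Rightarrow> complex set" where
  "polygon m = convex hull (vertex m ` {..<m})"

definition polygon_side :: "nat \<Rightarrow> nat \<Rightarrow> complex set" where
  "polygon_side m i = closed_segment (vertex m i) (vertex m (Suc i))"

lemma
  assumes "m \<ge> 5"
  shows cos_pos: "0 < cos (2 * pi / real m)"
    and cos_less_1: "cos (2 * pi / real m) < 1"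
    and vertex_radius_sq: "(vertex_radius m)\<^sup>2 =
          2 * cos (2 * pi / real m) / (1 + cos (2 * pi / real m))"
proof -
  have m: "real m \<ge> 5" using assms by simp
  have "2 * pi / real m < pi / 2" using m pi_gt_zero by (simp add: field_simps)
  moreover have "0 < 2 * pi / real m" using m pi_gt_zero by simp
  ultimately show 1: "0 < cos (2 * pi / real m)" by (intro cos_gt_zero) auto
  have "2 * pi / real m < 2 * pi" using m pi_gt_zero by (simp add: field_simps)
  then show "cos (2 * pi / real m) < 1"
    using \<open>0 < 2 * pi / real m\<close> \<open>2 * pi / real m < pi / 2\<close>
      cos_monotone_0_pi[of 0 "2 * pi / real m"] pi_gt_zero by auto
  have "1 + cos (2 * pi / real m) = 2 * (cos (pi / real m))\<^sup>2"
    using cos_double_cos[of "pi / real m"] by simp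
  then show "(vertex_radius m)\<^sup>2 = 2 * cos (2 * pi / real m) / (1 + cos (2 * pi / real m))"
    using 1 by (simp add: vertex_radius_def power_divide)
qed

lemma vertex_inner:
  "vertex m j \<bullet> vertex m k = (vertex_radius m)\<^sup>2 * cos (2 * pi * (real j - real k) / real m)"
  by (simp add: vertex_def inner_complex_def diff_divide_distrib right_diff_distrib cos_diff
      power2_eq_square algebra_simps)

lemma norm_vertex: "(norm (vertex m k))\<^sup>2 = (vertex_radius m)\<^sup>2"
  by (simp add: vertex_def)

lemma vertex_in_disc:
  assumes "m \<ge> 5"
  shows "norm (vertex m k) < 1"
proof -
  have "(norm (vertex m k))\<^sup>2 < 1\<^sup>2"
    using cos_pos[OF assms] cos_less_1[OF assms]
    by (simp add: norm_vertex vertex_radius_sq[OF assms])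
  then show ?thesis by (rule power2_less_imp_less) simp
qed

lemma side_length:
  assumes "m \<ge> 5"
  shows "hyp_dist (vertex m k) (vertex m (Suc k)) = arcosh (1 + 2 * cos (2 * pi / real m))"
proof -
  define c where "c = cos (2 * pi / real m)"
  have c: "0 < c" "c < 1" and r: "(vertex_radius m)\<^sup>2 = 2 * c / (1 + c)"
    using cos_pos cos_less_1 vertex_radius_sq assms by (auto simp: c_def)
  have r1: "1 - (vertex_radius m)\<^sup>2 = (1 - c) / (1 + c)"
    using c by (simp add: r field_simps)
  have "vertex m k \<bullet> vertex m (Suc k) = (vertex_radius m)\<^sup>2 * c"
    by (simp add: vertex_inner c_def)
  then have "hyp_dist (vertex m k) (vertex m (Suc k)) =
      arcosh ((1 - 2 * c / (1 + c) * c) / ((1 - c) / (1 + c)))"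
    using c by (simp add: hyp_dist_def norm_vertex r1 flip: r)
  also have "(1 - 2 * c / (1 + c) * c) / ((1 - c) / (1 + c)) = 1 + 2 * c"
    using c by (simp add: divide_simps) (simp add: algebra_simps power2_eq_square)
  finally show ?thesis by (simp add: c_def)
qed

text \<open>
  Right angles at the vertices, expressed by the hyperbolic theorem of Pythagoras (the
  case \<open>\<gamma> = \<pi>/2\<close> of \<open>cosh c = cosh a cosh b - sinh a sinh b cos \<gamma>\<close>).
\<close>

lemma right_angle:
  assumes "m \<ge> 5"
  shows "cosh (hyp_dist (vertex m k) (vertex m (k + 2))) =
         cosh (hyp_dist (vertex m k) (vertex m (k + 1))) *
         cosh (hyp_dist (vertex m (k + 1)) (vertex m (k + 2)))"
proof -
  define c where "c = cos (2 * pi / real m)"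
  have c: "0 < c" "c < 1" and r: "(vertex_radius m)\<^sup>2 = 2 * c / (1 + c)"
    using cos_pos cos_less_1 vertex_radius_sq assms by (auto simp: c_def)
  have r1: "1 - (vertex_radius m)\<^sup>2 = (1 - c) / (1 + c)"
    using c by (simp add: r field_simps)
  have "cos (4 * pi / real m) = 2 * c\<^sup>2 - 1"
    using cos_double_cos[of "2 * pi / real m"] by (simp add: c_def)
  then have "vertex m k \<bullet> vertex m (k + 2) = (vertex_radius m)\<^sup>2 * (2 * c\<^sup>2 - 1)"
    by (simp add: vertex_inner)
  then have "hyp_dist (vertex m k) (vertex m (k + 2)) =
      arcosh ((1 - 2 * c / (1 + c) * (2 * c\<^sup>2 - 1)) / ((1 - c) / (1 + c)))"
    using c by (simp add: hyp_dist_def norm_vertex r1 flip: r)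
  also have "(1 - 2 * c / (1 + c) * (2 * c\<^sup>2 - 1)) / ((1 - c) / (1 + c)) = (1 + 2 * c)\<^sup>2"
    using c by (simp add: divide_simps) (simp add: algebra_simps power2_eq_square)
  finally have "cosh (hyp_dist (vertex m k) (vertex m (k + 2))) = (1 + 2 * c)\<^sup>2"
    using c by (simp add: cosh_arcosh_real)
  then show ?thesis
    using side_length[OF assms, of k] side_length[OF assms, of "k + 1"] c
    by (simp add: cosh_arcosh_real power2_eq_square flip: c_def)
qed


section \<open>The surface\<close>

text \<open>
  An element of \<open>(\<int>/2)^m\<close> is represented by its support, a subset of \<open>{..<m}\<close>;
  adding the basis vector \<open>e_i\<close> is symmetric difference with \<open>{i}\<close>.
  The pair \<open>(v, x)\<close> is the point \<open>x\<close> of the copy \<open>P_v\<close>.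
\<close>

type_synonym tile_point = "nat set \<times> complex"
type_synonym surface_point = "tile_point set"

definition tiles_space :: "nat \<Rightarrow> tile_point topology" where
  "tiles_space m = prod_topology (discrete_topology (Pow {..<m})) (top_of_set (polygon m))"

definition glue :: "nat \<Rightarrow> (tile_point \<times> tile_point) set" where
  "glue m = {((v, x), (sym_diff v {i}, x)) | v x i. v \<subseteq> {..<m} \<and> i < m \<and> x \<in> polygon_side m i}"

text \<open>The relation \<open>glue m\<close> is symmetric, so its reflexive transitive closure is the
  equivalence relation it generates.\<close>

definition tile_class :: "nat \<Rightarrow> tile_point \<Rightarrow> surface_point" where
  "tile_class m p = (glue m)\<^sup>* `` {p}"

definition quotient_topology :: "'a topology \<Rightarrow> ('a \<Rightarrow> 'b) \<Rightarrow> 'b topology" where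
  "quotient_topology X q =
     topology (\<lambda>U. U \<subseteq> q ` topspace X \<and> openin X {x \<in> topspace X. q x \<in> U})"

lemma openin_quotient_topology:
  "openin (quotient_topology X q) U \<longleftrightarrow>
     U \<subseteq> q ` topspace X \<and> openin X {x \<in> topspace X. q x \<in> U}"
proof -
  have "istopology (\<lambda>U. U \<subseteq> q ` topspace X \<and> openin X {x \<in> topspace X. q x \<in> U})"
    unfolding istopology_def
  proof (intro conjI allI impI)
    fix S T
    assume "S \<subseteq> q ` topspace X \<and> openin X {x \<in> topspace X. q x \<in> S}"
      and "T \<subseteq> q ` topspace X \<and> openin X {x \<in> topspace X. q x \<in> T}"
    moreover have "{x \<in> topspace X. q x \<in> S \<inter> T} =
        {x \<in> topspace X. q x \<in> S} \<inter> {x \<in> topspace X. q x \<in> T}" by auto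
    ultimately show "S \<inter> T \<subseteq> q ` topspace X" "openin X {x \<in> topspace X. q x \<in> S \<inter> T}"
      by auto
  next
    fix K
    assume K: "\<forall>S\<in>K. S \<subseteq> q ` topspace X \<and> openin X {x \<in> topspace X. q x \<in> S}"
    then show "\<Union> K \<subseteq> q ` topspace X" by blast
    have "{x \<in> topspace X. q x \<in> \<Union> K} = (\<Union>S\<in>K. {x \<in> topspace X. q x \<in> S})" by auto
    then show "openin X {x \<in> topspace X. q x \<in> \<Union> K}" using K by auto
  qed
  then show ?thesis by (simp add: quotient_topology_def topology_inverse')
qed

definition surface :: "nat \<Rightarrow> surface_point topology" where
  "surface m = quotient_topology (tiles_space m) (tile_class m)"

definition edge_union :: "nat \<Rightarrow> surface_point set" where
  "edge_union m = {tile_class m (v, x) | v x i. v \<subseteq> {..<m} \<and> i < m \<and> x \<in> polygon_side m i}"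


section \<open>The hyperbolic metric and closed geodesics\<close>

text \<open>
  The metric on the surface is the one obtained by gluing the hyperbolic polygons: the distance
  is the infimum of the lengths of chains of hyperbolic segments, each lying in one
  polygon \<open>P_v\<close>.
\<close>

inductive segment_chain :: "nat \<Rightarrow> surface_point \<Rightarrow> surface_point \<Rightarrow> real \<Rightarrow> bool"
  for m :: nat and a :: surface_point where
  start: "a \<in> topspace (surface m) \<Longrightarrow> segment_chain m a a 0"
| step: "\<lbrakk>segment_chain m a (tile_class m (v, x)) l; v \<subseteq> {..<m}; x \<in> polygon m; y \<in> polygon m\<rbrakk>
         \<Longrightarrow> segment_chain m a (tile_class m (v, y)) (l + hyp_dist x y)"

definition surface_dist :: "nat \<Rightarrow> surface_point \<Rightarrow> surface_point \<Rightarrow> real" where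
  "surface_dist m a b = Inf {l. segment_chain m a b l}"

text \<open>Unit-speed geodesics, i.e. locally distance-preserving maps from the real line.\<close>

definition geodesic_line :: "nat \<Rightarrow> (real \<Rightarrow> surface_point) \<Rightarrow> bool" where
  "geodesic_line m \<gamma> \<longleftrightarrow>
     (\<forall>t. \<gamma> t \<in> topspace (surface m)) \<and>
     (\<forall>t. \<exists>\<epsilon>>0. \<forall>s\<in>ball t \<epsilon>. \<forall>s'\<in>ball t \<epsilon>. surface_dist m (\<gamma> s) (\<gamma> s') = \<bar>s - s'\<bar>)"

text \<open>\<open>L\<close> is required to be the least period, so that the geodesic is traversed exactly
  once by \<open>\<gamma>\<close> on \<open>{0..L}\<close>.\<close>

definition closed_geodesic :: "nat \<Rightarrow> (real \<Rightarrow> surface_point) \<Rightarrow> real \<Rightarrow> bool" where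
  "closed_geodesic m \<gamma> L \<longleftrightarrow>
     geodesic_line m \<gamma> \<and> L > 0 \<and> (\<forall>t. \<gamma> (t + L) = \<gamma> t) \<and>
     (\<forall>T. 0 < T \<and> T < L \<longrightarrow> (\<exists>t. \<gamma> (t + T) \<noteq> \<gamma> t))"

text \<open>Unoriented, unparametrised geodesics are identified with the curves they trace.\<close>

definition edge_geodesics :: "nat \<Rightarrow> surface_point set set" where
  "edge_geodesics m = {range \<gamma> | \<gamma> L. closed_geodesic m \<gamma> L \<and> range \<gamma> \<subseteq> edge_union m}"


section \<open>Singular homology with rational coefficients\<close>

abbreviation rat_field :: "rat ring" where
  "rat_field \<equiv> \<lparr>carrier = UNIV, mult = (*), one = 1, zero = 0, add = (+)\<rparr>"

type_synonym 'a rat_chain = "((nat \<Rightarrow> real) \<Rightarrow> 'a) \<Rightarrow>\<^sub>0 rat"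

definition rat_chains :: "nat \<Rightarrow> 'a topology \<Rightarrow> 'a rat_chain set" where
  "rat_chains p X = {c. Poly_Mapping.keys c \<subseteq> singular_simplex_set p X}"

definition rat_boundary :: "nat \<Rightarrow> 'a rat_chain \<Rightarrow> 'a rat_chain" where
  "rat_boundary p c =
     (if p = 0 then 0 else
      \<Sum>f\<in>Poly_Mapping.keys c. \<Sum>k\<le>p.
        Poly_Mapping.single (singular_face p k f) ((-1) ^ k * Poly_Mapping.lookup c f))"

definition rat_cycle_space :: "nat \<Rightarrow> 'a topology \<Rightarrow> (rat, 'a rat_chain) module" where
  "rat_cycle_space p X =
     \<lparr>carrier = {c \<in> rat_chains p X. rat_boundary p c = 0},
      mult = undefined, one = undefined, zero = 0, add = (+),
      smult = (\<lambda>r. Poly_Mapping.map ((*) r))\<rparr>"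

definition rat_boundaries :: "nat \<Rightarrow> 'a topology \<Rightarrow> 'a rat_chain set" where
  "rat_boundaries p X = rat_boundary (Suc p) ` rat_chains (Suc p) X"

definition quotient_space :: "('r, 'a) module \<Rightarrow> 'a set \<Rightarrow> ('r, 'a set) module" where
  "quotient_space V B =
     \<lparr>carrier = a_rcosets\<^bsub>V\<^esub> B, mult = undefined, one = undefined, zero = B,
      add = set_add V, smult = (\<lambda>r A. \<Union>a\<in>A. B +>\<^bsub>V\<^esub> (r \<odot>\<^bsub>V\<^esub> a))\<rparr>"

definition rat_homology :: "nat \<Rightarrow> 'a topology \<Rightarrow> (rat, 'a rat_chain set) module" where
  "rat_homology p X = quotient_space (rat_cycle_space p X) (rat_boundaries p X)"

definition rat_homology_class :: "nat \<Rightarrow> 'a topology \<Rightarrow> 'a rat_chain \<Rightarrow> 'a rat_chain set" where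
  "rat_homology_class p X c = rat_boundaries p X +>\<^bsub>rat_cycle_space p X\<^esub> c"

text \<open>The singular 1-simplex \<open>(1 - t, t) \<mapsto> \<gamma> (L t)\<close>, as a chain.\<close>

definition loop_chain :: "(real \<Rightarrow> 'a) \<Rightarrow> real \<Rightarrow> 'a rat_chain" where
  "loop_chain \<gamma> L = Poly_Mapping.single (restrict (\<lambda>x. \<gamma> (L * x 1)) (standard_simplex 1)) 1"

definition span_dim :: "(rat, 'a) module \<Rightarrow> 'a set \<Rightarrow> nat" where
  "span_dim V A =
     vectorspace.dim rat_field (V\<lparr>carrier := LinearCombinations.module.span rat_field V A\<rparr>)"

end

theory Submission
  imports Defs
begin

text \<open>
  The group \<open>(\<int>/2)^m\<close> acts on the surface with quotient the polygon, so rational chains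
  split into isotypic parts indexed by its characters, i.e. by subsets \<open>A\<close> of the sides. A geodesic
  made of edges goes straight on at every vertex, hence consists of four copies of one side \<open>i\<close>; it has a
  nonzero component at \<open>A\<close> only if \<open>i\<close> is an isolated gap of \<open>A\<close>, that is \<open>i \<notin> A\<close> but both neighbours of
  \<open>i\<close> lie in \<open>A\<close>. For a fixed \<open>A\<close> the only relation between these components comes from the boundary
  of the signed sum of all tiles, and it involves only isolated gaps exactly if every gap of \<open>A\<close> is
  isolated. Independence of the remaining components is detected by maps to the circle
  of the form \<open>(v, x) \<mapsto> exp (\<plusminus> 2 \<pi> \<i> u x)\<close>, where \<open>u\<close> is 0 or 1/2 on every side in \<open>A\<close> and
  the sign is the character. The dimension is the number of remaining pairs \<open>(A, i)\<close>.
\<close>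

section \<open>Rational chains and linear algebra of the homology quotient\<close>

text \<open>The geodesics are given metrically, as local isometries of the real line with trace in
  the edges, each with an arbitrary parametrization. The algebra therefore rests on a
  classification: such a curve is a straight line of edges up to shift and reversal. The obstacle is
  that the distance is an infimum over chains of segments through arbitrarily many tiles; it is
  bounded from below by comparison with the hyperbolic lines carrying the sides. Homology is
  singular throughout. Relations come from explicit 2-simplices over convex parameter sets,
  independence from winding numbers of maps to the punctured plane, so no cell structure has to be
  compared with singular chains. Origin of the numbers: there are m * 2^(m-3) pairs of a set A and
  an isolated gap of A. One pair is dropped for each A that has gaps, all of them isolated; these
  gap sets are the nonempty independent sets of the m-cycle, L_m - 1 in number with L_m the Lucas
  number. This gives 20 - 10, 48 - 17, 112 - 28 and 256 - 46.\<close>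

definition rat_scale :: "rat \<Rightarrow> 'a rat_chain \<Rightarrow> 'a rat_chain" where
  "rat_scale r = Poly_Mapping.map ((*) r)"

lemma lookup_rat_scale [simp]:
  "Poly_Mapping.lookup (rat_scale r c) f = r * Poly_Mapping.lookup c f"
  by (simp add: rat_scale_def Poly_Mapping.map.rep_eq when_def)

lemma rat_scale_simps [simp]:
  "rat_scale 0 c = 0" "rat_scale 1 c = c" "rat_scale r 0 = 0"
  "rat_scale r (rat_scale s c) = rat_scale (r * s) c"
  "rat_scale (- 1) c = - c" "rat_scale r (Poly_Mapping.single f s) = Poly_Mapping.single f (r * s)"
  by (rule poly_mapping_eqI; simp add: lookup_single when_def)+

lemma rat_scale_add_left: "rat_scale (r + s) c = rat_scale r c + rat_scale s c"
  by (rule poly_mapping_eqI) (simp add: lookup_add algebra_simps)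

lemma rat_scale_add_right: "rat_scale r (c + d) = rat_scale r c + rat_scale r d"
  by (rule poly_mapping_eqI) (simp add: lookup_add algebra_simps)

lemma rat_scale_diff_right: "rat_scale r (c - d) = rat_scale r c - rat_scale r d"
  by (rule poly_mapping_eqI) (simp add: lookup_minus algebra_simps)

lemma rat_scale_sum: "rat_scale r (\<Sum>i\<in>I. c i) = (\<Sum>i\<in>I. rat_scale r (c i))"
  by (induction I rule: infinite_finite_induct) (auto simp: rat_scale_add_right)

lemma keys_rat_scale: "Poly_Mapping.keys (rat_scale r c) \<subseteq> Poly_Mapping.keys c"
  by (auto simp: in_keys_iff)

lemma sum_rat_scale_const: "(\<Sum>i\<in>I. rat_scale (r i) c) = rat_scale (\<Sum>i\<in>I. r i) c"
  by (induction I rule: infinite_finite_induct) (auto simp: rat_scale_add_left)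

lemma linear_extension_superset:
  fixes W :: "'k \<Rightarrow> rat \<Rightarrow> 'b::comm_monoid_add"
  assumes "finite S" "Poly_Mapping.keys c \<subseteq> S" "\<And>f. W f 0 = 0"
  shows "(\<Sum>f\<in>Poly_Mapping.keys c. W f (Poly_Mapping.lookup c f)) =
         (\<Sum>f\<in>S. W f (Poly_Mapping.lookup c f))"
  using assms by (intro sum.mono_neutral_left) (auto simp: in_keys_iff)

text \<open>Cancellation can make the support of \<open>c + d\<close> smaller than those of
  \<open>c\<close> and \<open>d\<close>. All three sums are therefore taken over one common finite
  superset, where the extra terms vanish. It serves the boundary and the winding numbers
  alike.\<close>

lemma linear_extension_add:
  fixes W :: "'k \<Rightarrow> rat \<Rightarrow> 'b::ab_group_add"
  assumes "\<And>f a b. W f (a + b) = W f a + W f b"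
  shows "(\<Sum>f\<in>Poly_Mapping.keys (c + d). W f (Poly_Mapping.lookup (c + d) f)) =
         (\<Sum>f\<in>Poly_Mapping.keys c. W f (Poly_Mapping.lookup c f)) +
         (\<Sum>f\<in>Poly_Mapping.keys d. W f (Poly_Mapping.lookup d f))"
proof -
  define S where "S = Poly_Mapping.keys c \<union> Poly_Mapping.keys d"
  have W0: "W f 0 = 0" for f using assms[of f 0 0] by simp
  have S: "finite S" "Poly_Mapping.keys c \<subseteq> S" "Poly_Mapping.keys d \<subseteq> S"
    "Poly_Mapping.keys (c + d) \<subseteq> S"
    using Poly_Mapping.keys_add[of c d] by (auto simp: S_def)
  show ?thesis
    using linear_extension_superset[of S c W, OF S(1,2) W0]
      linear_extension_superset[of S d W, OF S(1,3) W0]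
      linear_extension_superset[of S "c + d" W, OF S(1,4) W0]
    by (simp add: lookup_add assms sum.distrib)
qed

lemma rat_boundary_add: "rat_boundary p (c + d) = rat_boundary p c + rat_boundary p d"
proof (cases "p = 0")
  case False
  have eq: "rat_boundary p c = (\<Sum>f\<in>Poly_Mapping.keys c.
     (\<lambda>f a. \<Sum>k\<le>p. Poly_Mapping.single (singular_face p k f) ((-1) ^ k * a)) f
        (Poly_Mapping.lookup c f))" for c :: "'a rat_chain"
    using False by (simp add: rat_boundary_def)
  show ?thesis unfolding eq
    by (rule linear_extension_add) (simp add: single_add distrib_left sum.distrib)
qed (simp add: rat_boundary_def)

lemma rat_boundary_scale: "rat_boundary p (rat_scale r c) = rat_scale r (rat_boundary p c)"
proof (cases "p = 0")
  case False
  have "rat_boundary p (rat_scale r c) = (\<Sum>f\<in>Poly_Mapping.keys c. \<Sum>k\<le>p.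
      Poly_Mapping.single (singular_face p k f) ((-1) ^ k * Poly_Mapping.lookup (rat_scale r c) f))"
    unfolding rat_boundary_def using False keys_rat_scale[of r c]
    by (simp, intro sum.mono_neutral_left) (auto simp: in_keys_iff)
  also have "\<dots> = rat_scale r (rat_boundary p c)"
    using False by (simp add: rat_boundary_def rat_scale_sum mult_ac)
  finally show ?thesis .
qed (simp add: rat_boundary_def)

lemma rat_boundary_0 [simp]: "rat_boundary p 0 = 0"
  by (simp add: rat_boundary_def)

lemma rat_boundary_sum: "rat_boundary p (\<Sum>i\<in>I. c i) = (\<Sum>i\<in>I. rat_boundary p (c i))"
  by (induction I rule: infinite_finite_induct) (auto simp: rat_boundary_add)

lemma rat_boundary_single:
  "p > 0 \<Longrightarrow> rat_boundary p (Poly_Mapping.single f r) =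
     (\<Sum>k\<le>p. Poly_Mapping.single (singular_face p k f) ((-1) ^ k * r))"
  by (cases "r = 0") (auto simp: rat_boundary_def)

lemma rat_chain_expand: "c = (\<Sum>f\<in>Poly_Mapping.keys c. Poly_Mapping.single f (Poly_Mapping.lookup c f))"
  by (rule poly_mapping_eqI) (auto simp: lookup_sum lookup_single when_def in_keys_iff)

lemma rat_chains_0 [simp]: "0 \<in> rat_chains p X"
  by (simp add: rat_chains_def)

lemma rat_chains_add: "c \<in> rat_chains p X \<Longrightarrow> d \<in> rat_chains p X \<Longrightarrow> c + d \<in> rat_chains p X"
  using Poly_Mapping.keys_add[of c d] by (auto simp: rat_chains_def)

lemma rat_chains_scale: "c \<in> rat_chains p X \<Longrightarrow> rat_scale r c \<in> rat_chains p X"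
  using keys_rat_scale[of r c] by (auto simp: rat_chains_def)

lemma rat_chains_single: "singular_simplex p X f \<Longrightarrow> Poly_Mapping.single f r \<in> rat_chains p X"
  by (simp add: rat_chains_def)

lemma rat_chains_sum: "(\<And>i. i \<in> I \<Longrightarrow> c i \<in> rat_chains p X) \<Longrightarrow> (\<Sum>i\<in>I. c i) \<in> rat_chains p X"
  by (induction I rule: infinite_finite_induct) (auto intro: rat_chains_add)

lemma rat_boundary_in_chains:
  assumes "c \<in> rat_chains (Suc p) X"
  shows "rat_boundary (Suc p) c \<in> rat_chains p X"
proof -
  have "singular_simplex p X (singular_face (Suc p) k f)"
    if "f \<in> Poly_Mapping.keys c" "k \<le> Suc p" for f k
    using singular_simplex_singular_face[of "Suc p" X f k] assms that
    by (auto simp: rat_chains_def)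
  then have "(\<Sum>f\<in>Poly_Mapping.keys c. \<Sum>k\<le>Suc p. Poly_Mapping.single (singular_face (Suc p) k f)
      ((-1) ^ k * Poly_Mapping.lookup c f)) \<in> rat_chains p X"
    by (intro rat_chains_sum rat_chains_single) auto
  then show ?thesis unfolding rat_boundary_def by simp
qed

text \<open>The simplicial identity d_j d_k = d_(k-1) d_j for j < k makes the six double faces of a
  triangle cancel in pairs.\<close>

lemma rat_boundary_boundary_2: "rat_boundary 1 (rat_boundary 2 c) = 0"
proof -
  have face: "singular_face 1 j (singular_face 2 k f) = singular_face 1 (k - 1) (singular_face 2 j f)"
    if "j < k" "k \<le> 2" for j k and f :: "(nat \<Rightarrow> real) \<Rightarrow> 'a"
  proof
    fix t :: "nat \<Rightarrow> real"
    have "simplical_face k (simplical_face j t) = simplical_face j (simplical_face (k - 1) t)"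
      using that by (auto simp: simplical_face_def fun_eq_iff)
    moreover have "simplical_face j t \<in> standard_simplex 1" "simplical_face (k - 1) t \<in> standard_simplex 1"
      if "t \<in> standard_simplex 0"
      using that \<open>j < k\<close> \<open>k \<le> 2\<close> by (auto intro!: simplical_face_in_standard_simplex)
    ultimately show "singular_face 1 j (singular_face 2 k f) t =
        singular_face 1 (k - 1) (singular_face 2 j f) t"
      by (simp add: singular_face_def)
  qed
  have "rat_boundary 1 (rat_boundary 2 (Poly_Mapping.single f r)) = 0"
    for f :: "(nat \<Rightarrow> real) \<Rightarrow> 'a" and r
  proof -
    have "rat_boundary 1 (rat_boundary 2 (Poly_Mapping.single f r)) = 
      (\<Sum>k\<le>2. \<Sum>j\<le>1. Poly_Mapping.single (singular_face 1 j (singular_face 2 k f)) 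
            ((-1) ^ j * ((-1) ^ k * r)))"
      by (simp add: rat_boundary_single rat_boundary_sum)
    also have "\<dots> = 0"
      using face[of 0 1] face[of 0 2] face[of 1 2] 
      by (simp add: numeral_2_eq_2 single_uminus)
    finally show ?thesis .
  qed
  then show ?thesis
    by (subst rat_chain_expand[of c]) (simp add: rat_boundary_sum)
qed

lemma rat_boundaries_subset: "rat_boundaries 1 X \<subseteq> carrier (rat_cycle_space 1 X)"
  using rat_boundary_in_chains[of _ 1 X] rat_boundary_boundary_2
  by (auto simp: rat_boundaries_def rat_cycle_space_def numeral_2_eq_2)

lemma rat_boundaries_closed:
  shows rat_boundaries_0: "0 \<in> rat_boundaries p X"
    and rat_boundaries_add: "\<lbrakk>a \<in> rat_boundaries p X; b \<in> rat_boundaries p X\<rbrakk> \<Longrightarrow> a + b \<in> rat_boundaries p X"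
    and rat_boundaries_scale: "a \<in> rat_boundaries p X \<Longrightarrow> rat_scale r a \<in> rat_boundaries p X"
proof -
  show "0 \<in> rat_boundaries p X"
    unfolding rat_boundaries_def by (rule image_eqI[of _ _ 0]) auto
qed (auto simp: rat_boundaries_def simp flip: rat_boundary_add rat_boundary_scale
      intro: rat_chains_add rat_chains_scale)

lemma rat_boundaries_uminus: "a \<in> rat_boundaries p X \<Longrightarrow> - a \<in> rat_boundaries p X"
  using rat_boundaries_scale[of a p X "-1"] by simp

abbreviation rat_cycles :: "nat \<Rightarrow> 'a topology \<Rightarrow> 'a rat_chain set" where
  "rat_cycles p X \<equiv> carrier (rat_cycle_space p X)"

lemma rat_cycles_iff: "c \<in> rat_cycles p X \<longleftrightarrow> c \<in> rat_chains p X \<and> rat_boundary p c = 0"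
  by (simp add: rat_cycle_space_def)

lemma rat_cycles_add: "\<lbrakk>c \<in> rat_cycles p X; d \<in> rat_cycles p X\<rbrakk> \<Longrightarrow> c + d \<in> rat_cycles p X"
  by (auto simp: rat_cycles_iff rat_boundary_add rat_chains_add)

lemma rat_cycles_scale: "c \<in> rat_cycles p X \<Longrightarrow> rat_scale r c \<in> rat_cycles p X"
  by (auto simp: rat_cycles_iff rat_boundary_scale rat_chains_scale)

lemma rat_cycles_0: "0 \<in> rat_cycles p X"
  by (auto simp: rat_cycles_iff)

lemma rat_cycles_sum: "(\<And>i. i \<in> I \<Longrightarrow> c i \<in> rat_cycles p X) \<Longrightarrow> (\<Sum>i\<in>I. c i) \<in> rat_cycles p X"
  by (induction I rule: infinite_finite_induct) (auto intro: rat_cycles_add rat_cycles_0)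

lemma rat_homology_class_eq: "rat_homology_class p X c = (\<lambda>b. b + c) ` rat_boundaries p X"
  by (auto simp: rat_homology_class_def a_r_coset_def r_coset_def rat_cycle_space_def)

lemma rat_homology_class_eqI:
  assumes "c - d \<in> rat_boundaries p X"
  shows "rat_homology_class p X c = rat_homology_class p X d"
proof -
  have "(\<lambda>b. b + c) ` rat_boundaries p X \<subseteq> (\<lambda>b. b + d) ` rat_boundaries p X"
    if "c - d \<in> rat_boundaries p X" for c d
  proof
    fix x assume "x \<in> (\<lambda>b. b + c) ` rat_boundaries p X"
    then obtain b where "b \<in> rat_boundaries p X" "x = b + c" by auto
    then show "x \<in> (\<lambda>b. b + d) ` rat_boundaries p X"
      using that by (intro image_eqI[of _ _ "b + (c - d)"] rat_boundaries_add) auto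
  qed
  from this[of c d] this[of d c] show ?thesis
    using assms rat_boundaries_uminus[OF assms] by (simp add: rat_homology_class_eq subset_antisym)
qed

lemma rat_homology_simps:
  shows carrier_rat_homology: "carrier (rat_homology p X) = rat_homology_class p X ` rat_cycles p X"
    and zero_rat_homology: "\<zero>\<^bsub>rat_homology p X\<^esub> = rat_homology_class p X 0"
    and add_rat_homology: "rat_homology_class p X c \<oplus>\<^bsub>rat_homology p X\<^esub> rat_homology_class p X d =
          rat_homology_class p X (c + d)"
    and smult_rat_homology: "r \<odot>\<^bsub>rat_homology p X\<^esub> rat_homology_class p X c =
          rat_homology_class p X (rat_scale r c)"
proof -
  show "carrier (rat_homology p X) = rat_homology_class p X ` rat_cycles p X"
    by (auto simp: rat_homology_def quotient_space_def A_RCOSETS_def RCOSETS_def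
        rat_homology_class_def a_r_coset_def)
  show "\<zero>\<^bsub>rat_homology p X\<^esub> = rat_homology_class p X 0"
    by (simp add: rat_homology_def quotient_space_def rat_homology_class_eq)
  have "set_add (rat_cycle_space p X) (rat_homology_class p X c) (rat_homology_class p X d) =
      {a + c + (b + d) | a b. a \<in> rat_boundaries p X \<and> b \<in> rat_boundaries p X}"
    unfolding set_add_def set_mult_def rat_homology_class_eq
    by (auto simp: rat_cycle_space_def) 
  also have "\<dots> = rat_homology_class p X (c + d)"
  proof (intro equalityI subsetI)
    fix x assume "x \<in> {a + c + (b + d) | a b. a \<in> rat_boundaries p X \<and> b \<in> rat_boundaries p X}"
    then obtain a b where "a \<in> rat_boundaries p X" "b \<in> rat_boundaries p X" "x = a + c + (b + d)"
      by auto
    then show "x \<in> rat_homology_class p X (c + d)"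
      by (auto simp: rat_homology_class_eq algebra_simps intro!: image_eqI[of _ _ "a + b"] rat_boundaries_add)
  next
    fix x assume "x \<in> rat_homology_class p X (c + d)"
    then obtain a where "a \<in> rat_boundaries p X" "x = a + c + (0 + d)"
      by (auto simp: rat_homology_class_eq algebra_simps)
    then show "x \<in> {a + c + (b + d) | a b. a \<in> rat_boundaries p X \<and> b \<in> rat_boundaries p X}"
      using rat_boundaries_0[of p X] by blast
  qed
  finally show "rat_homology_class p X c \<oplus>\<^bsub>rat_homology p X\<^esub> rat_homology_class p X d =
          rat_homology_class p X (c + d)"
    by (simp add: rat_homology_def quotient_space_def)
  have "r \<odot>\<^bsub>rat_homology p X\<^esub> rat_homology_class p X c =
      (\<Union>a\<in>rat_homology_class p X c. rat_homology_class p X (rat_scale r a))"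
    by (simp add: rat_homology_def quotient_space_def rat_homology_class_def rat_cycle_space_def
        rat_scale_def)
  \<comment> \<open>Scaling in the quotient is a union over all representatives \<open>a\<close>;
    each of them contributes the same coset.\<close>
  also have "\<dots> = (\<Union>a\<in>rat_homology_class p X c. rat_homology_class p X (rat_scale r c))"
  proof (rule SUP_cong[OF refl])
    fix a assume "a \<in> rat_homology_class p X c"
    then have "a - c \<in> rat_boundaries p X" by (auto simp: rat_homology_class_eq)
    then have "rat_scale r a - rat_scale r c \<in> rat_boundaries p X"
      by (simp add: rat_boundaries_scale flip: rat_scale_diff_right)
    then show "rat_homology_class p X (rat_scale r a) = rat_homology_class p X (rat_scale r c)"
      by (rule rat_homology_class_eqI)
  qed
  also have "\<dots> = rat_homology_class p X (rat_scale r c)"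
    using rat_boundaries_0[of p X] by (auto simp: rat_homology_class_eq)
  finally show "r \<odot>\<^bsub>rat_homology p X\<^esub> rat_homology_class p X c =
          rat_homology_class p X (rat_scale r c)" .
qed

section \<open>Homology as a rational vector space, and dimensions by dual functionals\<close>

lemma field_rat_field: "field rat_field"
proof -
  have "cring rat_field"
    by (rule cringI, rule abelian_groupI, auto simp: comm_monoid_def algebra_simps intro!: exI[of _ "- x" for x] monoid.intro)
      (auto intro!: comm_monoid.intro comm_monoid_axioms.intro monoid.intro simp: algebra_simps)
  then show ?thesis
  proof (rule cring.cring_fieldI2)
    fix a :: rat assume "a \<in> carrier rat_field" "a \<noteq> \<zero>\<^bsub>rat_field\<^esub>"
    then show "\<exists>b\<in>carrier rat_field. a \<otimes>\<^bsub>rat_field\<^esub> b = \<one>\<^bsub>rat_field\<^esub>"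
      by (auto intro!: exI[of _ "inverse a"])
  qed simp
qed

lemma vectorspace_rat_homology: "vectorspace rat_field (rat_homology p X)"
proof (rule vs_criteria, goal_cases)
  case 1 show ?case by (rule field_rat_field)
next
  case 4
  have "rat_homology_class p X c \<oplus>\<^bsub>rat_homology p X\<^esub> rat_homology_class p X (rat_scale (- 1) c) =
          \<zero>\<^bsub>rat_homology p X\<^esub>" for c
    by (simp add: add_rat_homology zero_rat_homology)
  then show ?case using rat_cycles_scale unfolding carrier_rat_homology by blast
qed (auto simp: rat_homology_simps rat_cycles_0 rat_cycles_add rat_cycles_scale algebra_simps
        rat_scale_add_left rat_scale_add_right)

text \<open>Applying \<open>\<Psi> i\<close> to a rational dependence isolates one coefficient times
  the nonzero number \<open>\<Psi> i (b i)\<close>. The functionals need only be linear over the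
  rationals, so they may take complex values, as winding numbers do.\<close>

lemma span_dim_eq_card:
  fixes V :: "(rat, 'b) module" and \<Psi> :: "'i \<Rightarrow> 'b \<Rightarrow> complex" and b :: "'i \<Rightarrow> 'b"
  assumes V: "vectorspace rat_field V"
    and A: "A \<subseteq> carrier V" and I: "finite I"
    and b: "\<And>i. i \<in> I \<Longrightarrow> b i \<in> LinearCombinations.module.span rat_field V A"
    and A_span: "A \<subseteq> LinearCombinations.module.span rat_field V (b ` I)"
    and \<Psi>_add: "\<And>i x y. \<lbrakk>i \<in> I; x \<in> carrier V; y \<in> carrier V\<rbrakk> \<Longrightarrow> \<Psi> i (x \<oplus>\<^bsub>V\<^esub> y) = \<Psi> i x + \<Psi> i y"
    and \<Psi>_smult: "\<And>i r x. \<lbrakk>i \<in> I; x \<in> carrier V\<rbrakk> \<Longrightarrow> \<Psi> i (r \<odot>\<^bsub>V\<^esub> x) = of_rat r * \<Psi> i x"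
    and \<Psi>_diag: "\<And>i. i \<in> I \<Longrightarrow> \<Psi> i (b i) \<noteq> 0"
    and \<Psi>_off: "\<And>i j. \<lbrakk>i \<in> I; j \<in> I; i \<noteq> j\<rbrakk> \<Longrightarrow> \<Psi> i (b j) = 0"
  shows "span_dim V A = card I"
proof -
  interpret V: vectorspace rat_field V by (rule V)
  have sub: "subspace rat_field (V.span A) V" by (rule V.span_is_subspace[OF A])
  then have submod: "submodule rat_field (V.span A) V" by (simp add: subspace_def)
  interpret W: vectorspace rat_field "V\<lparr>carrier := V.span A\<rparr>"
    by (rule V.subspace_is_vs[OF sub])
  have bA: "b ` I \<subseteq> V.span A" using b by blast
  have bV: "b ` I \<subseteq> carrier V" using bA V.span_is_subset2[OF A] by blast
  have span_b: "V.span (b ` I) = V.span A"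
  proof
    show "V.span (b ` I) \<subseteq> V.span A" by (rule V.span_is_subset[OF bA submod])
    show "V.span A \<subseteq> V.span (b ` I)"
      by (rule V.span_is_subset[OF A_span V.span_is_submodule[OF bV]])
  qed
  have \<Psi>_zero: "\<Psi> i \<zero>\<^bsub>V\<^esub> = 0" if "i \<in> I" for i
    using \<Psi>_add[OF that V.zero_closed V.zero_closed] by simp
  have \<Psi>_sum: "\<Psi> i (finsum V f S) = (\<Sum>x\<in>S. \<Psi> i (f x))"
    if "i \<in> I" "finite S" "f \<in> S \<rightarrow> carrier V" for i f and S :: "'b set"
    using that(2,3)
    by (induct S rule: finite_induct) (auto simp: \<open>i \<in> I\<close> \<Psi>_zero \<Psi>_add Pi_iff)
  have lin_indpt: "V.lin_indpt (b ` I)"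
  proof
    assume "V.lin_dep (b ` I)"
    then obtain S a v where S: "finite S" "S \<subseteq> b ` I" "V.lincomb a S = \<zero>\<^bsub>V\<^esub>" "v \<in> S"
      "a v \<noteq> 0"
      unfolding V.lin_dep_def by auto
    then obtain i where i: "i \<in> I" "v = b i" by auto
    have "0 = \<Psi> i (V.lincomb a S)"
      using S(3) \<Psi>_zero[OF i(1)] by simp
    also have "\<dots> = (\<Sum>x\<in>S. \<Psi> i (a x \<odot>\<^bsub>V\<^esub> x))"
      unfolding V.lincomb_def using S bV i(1) by (intro \<Psi>_sum) (auto intro!: V.smult_closed)
    also have "\<dots> = (\<Sum>x\<in>S. if x = v then of_rat (a v) * \<Psi> i v else 0)"
    proof (rule sum.cong[OF refl])
      fix x assume "x \<in> S"
      then obtain j where "j \<in> I" "x = b j" "x \<in> carrier V" using S bV by blast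
      then show "\<Psi> i (a x \<odot>\<^bsub>V\<^esub> x) = (if x = v then of_rat (a v) * \<Psi> i v else 0)"
        using i \<Psi>_off by (auto simp: \<Psi>_smult)
    qed
    also have "\<dots> = of_rat (a v) * \<Psi> i v" using S by simp
    finally show False using S(5) \<Psi>_diag[OF i(1)] i(2) by simp
  qed
  have "inj_on b I"
    using \<Psi>_diag \<Psi>_off by (metis inj_onI)
  have "W.basis (b ` I)"
    unfolding W.basis_def
    using V.span_li_not_depend[OF bA submod] lin_indpt span_b bA by simp
  then have "W.dim = card (b ` I)" using I by (intro W.dim_basis) auto
  then show ?thesis
    by (simp add: span_dim_def card_image[OF \<open>inj_on b I\<close>])
qed

declare One_nat_def [simp del]

section \<open>Chains modulo boundaries, and singular segments over convex sets\<close>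

definition homologous :: "'a topology \<Rightarrow> 'a rat_chain \<Rightarrow> 'a rat_chain \<Rightarrow> bool" where
  "homologous X c d \<longleftrightarrow> c - d \<in> rat_boundaries 1 X"

lemma homologous_refl [simp]: "homologous X c c"
  by (simp add: homologous_def rat_boundaries_0)

lemma homologous_sym: "homologous X c d \<Longrightarrow> homologous X d c"
  using rat_boundaries_uminus[of "c - d"] by (simp add: homologous_def)

lemma homologous_trans [trans]: "homologous X c d \<Longrightarrow> homologous X d e \<Longrightarrow> homologous X c e"
  using rat_boundaries_add[of "c - d" 1 X "d - e"] by (simp add: homologous_def)

lemma homologous_add: "homologous X c d \<Longrightarrow> homologous X c' d' \<Longrightarrow> homologous X (c + c') (d + d')"
  using rat_boundaries_add[of "c - d" 1 X "c' - d'"] by (simp add: homologous_def algebra_simps)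

lemma homologous_scale: "homologous X c d \<Longrightarrow> homologous X (rat_scale r c) (rat_scale r d)"
  using rat_boundaries_scale[of "c - d" 1 X r] by (simp add: homologous_def rat_scale_diff_right)

lemma homologous_uminus: "homologous X c d \<Longrightarrow> homologous X (- c) (- d)"
  using homologous_scale[of X c d "-1"] by simp

lemma homologous_sum:
  "(\<And>i. i \<in> I \<Longrightarrow> homologous X (c i) (d i)) \<Longrightarrow> homologous X (\<Sum>i\<in>I. c i) (\<Sum>i\<in>I. d i)"
  by (induction I rule: infinite_finite_induct) (auto intro: homologous_add)

lemma homologous_cycle: "homologous X c d \<Longrightarrow> d \<in> rat_cycles 1 X \<Longrightarrow> c \<in> rat_cycles 1 X"
  using rat_boundaries_subset[of X] rat_cycles_add[of "c - d" 1 X d] by (auto simp: homologous_def)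

lemma homologous_class:
  "homologous X c d \<Longrightarrow> rat_homology_class 1 X c = rat_homology_class 1 X d"
  unfolding homologous_def by (rule rat_homology_class_eqI)

text \<open>The parameter space is an arbitrary vector space because segments are taken both in a
  tile, inside the plane, and along a line of edges, parametrized by the reals.\<close>

definition segment_simplex :: "('b::real_vector \<Rightarrow> 'a) \<Rightarrow> 'b \<Rightarrow> 'b \<Rightarrow> (nat \<Rightarrow> real) \<Rightarrow> 'a" where
  "segment_simplex g a b = restrict (\<lambda>x. g (x 0 *\<^sub>R a + x 1 *\<^sub>R b)) (standard_simplex 1)"

definition path_chain :: "('b::real_vector \<Rightarrow> 'a) \<Rightarrow> 'b \<Rightarrow> 'b \<Rightarrow> 'a rat_chain" where
  "path_chain g a b = Poly_Mapping.single (segment_simplex g a b) 1"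

lemma standard_simplex_1_iff:
  "x \<in> standard_simplex 1 \<longleftrightarrow> 0 \<le> x 0 \<and> 0 \<le> x 1 \<and> x 0 + x 1 = 1 \<and> (\<forall>i>1. x i = 0)"
proof -
  have bounds: "0 \<le> x i \<and> x i \<le> 1"
    if "0 \<le> x 0" "0 \<le> x 1" "x 0 + x 1 = 1" "\<forall>i>1. x i = 0" for i
  proof -
    consider "i = 0" | "i = 1" | "i > 1" by linarith
    then show ?thesis using that by cases auto
  qed
  have sum: "(\<Sum>i\<le>1. x i) = x 0 + x 1" by (simp add: One_nat_def)
  show ?thesis unfolding standard_simplex_def mem_Collect_eq sum using bounds by blast
qed

lemma standard_simplex_2_iff:
  "x \<in> standard_simplex 2 \<longleftrightarrow>
     0 \<le> x 0 \<and> 0 \<le> x 1 \<and> 0 \<le> x 2 \<and> x 0 + x 1 + x 2 = 1 \<and> (\<forall>i>2. x i = 0)"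
proof -
  have bounds: "0 \<le> x i \<and> x i \<le> 1"
    if "0 \<le> x 0" "0 \<le> x 1" "0 \<le> x 2" "x 0 + x 1 + x 2 = 1" "\<forall>i>2. x i = 0" for i
  proof -
    consider "i = 0" | "i = 1" | "i = 2" | "i > 2" by linarith
    then show ?thesis using that by cases auto
  qed
  have sum: "(\<Sum>i\<le>2. x i) = x 0 + x 1 + x 2" by (simp add: numeral_2_eq_2 One_nat_def)
  show ?thesis unfolding standard_simplex_def mem_Collect_eq sum using bounds by blast
qed

lemma singular_simplexI:
  assumes "continuous_on (standard_simplex p) e" "e ` standard_simplex p \<subseteq> C"
    and "continuous_map (top_of_set C) X g"
  shows "singular_simplex p X (restrict (\<lambda>x. g (e x)) (standard_simplex p))"
proof -
  have "continuous_map (top_of_set (standard_simplex p)) (top_of_set C) e"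
    using assms(1,2) by (auto simp: continuous_map_in_subtopology)
  from continuous_map_compose[OF this assms(3)]
  have "continuous_map (top_of_set (standard_simplex p)) X (restrict (\<lambda>x. g (e x)) (standard_simplex p))"
    by (rule continuous_map_eq) simp
  then show ?thesis
    by (simp add: singular_simplex_def euclidean_product_topology)
qed

lemma continuous_on_coordinate [continuous_intros]: "continuous_on S (\<lambda>x :: nat \<Rightarrow> real. x i)"
  by (rule continuous_on_subset[OF continuous_on_product_coordinates]) simp

lemma rat_boundary_2_single:
  "rat_boundary 2 (Poly_Mapping.single f 1) = Poly_Mapping.single (singular_face 2 0 f) 1 -
     Poly_Mapping.single (singular_face 2 1 f) 1 + Poly_Mapping.single (singular_face 2 2 f) 1"
  by (simp add: rat_boundary_single) (simp add: numeral_2_eq_2 single_uminus One_nat_def)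

lemma homologous_2_simplex:
  assumes "singular_simplex 2 X f"
    and "singular_face 2 0 f = f0" "singular_face 2 1 f = f1" "singular_face 2 2 f = f2"
  shows "homologous X (Poly_Mapping.single f1 1) (Poly_Mapping.single f2 1 + Poly_Mapping.single f0 1)"
proof -
  have "rat_boundary 2 (Poly_Mapping.single f 1) \<in> rat_boundaries 1 X"
    using assms(1) by (auto simp: rat_boundaries_def numeral_2_eq_2 intro!: rat_chains_single)
  from rat_boundaries_uminus[OF this] show ?thesis
    by (simp add: homologous_def rat_boundary_2_single assms algebra_simps)
qed

lemma singular_face_2:
  assumes "k \<le> 2"
  shows "singular_face 2 k (restrict f (standard_simplex 2)) =
    restrict (\<lambda>x. f (simplical_face k x)) (standard_simplex 1)"
proof -
  have "singular_face 2 k f = restrict (\<lambda>x. f (simplical_face k x)) (standard_simplex 1)"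
    by (simp add: singular_face_def fun_eq_iff One_nat_def)
  then show ?thesis using assms by simp
qed

lemma simplical_face_012:
  fixes x :: "nat \<Rightarrow> real"
  shows "simplical_face 0 x 0 = 0" "simplical_face 0 x 1 = x 0" "simplical_face 0 x 2 = x 1"
    "simplical_face 1 x 0 = x 0" "simplical_face 1 x 1 = 0" "simplical_face 1 x 2 = x 1"
    "simplical_face 2 x 0 = x 0" "simplical_face 2 x 1 = x 1" "simplical_face 2 x 2 = 0"
  by (auto simp: simplical_face_def One_nat_def)

context
  fixes X :: "'a topology" and C :: "'b::real_normed_vector set" and g :: "'b \<Rightarrow> 'a"
  assumes C: "convex C" and g: "continuous_map (top_of_set C) X g"
begin

lemma convex_comb_3:
  assumes "a \<in> C" "b \<in> C" "c \<in> C" "x \<in> standard_simplex 2"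
  shows "x 0 *\<^sub>R a + x 1 *\<^sub>R b + x 2 *\<^sub>R c \<in> C"
proof -
  have "x 0 *\<^sub>R a + x 1 *\<^sub>R b + x 2 *\<^sub>R c \<in> convex hull {a, b, c}"
    using assms(4) unfolding convex_hull_3 standard_simplex_2_iff by blast
  then show ?thesis using hull_minimal[of "{a, b, c}" C convex] C assms by auto
qed

lemma convex_comb_2:
  assumes "a \<in> C" "b \<in> C" "x \<in> standard_simplex 1"
  shows "x 0 *\<^sub>R a + x 1 *\<^sub>R b \<in> C"
  using C assms by (auto simp: standard_simplex_1_iff convex_def)

lemma singular_segment_simplex:
  "a \<in> C \<Longrightarrow> b \<in> C \<Longrightarrow> singular_simplex 1 X (segment_simplex g a b)"
  unfolding segment_simplex_def
  by (rule singular_simplexI[OF _ _ g]) (auto intro!: continuous_intros convex_comb_2)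

text \<open>The affine triangle with corners \<open>a\<close>, \<open>b\<close>, \<open>c\<close>,
  composed with \<open>g\<close>, has exactly these three segments as faces; degenerate triangles
  are allowed.\<close>

lemma homologous_segment_split:
  assumes "a \<in> C" "b \<in> C" "c \<in> C"
  shows "homologous X (path_chain g a c) (path_chain g a b + path_chain g b c)"
  unfolding path_chain_def
proof (rule homologous_2_simplex)
  let ?f = "restrict (\<lambda>x. g (x 0 *\<^sub>R a + x 1 *\<^sub>R b + x 2 *\<^sub>R c)) (standard_simplex 2)"
  show "singular_simplex 2 X ?f"
    by (rule singular_simplexI[OF _ _ g]) (auto intro!: continuous_intros convex_comb_3 assms)
qed (simp_all del: singular_face_restrict add: singular_face_2 segment_simplex_def simplical_face_012)

text \<open>Splitting the constant segment at its own point shows that it is homologous to twice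
  itself.\<close>

lemma homologous_segment_refl: "a \<in> C \<Longrightarrow> homologous X (path_chain g a a) 0"
  using homologous_segment_split[of a a a] rat_boundaries_uminus[of "- path_chain g a a" 1 X]
  by (simp add: homologous_def)

lemma homologous_segment_reverse:
  assumes "a \<in> C" "b \<in> C"
  shows "homologous X (path_chain g b a) (- path_chain g a b)"
proof -
  have "homologous X (path_chain g a b + path_chain g b a) 0"
    by (rule homologous_trans[OF homologous_sym[OF homologous_segment_split] homologous_segment_refl])
      (use assms in auto)
  then show ?thesis by (simp add: homologous_def add.commute)
qed

lemma homologous_segment_polygon:
  assumes "\<And>k. k \<le> n \<Longrightarrow> p k \<in> C"
  shows "homologous X (\<Sum>k<n. path_chain g (p k) (p (Suc k))) (path_chain g (p 0) (p n))"
  using assms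
proof (induction n)
  case 0
  then show ?case using homologous_segment_refl homologous_sym by auto
next
  case (Suc n)
  have "homologous X (\<Sum>k<Suc n. path_chain g (p k) (p (Suc k)))
      (path_chain g (p 0) (p n) + path_chain g (p n) (p (Suc n)))"
    using Suc by (auto intro!: homologous_add)
  also have "homologous X \<dots> (path_chain g (p 0) (p (Suc n)))"
    by (rule homologous_sym, rule homologous_segment_split) (auto simp: Suc)
  finally show ?case .
qed

lemma homologous_segment_reparametrize:
  assumes ab: "a \<in> C" "b \<in> C" and \<phi>: "continuous_on {0..1} \<phi>" "\<phi> ` {0..1} \<subseteq> {0..1}"
    "\<phi> 0 = 0" "\<phi> 1 = (1::real)"
  shows "homologous X (Poly_Mapping.single (restrict (\<lambda>x. g ((1 - \<phi> (x 1)) *\<^sub>R a + \<phi> (x 1) *\<^sub>R b))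
           (standard_simplex 1)) 1) (path_chain g a b)"
proof -
  define P where "P t = max (\<phi> t - t) 0" for t
  define N where "N t = max (t - \<phi> t) 0" for t
  \<comment> \<open>\<open>F\<close> is \<open>x 1\<close> on face 1, constantly 0 on face 2 and
    \<open>\<phi> (x 1)\<close> on face 0. Face 1 has 1 - \<open>x 1\<close> = 1 and face 2 has
    \<open>x 2\<close> = 0, where \<open>P\<close> and \<open>N\<close> vanish, so there the minima
    kill the correction; on face 0 both arguments coincide and the full correction
    \<open>\<phi> t - t\<close> appears. The split into positive and negative part lets a minimum do
    this, and as nothing is divided, \<open>F\<close> is continuous at the corners too. Its value
    stays between \<open>x 2\<close> and \<open>\<phi> (x 2)\<close>.\<close>
  define F where "F x = x 2 + min (P (x 2)) (P (1 - x 1)) - min (N (x 2)) (N (1 - x 1))"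
    for x :: "nat \<Rightarrow> real"
  have P0: "P 0 = 0" "P 1 = 0" "N 0 = 0" "N 1 = 0" using \<phi> by (auto simp: P_def N_def)
  have PN: "P t \<ge> 0" "N t \<ge> 0" "t + P t - N t = \<phi> t" for t by (auto simp: P_def N_def)
  have contPN: "continuous_on {0..1} P" "continuous_on {0..1} N"
    unfolding P_def N_def by (auto intro!: continuous_intros \<phi>)
  have range: "x 2 \<in> {0..1}" "1 - x 1 \<in> {0..1}" if "x \<in> standard_simplex 2" for x
    using that by (auto simp: standard_simplex_2_iff)
  have cont: "continuous_on (standard_simplex 2) F"
    unfolding F_def
    by (intro continuous_intros continuous_on_compose2[OF contPN(1)] continuous_on_compose2[OF contPN(2)])
      (use range in auto)
  have F01: "F x \<in> {0..1}" if "x \<in> standard_simplex 2" for x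
  proof -
    have "\<phi> (x 2) \<in> {0..1}" using range(1)[OF that] \<phi>(2) by blast
    then show ?thesis using range(1)[OF that] PN(1,2)[of "1 - x 1"]
      unfolding F_def P_def N_def by (auto simp: min_def max_def)
  qed
  let ?f = "restrict (\<lambda>x. g ((1 - F x) *\<^sub>R a + F x *\<^sub>R b)) (standard_simplex 2)"
  have f: "singular_simplex 2 X ?f"
  proof (rule singular_simplexI[OF _ _ g])
    show "continuous_on (standard_simplex 2) (\<lambda>x. (1 - F x) *\<^sub>R a + F x *\<^sub>R b)"
      by (intro continuous_intros cont)
    show "(\<lambda>x. (1 - F x) *\<^sub>R a + F x *\<^sub>R b) ` standard_simplex 2 \<subseteq> C"
      using F01 C ab by (auto simp: convex_alt)
  qed
  have F0: "F (simplical_face 0 x) = \<phi> (x 1)" if "x \<in> standard_simplex 1" for x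
  proof -
    have "1 - x 0 = x 1" using that by (simp add: standard_simplex_1_iff)
    then show ?thesis using PN(3)[of "x 1"] by (simp add: F_def simplical_face_012)
  qed
  have F1: "F (simplical_face 1 x) = x 1" for x
    using PN[of "x 1"] by (simp add: F_def simplical_face_012 P0)
  have F2: "F (simplical_face 2 x) = 0" for x
    using PN[of "1 - x 1"] by (simp add: F_def simplical_face_012 P0)
  let ?\<phi> = "restrict (\<lambda>x. g ((1 - \<phi> (x 1)) *\<^sub>R a + \<phi> (x 1) *\<^sub>R b)) (standard_simplex 1)"
  have x01: "1 - x 1 = x 0" if "x \<in> standard_simplex 1" for x
    using that by (simp add: standard_simplex_1_iff)
  have "homologous X (Poly_Mapping.single (segment_simplex g a b) 1)
      (Poly_Mapping.single (segment_simplex g a a) 1 + Poly_Mapping.single ?\<phi> 1)"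
  proof (rule homologous_2_simplex[OF f])
    show "singular_face 2 0 ?f = ?\<phi>"
      by (simp del: singular_face_restrict add: singular_face_2 F0 cong: restrict_cong)
    show "singular_face 2 1 ?f = segment_simplex g a b"
      by (simp del: singular_face_restrict add: singular_face_2 F1 segment_simplex_def x01 cong: restrict_cong)
    show "singular_face 2 2 ?f = segment_simplex g a a"
      using x01
      by (simp del: singular_face_restrict add: singular_face_2 F2 segment_simplex_def standard_simplex_1_iff
          cong: restrict_cong flip: scaleR_add_left)
  qed
  also have "homologous X \<dots> (0 + Poly_Mapping.single ?\<phi> 1)"
    using homologous_segment_refl[OF ab(1)]
    by (intro homologous_add) (auto simp: path_chain_def)
  finally show ?thesis by (simp add: homologous_sym path_chain_def)
qed

end

section \<open>Winding functionals\<close>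

text \<open>Total change of a continuous logarithm along a path in the punctured plane, which is 2
  \<pi> \<i> times the winding number when the path is closed. Open paths get a value as well, so
  the functional can be evaluated edge by edge.\<close>

definition log_change :: "(real \<Rightarrow> complex) \<Rightarrow> complex" where
  "log_change p = (THE d. \<exists>k. continuous_on {0..1} k \<and> (\<forall>t\<in>{0..1}. p t = exp (k t)) \<and> d = k 1 - k 0)"

lemma log_change_eq:
  assumes k: "continuous_on {0..1} k" "\<And>t. t \<in> {0..1} \<Longrightarrow> p t = exp (k t)"
  shows "log_change p = k 1 - k 0"
  unfolding log_change_def
proof (rule the_equality)
  show "\<exists>l. continuous_on {0..1} l \<and> (\<forall>t\<in>{0..1}. p t = exp (l t)) \<and> k 1 - k 0 = l 1 - l 0"
    using k by blast
next
  fix d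
  assume "\<exists>l. continuous_on {0..1} l \<and> (\<forall>t\<in>{0..1}. p t = exp (l t)) \<and> d = l 1 - l 0"
  then obtain l where l: "continuous_on {0..1} l" "\<And>t. t \<in> {0..1} \<Longrightarrow> p t = exp (l t)" "d = l 1 - l 0"
    by blast
  have exp0: "exp (k 0) = exp (l 0)" using k(2)[of 0] l(2)[of 0] by simp
  have contp: "continuous_on {0..1} p"
    using continuous_on_exp[OF k(1)] by (rule continuous_on_eq) (simp add: k(2))
  \<comment> \<open>Shifted by this constant, \<open>l\<close> is a lift of \<open>p\<close> through
    the exponential that agrees with \<open>k\<close> at 0; lifts over a connected set that agree at
    one point coincide.\<close>
  have "l 1 + (k 0 - l 0) = k 1"
  proof (rule covering_space_lift_unique[OF covering_space_exp_punctured_plane, of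
        "\<lambda>t. l t + (k 0 - l 0)" 0 k "{0..1}" p 1])
    show "p x = exp (l x + (k 0 - l 0))" if "x \<in> {0..1}" for x
      using l(2)[OF that] exp0 by (simp add: exp_add exp_diff)
  qed (use k contp in \<open>auto intro!: continuous_intros l\<close>)
  then have "k 1 - k 0 = l 1 + (k 0 - l 0) - k 0" by simp
  then show "d = k 1 - k 0" using l(3) by simp
qed

definition unit_path :: "real \<Rightarrow> nat \<Rightarrow> real" where
  "unit_path t = (\<lambda>i. if i = 0 then 1 - t else if i = 1 then t else 0)"

lemma unit_path_simplex: "t \<in> {0..1} \<Longrightarrow> unit_path t \<in> standard_simplex 1"
  by (auto simp: standard_simplex_1_iff unit_path_def)

definition winding :: "('a \<Rightarrow> complex) \<Rightarrow> 'a rat_chain \<Rightarrow> complex" where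
  "winding h c = (\<Sum>f\<in>Poly_Mapping.keys c.
     of_rat (Poly_Mapping.lookup c f) * log_change (\<lambda>t. h (f (unit_path t))))"

lemma winding_add: "winding h (c + d) = winding h c + winding h d"
  unfolding winding_def
  by (rule linear_extension_add[where W = "\<lambda>f a. of_rat a * log_change (\<lambda>t. h (f (unit_path t)))"])
    (simp add: of_rat_add algebra_simps)

lemma winding_0 [simp]: "winding h 0 = 0"
  by (simp add: winding_def)

lemma winding_single: "winding h (Poly_Mapping.single f r) = of_rat r * log_change (\<lambda>t. h (f (unit_path t)))"
  by (cases "r = 0") (auto simp: winding_def)

lemma winding_scale: "winding h (rat_scale r c) = of_rat r * winding h c"
proof -
  have "winding h (rat_scale r c) = (\<Sum>f\<in>Poly_Mapping.keys c.
     of_rat (Poly_Mapping.lookup (rat_scale r c) f) * log_change (\<lambda>t. h (f (unit_path t))))"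
    unfolding winding_def using keys_rat_scale[of r c]
    by (intro sum.mono_neutral_left) (auto simp: in_keys_iff)
  then show ?thesis by (simp add: winding_def of_rat_mult sum_distrib_left mult_ac)
qed

lemma winding_sum: "winding h (\<Sum>i\<in>I. c i) = (\<Sum>i\<in>I. winding h (c i))"
  by (induction I rule: infinite_finite_induct) (auto simp: winding_add)

text \<open>On the whole triangle \<open>h\<close> composed with \<open>f\<close> has a continuous
  logarithm, since the triangle is contractible. The changes along the faces are then differences of
  its values at the three corners and cancel.\<close>

lemma winding_boundary_simplex:
  assumes h: "continuous_map X (top_of_set (- {0})) h" and f: "singular_simplex 2 X f"
  shows "winding h (rat_boundary 2 (Poly_Mapping.single f 1)) = 0"
proof -
  \<comment> \<open>The standard 2-simplex consists of functions on the naturals; \<open>T\<close>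
    describes it by the coordinates 1 and 2 inside a normed plane, and \<open>E\<close> is the
    inverse description.\<close>
  define T where "T = {z. 0 \<le> fst z \<and> 0 \<le> snd z \<and> fst z + snd z \<le> (1::real)}"
  define E where "E z = (\<lambda>i::nat. if i = 0 then 1 - fst z - snd z else if i = 1 then fst z else
      if i = 2 then snd z else (0::real))" for z
  have T: "convex T" 
  proof (rule convexI)
    fix y z and u v :: real assume *: "y \<in> T" "z \<in> T" "0 \<le> u" "0 \<le> v" "u + v = 1"
    have "u * (fst y + snd y) + v * (fst z + snd z) \<le> 1"
      using * by (intro convex_bound_le) (auto simp: T_def)
    then show "u *\<^sub>R y + v *\<^sub>R z \<in> T" using * by (auto simp: T_def algebra_simps)
  qed
  have E: "E z \<in> standard_simplex 2" if "z \<in> T" for z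
    using that by (auto simp: standard_simplex_2_iff E_def T_def)
  have contE: "continuous_on T E"
  proof (rule continuous_on_coordinatewise_then_product)
    show "continuous_on T (\<lambda>x. E x i)" for i
      by (cases "i = 0"; cases "i = 1"; cases "i = 2") (auto simp: E_def intro!: continuous_intros)
  qed
  have E': "continuous_map (top_of_set T) (top_of_set (standard_simplex 2)) E"
    using contE E by (auto simp: continuous_map_in_subtopology)
  have "continuous_map (top_of_set (standard_simplex 2)) X f"
    using f by (simp add: singular_simplex_def euclidean_product_topology)
  then have "continuous_map (top_of_set T) (top_of_set (- {0})) (h \<circ> (f \<circ> E))"
    by (rule continuous_map_compose[OF continuous_map_compose[OF E'] h])
  then have "continuous_on T (\<lambda>z. h (f (E z)))" "\<And>z. z \<in> T \<Longrightarrow> h (f (E z)) \<noteq> 0"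
    by (auto simp: continuous_map_in_subtopology o_def image_subset_iff Pi_iff)
  then obtain k where k: "continuous_on T k" "\<And>z. z \<in> T \<Longrightarrow> h (f (E z)) = exp (k z)"
    using continuous_logarithm_on_contractible[of T "\<lambda>z. h (f (E z))"] convex_imp_contractible[OF T]
    by blast
  have face: "log_change (\<lambda>t. h (singular_face 2 j f (unit_path t))) = k (w 1) - k (w 0)"
    if wc: "continuous_on {0..1} w" and wT: "\<And>t. t \<in> {0..1} \<Longrightarrow> w t \<in> T"
      and wE: "\<And>t. simplical_face j (unit_path t) = E (w t)"
    for j w
  proof (rule log_change_eq)
    show "continuous_on {0..1} (\<lambda>t. k (w t))"
      by (rule continuous_on_compose2[OF k(1) wc]) (use wT in blast)
    show "h (singular_face 2 j f (unit_path t)) = exp (k (w t))" if "t \<in> {0..1}" for t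
      using k(2)[OF wT[OF that]] wE unit_path_simplex[OF that]
      by (simp add: singular_face_def One_nat_def)
  qed
  have face_E: "simplical_face 0 (unit_path t) = E (1 - t, t)" "simplical_face 1 (unit_path t) = E (0, t)"
    "simplical_face 2 (unit_path t) = E (t, 0)" for t
    by (auto simp: E_def unit_path_def simplical_face_def fun_eq_iff One_nat_def)
  have 0: "log_change (\<lambda>t. h (singular_face 2 0 f (unit_path t))) = k (1 - 1, 1) - k (1 - 0, 0)"
    by (rule face[OF _ _ face_E(1)]) (auto simp: T_def intro!: continuous_intros)
  have 1: "log_change (\<lambda>t. h (singular_face 2 1 f (unit_path t))) = k (0, 1) - k (0, 0)"
    by (rule face[OF _ _ face_E(2)]) (auto simp: T_def intro!: continuous_intros)
  have 2: "log_change (\<lambda>t. h (singular_face 2 2 f (unit_path t))) = k (1, 0) - k (0, 0)"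
    by (rule face[OF _ _ face_E(3)]) (auto simp: T_def intro!: continuous_intros)
  show ?thesis
    unfolding rat_boundary_single[OF zero_less_numeral] winding_sum winding_single
    using 0 1 2 by (simp add: numeral_2_eq_2 One_nat_def)
qed

lemma winding_boundary:
  assumes h: "continuous_map X (top_of_set (- {0})) h" and c: "c \<in> rat_boundaries 1 X"
  shows "winding h c = 0"
proof -
  obtain d where d: "d \<in> rat_chains 2 X" "c = rat_boundary 2 d"
    using c by (auto simp: rat_boundaries_def numeral_2_eq_2)
  have "winding h (rat_boundary 2 (Poly_Mapping.single f r)) = 0" if "f \<in> Poly_Mapping.keys d" for f r
    using winding_boundary_simplex[OF h, of f] that d(1)
      rat_boundary_scale[of 2 r "Poly_Mapping.single f 1"]
    by (auto simp: rat_chains_def winding_scale)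
  then show ?thesis
    unfolding d(2) by (subst rat_chain_expand[of d]) (simp add: rat_boundary_sum winding_sum)
qed

section \<open>Geometry of the polygon\<close>

text \<open>\<open>N\<close> is the absolute value of 2 k - (2 i + 1), that is the angle between
  vertex \<open>k\<close> and the midpoint of side \<open>i\<close> in units of \<pi> / m, not yet
  reduced modulo the full turn 2 m. The extreme values 1 and 2 m - 1 both mean one unit, so they
  single out the two ends of the side.\<close>

lemma abs_diff_odd_cases:
  fixes k m i N :: nat
  assumes "k < m" "i < m" "5 \<le> m" and N: "N = (if k \<le> i then 2 * (i - k) + 1 else 2 * (k - i) - 1)"
  shows "N = 1 \<or> N = 2 * m - 1 \<longleftrightarrow> k = i \<or> k = Suc i mod m"
proof (cases "k \<le> i")
  case True
  then have N: "N = 2 * (i - k) + 1" by (simp add: N)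
  have "N = 1 \<longleftrightarrow> k = i" using True unfolding N by arith
  moreover have "N = 2 * m - 1 \<longleftrightarrow> k = 0 \<and> Suc i = m" using True assms(1-3) unfolding N by arith
  moreover have "k = Suc i mod m \<longleftrightarrow> k = 0 \<and> Suc i = m"
    using True assms(2,3) by (cases "Suc i = m") auto
  ultimately show ?thesis by blast
next
  case False
  then have N: "N = 2 * (k - i) - 1" by (simp add: N)
  have "N = 1 \<longleftrightarrow> k = Suc i" using False unfolding N by arith
  moreover have "N \<noteq> 2 * m - 1" using False assms(1-3) unfolding N by arith
  moreover have "k = Suc i mod m \<longleftrightarrow> k = Suc i"
    using False assms(1,2) by (cases "Suc i = m") auto
  ultimately show ?thesis using False by blast
qed
locale right_angled_polygon =
  fixes m :: nat
  assumes m5: "5 \<le> m"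
begin

text \<open>\<open>inradius\<close> is the Euclidean distance of a side from the centre and
  \<open>kap\<close> half the length of the chord of the disc through that side.
  \<open>half_side\<close> is half the hyperbolic length of a side: with c = cos (2 \<pi> / m), the
  side length satisfies cosh = 1 + 2 c, so its half has sinh equal to sqrt c.\<close>

definition inradius :: real where "inradius = sqrt (cos (2 * pi / real m))"
definition kap :: real where "kap = sqrt (1 - inradius\<^sup>2)"
definition half_side :: real where "half_side = arsinh inradius"
definition unit_normal :: "nat \<Rightarrow> complex" where "unit_normal i = cis ((2 * real i + 1) * pi / real m)"
text \<open>Along a chord of the Klein disc, tanh of the hyperbolic arc length from the midpoint is
  the Euclidean position relative to half the chord. So \<open>t\<close> is arc length from the
  midpoint of side \<open>i\<close>.\<close>

definition side_point :: "nat \<Rightarrow> real \<Rightarrow> complex" where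
  "side_point i t = inradius *\<^sub>R unit_normal i + (kap * tanh t) *\<^sub>R (\<i> * unit_normal i)"
definition next_side :: "nat \<Rightarrow> nat" where "next_side i = Suc i mod m"
definition prev_side :: "nat \<Rightarrow> nat" where "prev_side i = (i + m - 1) mod m"

lemma m_pos [simp]: "0 < m" "m \<noteq> 0" "real m > 0" using m5 by auto

lemma next_prev [simp]:
  "next_side i < m" "prev_side i < m" 
  "i < m \<Longrightarrow> next_side (prev_side i) = i" "i < m \<Longrightarrow> prev_side (next_side i) = i"
proof -
  show "i < m \<Longrightarrow> next_side (prev_side i) = i"
    using m5 by (cases "i = 0") (auto simp: next_side_def prev_side_def mod_simps
        simp flip: Suc_diff_le)
  show "i < m \<Longrightarrow> prev_side (next_side i) = i"
    using m5 by (cases "Suc i = m") (auto simp: next_side_def prev_side_def)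
qed (auto simp: next_side_def prev_side_def)

lemma next_neq: "i < m \<Longrightarrow> next_side i \<noteq> i" "i < m \<Longrightarrow> prev_side i \<noteq> i"
  "i < m \<Longrightarrow> next_side i \<noteq> prev_side i"
proof -
  show 1: "i < m \<Longrightarrow> next_side i \<noteq> i" for i
    using m5 by (cases "Suc i = m") (auto simp: next_side_def)
  show "i < m \<Longrightarrow> prev_side i \<noteq> i" by (metis 1 next_prev(2) next_prev(3))
  have "next_side (next_side j) \<noteq> j" if "j < m" for j
  proof (cases "Suc (Suc j) < m")
    case True then show ?thesis by (simp add: next_side_def)
  next
    case False
    then have "j = m - 1 \<or> j = m - 2" using that by linarith
    moreover have "next_side (m - 1) = 0" "next_side (m - 2) = m - 1" "next_side 0 = 1"
      using m5 by (auto simp: next_side_def Suc_diff_le One_nat_def simp flip: Suc_diff_le)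
    ultimately show ?thesis using m5 by auto
  qed
  from this[of "prev_side i"] show "i < m \<Longrightarrow> next_side i \<noteq> prev_side i" by simp
qed

lemma inradius_sq: "inradius\<^sup>2 = cos (2 * pi / real m)"
  using cos_pos[OF m5] by (simp add: inradius_def)

lemma inradius_bounds: "0 < inradius" "inradius < 1" "inradius\<^sup>2 < 1"
  using cos_pos[OF m5] cos_less_1[OF m5] by (auto simp: inradius_def)

lemma kap_pos: "0 < kap" and kap_sq: "kap\<^sup>2 = 1 - inradius\<^sup>2"
  using inradius_bounds by (auto simp: kap_def)

lemma sinh_half_side: "sinh half_side = inradius" by (simp add: half_side_def)

lemma half_side_pos: "0 < half_side" using inradius_bounds by (simp add: half_side_def)

lemma cosh_half_side_sq: "(cosh half_side)\<^sup>2 = 1 + inradius\<^sup>2"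
  by (simp add: cosh_square_eq sinh_half_side)

text \<open>Both sides are positive with square 1 - c^2 for c = cos (2 \<pi> / m). This rewrites the
  inner products of neighbouring normals in terms of the hyperbolic half length of a side.\<close>

lemma sin_2pi: "sin (2 * pi / real m) = kap * cosh half_side"
proof -
  have "0 < sin (2 * pi / real m)" using m5 pi_gt_zero by (intro sin_gt_zero) (auto simp: field_simps)
  moreover have "(sin (2 * pi / real m))\<^sup>2 = (kap * cosh half_side)\<^sup>2"
  proof -
    have "(sin (2 * pi / real m))\<^sup>2 = 1 - (inradius\<^sup>2)\<^sup>2" by (simp add: sin_squared_eq inradius_sq)
    then show ?thesis
      by (simp add: power_mult_distrib kap_sq cosh_half_side_sq)
        (simp add: algebra_simps power2_eq_square power4_eq_xxxx)
  qed
  moreover have "0 < kap * cosh half_side" using kap_pos by simp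
  ultimately show ?thesis by (metis less_imp_le power2_eq_iff_nonneg)
qed

lemma cos_pi_pos: "0 < cos (pi / real m)"
  using m5 pi_gt_zero by (intro cos_gt_zero) (auto simp: field_simps)

lemma radius_cos: "vertex_radius m * cos (pi / real m) = inradius"
  using cos_pi_pos by (simp add: vertex_radius_def inradius_def)

lemma radius_pos: "0 < vertex_radius m"
  using radius_cos inradius_bounds cos_pi_pos by (metis mult_less_0_iff not_less_iff_gr_or_eq mult_zero_left)

text \<open>The coordinate of a vertex along its side, measured from the midpoint; it identifies
  \<open>side_point i half_side\<close> as a vertex.\<close>

lemma radius_sin: "vertex_radius m * sin (pi / real m) = kap * tanh half_side"
proof -
  have c: "inradius\<^sup>2 = 2 * (cos (pi / real m))\<^sup>2 - 1"
    using cos_double_cos[of "pi / real m"] by (simp add: inradius_sq)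
  have "vertex_radius m * sin (pi / real m) * (cosh half_side)\<^sup>2 * cos (pi / real m) =
      inradius * (sin (pi / real m) * 2 * cos (pi / real m)) * cos (pi / real m)"
    unfolding cosh_half_side_sq c
    by (simp add: power2_eq_square flip: radius_cos)
  also have "sin (pi / real m) * 2 * cos (pi / real m) = kap * cosh half_side"
    using sin_2pi sin_double[of "pi / real m"] by (simp add: mult_ac)
  finally have "vertex_radius m * sin (pi / real m) * cosh half_side * cosh half_side =
      kap * sinh half_side * cosh half_side"
    using cos_pi_pos by (simp add: sinh_half_side power2_eq_square mult_ac)
  then have "vertex_radius m * sin (pi / real m) * cosh half_side = kap * sinh half_side"
    using cosh_real_pos[of half_side] by simp
  then show ?thesis using cosh_real_pos[of half_side] by (simp add: tanh_def field_simps)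
qed

lemma vertex_add_m [simp]: "vertex m (k + m) = vertex m k"
proof -
  have "2 * pi * real (k + m) / real m = 2 * pi * real k / real m + 2 * pi"
    by (simp add: field_simps)
  then have "cis (2 * pi * real (k + m) / real m) = cis (2 * pi * real k / real m)"
    by (metis cis_mult cis_2pi mult.right_neutral)
  then show ?thesis unfolding vertex_def by simp
qed

lemma vertex_mod [simp]: "vertex m (k mod m) = vertex m k"
proof -
  have "vertex m (a + n * m) = vertex m a" for a n
    by (induction n) (auto simp: add.commute add.left_commute simp flip: vertex_add_m[of "a + _ * m"])
  from this[of "k mod m" "k div m"] show ?thesis by simp
qed

lemma normal_add_m [simp]: "unit_normal (k + m) = unit_normal k"
proof -
  have "(2 * real (k + m) + 1) * pi / real m = (2 * real k + 1) * pi / real m + 2 * pi"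
    by (simp add: field_simps)
  then show ?thesis unfolding unit_normal_def by (metis cis_mult cis_2pi mult.right_neutral)
qed

lemma normal_next: "i < m \<Longrightarrow> unit_normal (next_side i) = unit_normal (Suc i)"
  using normal_add_m[of 0] by (cases "Suc i = m") (auto simp: next_side_def)

lemma vertex_next: "vertex m (next_side i) = vertex m (Suc i)"
  by (simp add: next_side_def)

lemma side_point_next: "i < m \<Longrightarrow> side_point (next_side i) = side_point (Suc i)"
  by (simp add: side_point_def normal_next fun_eq_iff)

text \<open>Cosine decreases up to \<pi> and is symmetric about it, so its value at an angle exceeds
  all values strictly between that angle and its mirror image.\<close>

lemma cos_less:
  assumes "0 \<le> a" "a < b" "b < 2 * real m - a"
  shows "cos (b * pi / real m) < cos (a * pi / real m)"
proof -
  have less: "cos (c * pi / real m) < cos (a * pi / real m)" if "a < c" "c \<le> real m" for c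
  proof (rule cos_monotone_0_pi)
    show "0 \<le> a * pi / real m" using assms(1) by simp
    show "a * pi / real m < c * pi / real m" using that(1) by (simp add: divide_strict_right_mono)
    have "c * pi \<le> real m * pi" using that(2) by (intro mult_right_mono) auto
    then show "c * pi / real m \<le> pi" by (simp add: divide_le_eq mult.commute)
  qed
  show ?thesis
  proof (cases "b \<le> real m")
    case True
    then show ?thesis using less assms by blast
  next
    case False
    have "b * pi / real m = 2 * pi - (2 * real m - b) * pi / real m"
      by (simp add: field_simps)
    then have "cos (b * pi / real m) = cos ((2 * real m - b) * pi / real m)"
      by (simp only: cos_2pi_minus)
    also have "\<dots> < cos (a * pi / real m)"
      by (rule less) (use assms False in auto)
    finally show ?thesis .
  qed
qed

lemma vertex_inner_cis:
  "vertex m k \<bullet> cis (a * pi / real m) = vertex_radius m * cos (\<bar>2 * real k - a\<bar> * pi / real m)"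
proof -
  have "vertex m k \<bullet> cis (a * pi / real m) =
      vertex_radius m * cos (2 * pi * real k / real m - a * pi / real m)"
    by (simp add: vertex_def inner_complex_def cos_diff algebra_simps)
  also have "2 * pi * real k / real m - a * pi / real m = (2 * real k - a) * (pi / real m)"
    by (simp add: field_simps)
  also have "cos ((2 * real k - a) * (pi / real m)) = cos (\<bar>2 * real k - a\<bar> * (pi / real m))"
  proof -
    have "\<bar>2 * real k - a\<bar> * (pi / real m) = \<bar>(2 * real k - a) * (pi / real m)\<bar>"
      using pi_gt_zero by (simp add: abs_mult)
    then show ?thesis by (simp only: cos_abs_real)
  qed
  finally show ?thesis by simp
qed

text \<open>The line through side \<open>i\<close> supports the polygon and meets its vertices only
  in the two ends of that side, because these are the vertices at the smallest angle from the
  normal.\<close>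

lemma vertex_normal:
  assumes "k < m" "i < m"
  shows "vertex m k \<bullet> unit_normal i \<le> inradius"
    and "vertex m k \<bullet> unit_normal i = inradius \<longleftrightarrow> k = i \<or> k = next_side i"
proof -
  define n where "n = \<bar>2 * real k - (2 * real i + 1)\<bar>"
  have eq: "vertex m k \<bullet> unit_normal i = vertex_radius m * cos (n * pi / real m)"
    unfolding n_def unit_normal_def by (rule vertex_inner_cis)
  define N where "N = (if k \<le> i then 2 * (i - k) + 1 else 2 * (k - i) - 1)"
  have n: "n = real N" unfolding n_def N_def by (auto simp: of_nat_diff)
  have "N = 1 \<or> N = 2 * m - 1 \<or> (1 < N \<and> N < 2 * m - 1)"
    using assms unfolding N_def by auto
  moreover have "real (2 * m - 1) = 2 * real m - 1" using m5 by (simp add: of_nat_diff)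
  ultimately have "n = 1 \<or> n = 2 * real m - 1 \<or> (1 < n \<and> n < 2 * real m - 1)"
    unfolding n by (metis of_nat_1 of_nat_less_iff)
  moreover have "cos ((2 * real m - 1) * pi / real m) = cos (pi / real m)"
  proof -
    have "(2 * real m - 1) * pi / real m = 2 * pi - pi / real m" by (simp add: field_simps)
    then show ?thesis by (simp only: cos_2pi_minus)
  qed
  moreover have "n = 1 \<or> n = 2 * real m - 1 \<longleftrightarrow> k = i \<or> k = next_side i"
  proof -
    have "N = 1 \<or> N = 2 * m - 1 \<longleftrightarrow> k = i \<or> k = next_side i"
      unfolding next_side_def by (rule abs_diff_odd_cases[OF assms m5 N_def])
    then show ?thesis unfolding n using \<open>real (2 * m - 1) = 2 * real m - 1\<close>
      by (metis of_nat_1 of_nat_eq_iff)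
  qed
  ultimately consider "k = i \<or> k = next_side i" "cos (n * pi / real m) = cos (pi / real m)"
    | "\<not> (k = i \<or> k = next_side i)" "cos (n * pi / real m) < cos (pi / real m)"
    using cos_less[of 1 n] by auto
  then show "vertex m k \<bullet> unit_normal i \<le> inradius"
    "vertex m k \<bullet> unit_normal i = inradius \<longleftrightarrow> k = i \<or> k = next_side i"
    using radius_pos unfolding eq radius_cos[symmetric] by (cases; auto)+
qed

lemma vertex_in_polygon: "vertex m k \<in> polygon m"
proof -
  have "vertex m (k mod m) \<in> vertex m ` {..<m}" by (rule imageI) simp
  then show ?thesis unfolding polygon_def by (simp only: vertex_mod hull_inc)
qed

lemma convex_polygon: "convex (polygon m)" by (simp add: polygon_def)

lemma polygon_side_subset: "polygon_side m i \<subseteq> polygon m"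
  unfolding polygon_side_def using convex_polygon vertex_in_polygon
  by (simp add: closed_segment_subset)

lemma polygon_in_disc: "x \<in> polygon m \<Longrightarrow> norm x < 1"
proof -
  have "polygon m \<subseteq> ball 0 1"
    unfolding polygon_def using vertex_in_disc[OF m5] by (intro hull_minimal) auto
  then show "x \<in> polygon m \<Longrightarrow> norm x < 1" by auto
qed

lemma polygon_normal: "x \<in> polygon m \<Longrightarrow> i < m \<Longrightarrow> x \<bullet> unit_normal i \<le> inradius"
proof -
  assume i: "i < m"
  have "polygon m \<subseteq> {x. unit_normal i \<bullet> x \<le> inradius}"
    unfolding polygon_def using vertex_normal(1)[OF _ i]
    by (intro hull_minimal convex_halfspace_le) (auto simp: inner_commute[of "unit_normal i"])
  then show "x \<in> polygon m \<Longrightarrow> x \<bullet> unit_normal i \<le> inradius" by (auto simp: inner_commute)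
qed

lemma side_normal: "x \<in> polygon_side m i \<Longrightarrow> i < m \<Longrightarrow> x \<bullet> unit_normal i = inradius"
proof -
  assume i: "i < m" and "x \<in> polygon_side m i"
  then obtain u where x: "x = (1 - u) *\<^sub>R vertex m i + u *\<^sub>R vertex m (next_side i)"
    by (auto simp: polygon_side_def closed_segment_def vertex_next)
  show "x \<bullet> unit_normal i = inradius"
    using vertex_normal(2)[OF i i] vertex_normal(2)[of "next_side i" i] i
    by (simp add: x inner_add_left left_diff_distrib)
qed

lemma normal_inner [simp]:
  "unit_normal i \<bullet> unit_normal i = 1" "(\<i> * unit_normal i) \<bullet> (\<i> * unit_normal i) = 1"
  "(\<i> * unit_normal i) \<bullet> unit_normal i = 0" "unit_normal i \<bullet> (\<i> * unit_normal i) = 0"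
  by (simp_all add: unit_normal_def inner_complex_def flip: power2_eq_square)

lemma normal_Suc: "unit_normal (Suc i) = unit_normal i * cis (2 * pi / real m)"
proof -
  have "(2 * real (Suc i) + 1) * pi / real m = (2 * real i + 1) * pi / real m + 2 * pi / real m"
    by (simp add: field_simps)
  then show ?thesis by (simp only: unit_normal_def cis_mult)
qed

lemma normal_inner_Suc:
  "unit_normal i \<bullet> unit_normal (Suc i) = inradius\<^sup>2" "(\<i> * unit_normal i) \<bullet> (\<i> * unit_normal (Suc i)) = inradius\<^sup>2"
  "(\<i> * unit_normal i) \<bullet> unit_normal (Suc i) = kap * cosh half_side"
  "unit_normal i \<bullet> (\<i> * unit_normal (Suc i)) = - (kap * cosh half_side)"
proof -
  define a b where "a = Re (unit_normal i)" and "b = Im (unit_normal i)"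
  have ab: "a * a + b * b = 1" using normal_inner(1)[of i] by (simp add: inner_complex_def a_def b_def)
  have *: "a * (a * z) + b * (b * z) = z" for z
    using ab by (metis distrib_right mult.assoc mult_1)
  show "unit_normal i \<bullet> unit_normal (Suc i) = inradius\<^sup>2" "(\<i> * unit_normal i) \<bullet> (\<i> * unit_normal (Suc i)) = inradius\<^sup>2"
    "(\<i> * unit_normal i) \<bullet> unit_normal (Suc i) = kap * cosh half_side"
    "unit_normal i \<bullet> (\<i> * unit_normal (Suc i)) = - (kap * cosh half_side)"
    unfolding normal_Suc inner_complex_def inradius_sq sin_2pi[symmetric]
    using *[of "cos (2 * pi / real m)"] *[of "sin (2 * pi / real m)"]
    by (simp_all add: algebra_simps flip: a_def b_def)
qed

lemma normal_inner_Suc':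
  "unit_normal (Suc i) \<bullet> unit_normal i = inradius\<^sup>2"
  "(\<i> * unit_normal (Suc i)) \<bullet> unit_normal i = - (kap * cosh half_side)"
  using normal_inner_Suc(1,4)[of i] by (simp_all add: inner_commute)

section \<open>Hyperbolic distances between points of sides and to the lines carrying them\<close>

lemma side_point_inner:
  "side_point i s \<bullet> side_point i t = inradius\<^sup>2 + kap\<^sup>2 * (tanh s * tanh t)"
  "side_point i s \<bullet> unit_normal (Suc i) = inradius ^ 3 + kap\<^sup>2 * tanh s * cosh half_side"
  "side_point (Suc i) s \<bullet> unit_normal i = inradius ^ 3 - kap\<^sup>2 * tanh s * cosh half_side"
  "side_point i s \<bullet> side_point (Suc i) t = inradius ^ 4 + inradius * kap\<^sup>2 * cosh half_side * (tanh s - tanh t) +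
      kap\<^sup>2 * tanh s * tanh t * inradius\<^sup>2"
  by (simp_all add: side_point_def inner_add_left inner_add_right normal_inner_Suc
      normal_inner_Suc'
      power2_eq_square power3_eq_cube power4_eq_xxxx algebra_simps)

lemma one_minus_tanh_sq: "1 - (tanh t)\<^sup>2 = 1 / (cosh t)\<^sup>2" for t :: real
proof -
  have "1 - (tanh t)\<^sup>2 = ((cosh t)\<^sup>2 - (sinh t)\<^sup>2) / (cosh t)\<^sup>2"
    by (simp add: tanh_def power_divide diff_divide_distrib)
  then show ?thesis by (simp add: hyperbolic_pythagoras)
qed

lemma sqrt_side_point: "sqrt (1 - (norm (side_point i t))\<^sup>2) = kap / cosh t"
proof -
  have "1 - (norm (side_point i t))\<^sup>2 = kap\<^sup>2 * (1 - (tanh t)\<^sup>2)"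
    unfolding power2_norm_eq_inner side_point_inner
    using kap_sq by (simp add: power2_eq_square algebra_simps)
  also have "\<dots> = (kap / cosh t)\<^sup>2" by (simp add: one_minus_tanh_sq power_divide)
  finally show ?thesis using kap_pos by simp
qed

lemma hyp_dist_side_point: "hyp_dist (side_point i s) (side_point i t) = \<bar>s - t\<bar>"
proof -
  have "(1 - side_point i s \<bullet> side_point i t) / (kap / cosh s * (kap / cosh t)) = 
      (1 - tanh s * tanh t) * (cosh s * cosh t)"
  proof -
    have *: "1 - side_point i s \<bullet> side_point i t = kap\<^sup>2 * (1 - tanh s * tanh t)"
      by (simp add: side_point_inner kap_sq algebra_simps)
    show ?thesis unfolding * using kap_pos by (simp add: power2_eq_square)
  qed
  also have "\<dots> = cosh (s - t)"
    by (simp add: cosh_diff tanh_def field_simps)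
  also have "\<dots> = cosh \<bar>s - t\<bar>" by simp
  finally have eq: "(1 - side_point i s \<bullet> side_point i t) / (kap / cosh s * (kap / cosh t)) = cosh \<bar>s - t\<bar>" .
  show ?thesis unfolding hyp_dist_def sqrt_side_point eq by (rule arcosh_cosh_real) simp
qed

text \<open>Hyperbolic Pythagoras at the common vertex of two consecutive sides: the legs are
  \<open>half_side - s\<close> and \<open>half_side + t\<close>.\<close>

lemma hyp_dist_corner:
  "hyp_dist (side_point i s) (side_point (Suc i) t) = arcosh (cosh (half_side - s) * cosh (half_side + t))"
proof -
  have *: "1 - side_point i s \<bullet> side_point (Suc i) t =
    kap\<^sup>2 * ((cosh half_side)\<^sup>2 - sinh half_side * cosh half_side * (tanh s - tanh t) -
       (sinh half_side)\<^sup>2 * tanh s * tanh t)"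
    unfolding side_point_inner cosh_half_side_sq kap_sq sinh_half_side
    by (simp add: power2_eq_square power4_eq_xxxx algebra_simps)
  have "(1 - side_point i s \<bullet> side_point (Suc i) t) / (kap / cosh s * (kap / cosh t)) =
     ((cosh half_side)\<^sup>2 - sinh half_side * cosh half_side * (tanh s - tanh t) -
       (sinh half_side)\<^sup>2 * tanh s * tanh t) * (cosh s * cosh t)"
    unfolding * using kap_pos by (simp add: power2_eq_square)
  also have "\<dots> = cosh (half_side - s) * cosh (half_side + t)"
    by (simp add: cosh_diff cosh_add tanh_def field_simps power2_eq_square)
  finally show ?thesis
    unfolding hyp_dist_def sqrt_side_point by simp
qed


text \<open>Signed hyperbolic distance from \<open>x\<close> to the full line carrying side
  \<open>j\<close>, positive on the side of the centre: the argument of \<open>arsinh\<close> is the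
  Lorentz product of the hyperboloid point over \<open>x\<close> with the unit normal of the
  line.\<close>

definition line_dist :: "nat \<Rightarrow> complex \<Rightarrow> real" where
  "line_dist j x = arsinh ((inradius - x \<bullet> unit_normal j) / (kap * sqrt (1 - (norm x)\<^sup>2)))"

text \<open>Side \<open>i\<close> is perpendicular to the next one, so the distance to that line is
  arc length along side \<open>i\<close>, in exact form and without a sign restriction on
  it.\<close>

lemma line_dist_Suc: "line_dist (Suc i) (side_point i t) = half_side - t"
proof -
  have *: "inradius - side_point i t \<bullet> unit_normal (Suc i) = kap\<^sup>2 * (inradius - tanh t * cosh half_side)"
    unfolding side_point_inner kap_sq by (simp add: power2_eq_square power3_eq_cube algebra_simps)
  have "(inradius - side_point i t \<bullet> unit_normal (Suc i)) / (kap * (kap / cosh t)) = 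
      (inradius - tanh t * cosh half_side) * cosh t"
    unfolding * using kap_pos by (simp add: power2_eq_square)
  also have "\<dots> = sinh (half_side - t)"
    by (simp add: sinh_diff tanh_def field_simps sinh_half_side)
  finally show ?thesis unfolding line_dist_def sqrt_side_point by (simp add: arsinh_sinh_real)
qed

lemma line_dist_prev: "line_dist i (side_point (Suc i) t) = half_side + t"
proof -
  have *: "inradius - side_point (Suc i) t \<bullet> unit_normal i = kap\<^sup>2 * (inradius + tanh t * cosh half_side)"
    unfolding side_point_inner kap_sq by (simp add: power2_eq_square power3_eq_cube algebra_simps)
  have "(inradius - side_point (Suc i) t \<bullet> unit_normal i) / (kap * (kap / cosh t)) = 
      (inradius + tanh t * cosh half_side) * cosh t"
    unfolding * using kap_pos by (simp add: power2_eq_square)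
  also have "\<dots> = sinh (half_side + t)"
    by (simp add: sinh_add tanh_def field_simps sinh_half_side)
  finally show ?thesis unfolding line_dist_def sqrt_side_point by (simp add: arsinh_sinh_real)
qed

text \<open>A Lorentz boost moves the line of side \<open>j\<close> to the centre; up to the factor
  \<open>kap\<close>, it takes the vector (1, x) to the coordinates \<open>p\<close> (time),
  \<open>u\<close> (along the line) and \<open>inradius - x1\<close> (across it). Dropping the
  motion along the line can only shorten a distance, which is the reverse Cauchy-Schwarz inequality
  for the pairs (p, u) and (q, v). Hence cosh of the difference of the two line distances is at most
  cosh of the distance.\<close>

lemma line_dist_lipschitz:
  assumes x: "norm x < 1" and y: "norm y < 1"
  shows "\<bar>line_dist j x - line_dist j y\<bar> \<le> hyp_dist x y"
proof -
  define X Y where "X = sqrt (1 - (norm x)\<^sup>2)" and "Y = sqrt (1 - (norm y)\<^sup>2)"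
  define n where "n = unit_normal j"
  define x1 x2 y1 y2 where "x1 = x \<bullet> n" and "x2 = x \<bullet> (\<i> * n)" and "y1 = y \<bullet> n" and "y2 = y \<bullet> (\<i> * n)"
  define p u q v where "p = 1 - inradius * x1" and "u = kap * x2" and "q = 1 - inradius * y1" and "v = kap * y2"
  define a b where "a = (inradius - x1) / (kap * X)" and "b = (inradius - y1) / (kap * Y)"
  have "(norm x)\<^sup>2 < 1" "(norm y)\<^sup>2 < 1" using x y by (simp_all add: power_less_one_iff abs_square_less_1)
  then have XY: "X > 0" "Y > 0" "X\<^sup>2 = 1 - (norm x)\<^sup>2" "Y\<^sup>2 = 1 - (norm y)\<^sup>2"
    by (auto simp: X_def Y_def)
  have n1: "Re n * Re n + Im n * Im n = 1"
    using normal_inner(1)[of j] by (simp add: n_def inner_complex_def)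
  have inner: "z \<bullet> w = (z \<bullet> n) * (w \<bullet> n) + (z \<bullet> (\<i> * n)) * (w \<bullet> (\<i> * n))" for z w
  proof -
    have "(z \<bullet> n) * (w \<bullet> n) + (z \<bullet> (\<i> * n)) * (w \<bullet> (\<i> * n)) =
        (Re z * Re w + Im z * Im w) * (Re n * Re n + Im n * Im n)"
      by (simp add: inner_complex_def algebra_simps)
    then show ?thesis using n1 by (simp add: inner_complex_def)
  qed
  have nx: "(norm x)\<^sup>2 = x1\<^sup>2 + x2\<^sup>2" and ny: "(norm y)\<^sup>2 = y1\<^sup>2 + y2\<^sup>2" and xy: "x \<bullet> y = x1 * y1 + x2 * y2"
    unfolding power2_norm_eq_inner
    by (simp_all add: inner[of x x] inner[of y y] inner[of x y] x1_def x2_def y1_def y2_def power2_eq_square)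
  have pos: "p\<^sup>2 - u\<^sup>2 = (kap * X)\<^sup>2 * (1 + a\<^sup>2)" "q\<^sup>2 - v\<^sup>2 = (kap * Y)\<^sup>2 * (1 + b\<^sup>2)"
  proof -
    \<comment> \<open>Invariance of the Lorentz form under the boost: time squared minus the
      coordinate along the line equals the norm plus the coordinate across it.\<close>
    have "(kap * X)\<^sup>2 * (1 + a\<^sup>2) = (kap * X)\<^sup>2 + (inradius - x1)\<^sup>2"
      using XY kap_pos by (simp add: a_def power_divide field_simps)
    then show "p\<^sup>2 - u\<^sup>2 = (kap * X)\<^sup>2 * (1 + a\<^sup>2)"
      by (simp add: p_def u_def power_mult_distrib XY nx kap_sq) (simp add: power2_eq_square algebra_simps)
    have "(kap * Y)\<^sup>2 * (1 + b\<^sup>2) = (kap * Y)\<^sup>2 + (inradius - y1)\<^sup>2"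
      using XY kap_pos by (simp add: b_def power_divide field_simps)
    then show "q\<^sup>2 - v\<^sup>2 = (kap * Y)\<^sup>2 * (1 + b\<^sup>2)"
      by (simp add: q_def v_def power_mult_distrib XY ny kap_sq) (simp add: power2_eq_square algebra_simps)
  qed
  have abs1: "\<bar>x1\<bar> < 1" "\<bar>y1\<bar> < 1"
  proof -
    have "x1\<^sup>2 < 1" using \<open>(norm x)\<^sup>2 < 1\<close> nx zero_le_power2[of x2] by linarith
    then show "\<bar>x1\<bar> < 1" by (simp only: abs_square_less_1)
    have "y1\<^sup>2 < 1" using \<open>(norm y)\<^sup>2 < 1\<close> ny zero_le_power2[of y2] by linarith
    then show "\<bar>y1\<bar> < 1" by (simp only: abs_square_less_1)
  qed
  have pq: "p > 0" "q > 0"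
  proof -
    have "inradius * z < 1" if "\<bar>z\<bar> < 1" for z
    proof -
      have "inradius * z \<le> inradius * \<bar>z\<bar>"
        using inradius_bounds by (intro mult_left_mono) auto
      also have "\<dots> \<le> 1 * \<bar>z\<bar>" using inradius_bounds by (intro mult_right_mono) auto
      finally show ?thesis using that by simp
    qed
    then show "p > 0" "q > 0" using abs1 by (auto simp: p_def q_def)
  qed
  have "p\<^sup>2 - u\<^sup>2 > 0" "q\<^sup>2 - v\<^sup>2 > 0"
    unfolding pos using XY kap_pos by (auto intro!: mult_pos_pos add_pos_nonneg)
  then have up: "\<bar>u\<bar> \<le> p" "\<bar>v\<bar> \<le> q"
    using pq abs_le_square_iff[of u p] abs_le_square_iff[of v q] by auto
  have "u * v \<le> \<bar>u\<bar> * \<bar>v\<bar>" by (metis abs_ge_self abs_mult)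
  also have "\<dots> \<le> p * q" using up pq by (intro mult_mono) auto
  finally have uv: "p * q - u * v \<ge> 0" by simp
  have "(p\<^sup>2 - u\<^sup>2) * (q\<^sup>2 - v\<^sup>2) \<le> (p * q - u * v)\<^sup>2"
  proof -
    have "(p * q - u * v)\<^sup>2 - (p\<^sup>2 - u\<^sup>2) * (q\<^sup>2 - v\<^sup>2) = (p * v - q * u)\<^sup>2"
      by (simp add: power2_eq_square algebra_simps)
    then show ?thesis by (metis diff_ge_0_iff_ge zero_le_power2)
  qed
  then have "sqrt ((p\<^sup>2 - u\<^sup>2) * (q\<^sup>2 - v\<^sup>2)) \<le> p * q - u * v"
    using uv by (metis real_sqrt_le_iff real_sqrt_abs abs_of_nonneg)
  then have "kap\<^sup>2 * X * Y * (sqrt (1 + a\<^sup>2) * sqrt (1 + b\<^sup>2)) \<le> p * q - u * v"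
  proof -
    have "sqrt ((kap * X)\<^sup>2 * (1 + a\<^sup>2) * ((kap * Y)\<^sup>2 * (1 + b\<^sup>2))) =
        kap * X * sqrt (1 + a\<^sup>2) * (kap * Y * sqrt (1 + b\<^sup>2))"
      using XY kap_pos by (simp only: real_sqrt_mult real_sqrt_abs abs_mult abs_of_pos)
    then show ?thesis using \<open>sqrt _ \<le> _\<close> unfolding pos by (simp add: power2_eq_square mult_ac)
  qed
  also have "p * q - u * v = (inradius - x1) * (inradius - y1) + kap\<^sup>2 * (1 - x \<bullet> y)"
  proof -
    have "u * v = kap\<^sup>2 * (x2 * y2)" by (simp add: u_def v_def power2_eq_square)
    then show ?thesis
      unfolding xy kap_sq p_def q_def by (simp add: algebra_simps power2_eq_square)
  qed
  also have "\<dots> = kap\<^sup>2 * X * Y * (a * b + (1 - x \<bullet> y) / (X * Y))"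
    using XY kap_pos by (simp add: a_def b_def field_simps power2_eq_square)
  finally have "sqrt (1 + a\<^sup>2) * sqrt (1 + b\<^sup>2) \<le> a * b + (1 - x \<bullet> y) / (X * Y)"
    using XY kap_pos by (simp add: mult_le_cancel_left_pos)
  then have cosh_le: "cosh (arsinh a - arsinh b) \<le> (1 - x \<bullet> y) / (X * Y)"
    by (simp add: cosh_diff cosh_arsinh_real add.commute)
  then have ge1: "1 \<le> (1 - x \<bullet> y) / (X * Y)"
    using cosh_real_ge_1[of "arsinh a - arsinh b"] by linarith
  have "cosh \<bar>arsinh a - arsinh b\<bar> \<le> cosh (hyp_dist x y)"
    unfolding hyp_dist_def X_def[symmetric] Y_def[symmetric]
    using cosh_le ge1 by (simp add: cosh_arcosh_real)
  moreover have "hyp_dist x y \<ge> 0"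
    unfolding hyp_dist_def X_def[symmetric] Y_def[symmetric] using ge1 by simp
  ultimately have "\<bar>arsinh a - arsinh b\<bar> \<le> hyp_dist x y"
    by (subst (asm) cosh_real_nonneg_le_iff) auto
  then show ?thesis
    by (simp add: line_dist_def a_def b_def x1_def y1_def n_def X_def Y_def)
qed

lemma hyp_dist_nonneg: "x \<in> polygon m \<Longrightarrow> y \<in> polygon m \<Longrightarrow> 0 \<le> hyp_dist x y"
  using line_dist_lipschitz[of x y 0] polygon_in_disc by fastforce

section \<open>Sides as unit-speed segments and their incidences\<close>

lemma side_point_ends: "side_point i half_side = vertex m (Suc i)" "side_point i (- half_side) = vertex m i"
proof -
  have "2 * pi * real (Suc i) / real m = (2 * real i + 1) * pi / real m + pi / real m"
    by (simp add: field_simps)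
  then have 1: "vertex m (Suc i) = vertex_radius m *\<^sub>R (unit_normal i * cis (pi / real m))"
    by (simp only: vertex_def unit_normal_def cis_mult)
  have "2 * pi * real i / real m = (2 * real i + 1) * pi / real m + - (pi / real m)"
    by (simp add: field_simps)
  then have 2: "vertex m i = vertex_radius m *\<^sub>R (unit_normal i * cis (- (pi / real m)))"
    by (simp only: vertex_def unit_normal_def cis_mult)
  have v: "vertex m (Suc i) = (vertex_radius m * cos (pi / real m)) *\<^sub>R unit_normal i + 
       (vertex_radius m * sin (pi / real m)) *\<^sub>R (\<i> * unit_normal i)"
     "vertex m i = (vertex_radius m * cos (pi / real m)) *\<^sub>R unit_normal i - 
       (vertex_radius m * sin (pi / real m)) *\<^sub>R (\<i> * unit_normal i)"
    by (simp_all add: 1 2 complex_eq_iff algebra_simps)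
  show "side_point i half_side = vertex m (Suc i)" "side_point i (- half_side) = vertex m i"
    unfolding v radius_cos radius_sin side_point_def by simp_all
qed

lemma side_point_convex:
  "side_point i t = (1 - (tanh t + tanh half_side) / (2 * tanh half_side)) *\<^sub>R vertex m i +
      ((tanh t + tanh half_side) / (2 * tanh half_side)) *\<^sub>R vertex m (Suc i)"
proof -
  have "tanh half_side > 0" using half_side_pos by simp
  then show ?thesis
    unfolding side_point_ends[of i, symmetric] side_point_def
    by (simp add: complex_eq_iff field_simps)
qed

lemma side_fraction_bounds:
  assumes "\<bar>t\<bar> \<le> half_side"
  shows "(tanh t + tanh half_side) / (2 * tanh half_side) \<in> {0..1}"
proof -
  have "tanh half_side > 0" using half_side_pos by simp
  moreover have "tanh t \<le> tanh half_side" "tanh (- half_side) \<le> tanh t"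
    unfolding tanh_real_le_iff using assms by auto
  ultimately show ?thesis by (simp add: field_simps)
qed

lemma polygon_side_eq: "polygon_side m i = side_point i ` {- half_side..half_side}"
proof
  show "side_point i ` {- half_side..half_side} \<subseteq> polygon_side m i"
    using side_fraction_bounds unfolding polygon_side_def closed_segment_def
    by (force simp: side_point_convex[of i])
  show "polygon_side m i \<subseteq> side_point i ` {- half_side..half_side}"
  proof
    fix x assume "x \<in> polygon_side m i"
    then obtain u where u: "0 \<le> u" "u \<le> 1" "x = (1 - u) *\<^sub>R vertex m i + u *\<^sub>R vertex m (Suc i)"
      by (auto simp: polygon_side_def closed_segment_def)
    have th: "tanh half_side > 0" using half_side_pos by simp
    define z where "z = (2 * u - 1) * tanh half_side"
    have "z \<in> {tanh (- half_side)..tanh half_side}"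
      using u th mult_right_mono[of "2 * u - 1" 1 "tanh half_side"]
        mult_right_mono[of "-1" "2 * u - 1" "tanh half_side"] by (auto simp: z_def)
    moreover have "continuous_on {- half_side..half_side} (tanh :: real \<Rightarrow> real)"
      by (intro continuous_intros) auto
    ultimately obtain t where t: "t \<in> {- half_side..half_side}" "tanh t = z"
      using IVT'[of tanh "- half_side" z half_side] half_side_pos by auto
    have "(tanh t + tanh half_side) / (2 * tanh half_side) = u"
      using th by (simp add: t z_def field_simps)
    then have "x = side_point i t" using side_point_convex[of i t] u by simp
    then show "x \<in> side_point i ` {- half_side..half_side}" using t by blast
  qed
qed

lemma side_point_in_polygon: "\<bar>t\<bar> \<le> half_side \<Longrightarrow> side_point i t \<in> polygon m"
  using polygon_side_subset[of i] by (auto simp: polygon_side_eq abs_le_iff)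

text \<open>Along side \<open>i\<close> the slack to the line of side \<open>j\<close> is an affine
  combination of its nonnegative values at the two ends, so it vanishes only where every end with
  positive slack has weight 0.\<close>

lemma side_point_normal:
  assumes ij: "i < m" "j < m" and t: "\<bar>t\<bar> \<le> half_side"
  shows "side_point i t \<bullet> unit_normal j = inradius \<longleftrightarrow>
     j = i \<or> (t = half_side \<and> j = next_side i) \<or> (t = - half_side \<and> j = prev_side i)"
proof -
  define u where "u = (tanh t + tanh half_side) / (2 * tanh half_side)"
  have th: "tanh half_side > 0" using half_side_pos by simp
  have u01: "0 \<le> u" "u \<le> 1" using side_fraction_bounds[OF t] by (auto simp: u_def)
  have u0: "u = 0 \<longleftrightarrow> t = - half_side"
  proof -
    have "u = 0 \<longleftrightarrow> tanh t = tanh (- half_side)" using th by (auto simp: u_def)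
    then show ?thesis by (simp only: tanh_real_eq_iff)
  qed
  have u1: "u = 1 \<longleftrightarrow> t = half_side"
  proof -
    have "u = 1 \<longleftrightarrow> tanh t = tanh half_side" using th by (auto simp: u_def field_simps)
    then show ?thesis by simp
  qed
  define a b where "a = inradius - vertex m i \<bullet> unit_normal j" and "b = inradius - vertex m (next_side i) \<bullet> unit_normal j"
  have ab: "a \<ge> 0" "b \<ge> 0" "a = 0 \<longleftrightarrow> i = j \<or> i = next_side j" "b = 0 \<longleftrightarrow> next_side i = j \<or> next_side i = next_side j"
    using vertex_normal[of i j] vertex_normal[of "next_side i" j] ij by (auto simp: a_def b_def)
  have "inradius - side_point i t \<bullet> unit_normal j = (1 - u) * a + u * b"
    unfolding side_point_convex[of i t] u_def[symmetric]
    by (simp add: a_def b_def vertex_next inner_add_left algebra_simps)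
  then have 1: "side_point i t \<bullet> unit_normal j = inradius \<longleftrightarrow> (1 - u) * a + u * b = 0"
    by linarith
  have "(1 - u) * a + u * b = 0 \<longleftrightarrow> (1 - u) * a = 0 \<and> u * b = 0"
    using u01 ab(1,2) by (intro add_nonneg_eq_0_iff) auto
  then have 2: "(1 - u) * a + u * b = 0 \<longleftrightarrow> (u = 1 \<or> a = 0) \<and> (u = 0 \<or> b = 0)" by auto
  have 3: "i = next_side j \<longleftrightarrow> j = prev_side i"
    using next_prev(3)[OF ij(1)] next_prev(4)[OF ij(2)] by metis
  have 4: "next_side i = next_side j \<longleftrightarrow> i = j"
    using next_prev(4)[OF ij(1)] next_prev(4)[OF ij(2)] by metis
  have "side_point i t \<bullet> unit_normal j = inradius \<longleftrightarrow>
      (t = half_side \<or> i = j \<or> j = prev_side i) \<and> (t = - half_side \<or> next_side i = j \<or> i = j)"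
    unfolding 1 2 ab(3,4) u0 u1 3 4 by (rule refl)
  moreover have "half_side \<noteq> - half_side" using half_side_pos by linarith
  ultimately show ?thesis using next_neq[OF ij(1)] by metis
qed

lemma side_point_in_side_iff:
  assumes ij: "i < m" "j < m" and t: "\<bar>t\<bar> \<le> half_side"
  shows "side_point i t \<in> polygon_side m j \<longleftrightarrow>
     j = i \<or> (t = half_side \<and> j = next_side i) \<or> (t = - half_side \<and> j = prev_side i)"
proof
  assume "side_point i t \<in> polygon_side m j"
  then have "side_point i t \<bullet> unit_normal j = inradius" using ij(2) by (rule side_normal)
  then show "j = i \<or> (t = half_side \<and> j = next_side i) \<or> (t = - half_side \<and> j = prev_side i)"
    unfolding side_point_normal[OF assms] .
next
  have 1: "vertex m (Suc i) \<in> polygon_side m (next_side i)"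
    by (simp add: polygon_side_def flip: vertex_next)
  have 2: "vertex m i \<in> polygon_side m (prev_side i)"
    using vertex_next[of "prev_side i"] ij by (simp add: polygon_side_def)
  have 3: "side_point i t \<in> polygon_side m i"
    using t by (auto simp: polygon_side_eq abs_le_iff)
  assume "j = i \<or> (t = half_side \<and> j = next_side i) \<or> (t = - half_side \<and> j = prev_side i)"
  then show "side_point i t \<in> polygon_side m j"
    using 1 2 3 side_point_ends[of i] by (elim disjE conjE) simp_all
qed

lemma line_dist_side_point_pos:
  assumes "i < m" "j < m" "\<bar>t\<bar> \<le> half_side" "side_point i t \<notin> polygon_side m j"
  shows "0 < line_dist j (side_point i t)"
proof -
  have "side_point i t \<bullet> unit_normal j < inradius"
  proof (rule order.not_eq_order_implies_strict)
    show "side_point i t \<bullet> unit_normal j \<noteq> inradius"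
      using assms(4) unfolding side_point_normal[OF assms(1-3)] side_point_in_side_iff[OF assms(1-3)] .
    show "side_point i t \<bullet> unit_normal j \<le> inradius"
      by (rule polygon_normal[OF side_point_in_polygon[OF assms(3)] assms(2)])
  qed
  then show ?thesis
    unfolding line_dist_def sqrt_side_point using kap_pos by (simp add: field_simps)
qed

lemma line_dist_nonneg: "x \<in> polygon m \<Longrightarrow> j < m \<Longrightarrow> 0 \<le> line_dist j x"
proof -
  assume x: "x \<in> polygon m" and j: "j < m"
  have "(norm x)\<^sup>2 < 1" using polygon_in_disc[OF x] by (simp add: power_less_one_iff abs_square_less_1)
  then have "0 \<le> (inradius - x \<bullet> unit_normal j) / (kap * sqrt (1 - (norm x)\<^sup>2))"
    using polygon_normal[OF x j] kap_pos by (intro divide_nonneg_nonneg) auto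
  then show "0 \<le> line_dist j x"
    unfolding line_dist_def by (metis arsinh_real_neg_iff not_less)
qed

lemma line_dist_side: "x \<in> polygon_side m j \<Longrightarrow> j < m \<Longrightarrow> line_dist j x = 0"
  using side_normal[of x j] by (simp add: line_dist_def)

lemma side_point_inj: "side_point i s = side_point i t \<longleftrightarrow> s = t"
  using hyp_dist_side_point[of i s t] hyp_dist_side_point[of i s s] by auto

end

declare One_nat_def [simp]

section \<open>The surface and its straight edge lines\<close>

context right_angled_polygon begin

abbreviation tiles :: "nat set set" where "tiles \<equiv> Pow {..<m}"
abbreviation cls :: "nat set \<Rightarrow> complex \<Rightarrow> surface_point" where "cls v x \<equiv> tile_class m (v, x)"

definition sides_at :: "complex \<Rightarrow> nat set" where
  "sides_at x = {j. j < m \<and> x \<in> polygon_side m j}"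

section \<open>Points of the surface and lower bounds for its metric\<close>

lemma glue_flip_set:
  assumes "finite D" "D \<subseteq> sides_at x" "v \<subseteq> {..<m}"
  shows "((v, x), (sym_diff v D, x)) \<in> (glue m)\<^sup>*"
  using assms
proof (induction D rule: finite_induct)
  case (insert i D)
  have "((v, x), (sym_diff v D, x)) \<in> (glue m)\<^sup>*" using insert by auto
  moreover have "((sym_diff v D, x), (sym_diff (sym_diff v D) {i}, x)) \<in> glue m"
    using insert.prems unfolding glue_def sides_at_def by blast
  moreover have "sym_diff (sym_diff v D) {i} = sym_diff v (insert i D)" using insert.hyps by auto
  ultimately show ?case by (metis rtrancl.rtrancl_into_rtrancl)
qed auto

text \<open>Gluing never moves the point \<open>x\<close> of the polygon. Hence the sides through it
  stay the same along the whole orbit and can be flipped independently of each other.\<close>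

lemma tile_class_eq:
  assumes "v \<subseteq> {..<m}"
  shows "cls v x = {(w, x) | w. w \<subseteq> {..<m} \<and> sym_diff v w \<subseteq> sides_at x}"
proof (intro equalityI subsetI)
  fix p assume "p \<in> cls v x"
  then have "((v, x), p) \<in> (glue m)\<^sup>*" by (simp add: tile_class_def)
  then have "snd p = x \<and> fst p \<subseteq> {..<m} \<and> sym_diff v (fst p) \<subseteq> sides_at x"
  proof (induction rule: rtrancl_induct)
    case base then show ?case using assms by auto
  next
    case (step p q)
    from step.hyps(2) obtain w y i where "p = (w, y)" "q = (sym_diff w {i}, y)" "i < m" "y \<in> polygon_side m i"
      unfolding glue_def by blast
    then show ?case using step.IH by (auto simp: sides_at_def)
  qed
  then show "p \<in> {(w, x) | w. w \<subseteq> {..<m} \<and> sym_diff v w \<subseteq> sides_at x}" by (cases p) auto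
next
  fix p assume "p \<in> {(w, x) | w. w \<subseteq> {..<m} \<and> sym_diff v w \<subseteq> sides_at x}"
  then obtain w where w: "p = (w, x)" "w \<subseteq> {..<m}" "sym_diff v w \<subseteq> sides_at x" by auto
  have "finite (sym_diff v w)" using w assms by (auto intro: finite_subset)
  from glue_flip_set[OF this w(3) assms] have "((v, x), (sym_diff v (sym_diff v w), x)) \<in> (glue m)\<^sup>*" .
  moreover have "sym_diff v (sym_diff v w) = w" by auto
  ultimately show "p \<in> cls v x" using w(1) by (simp add: tile_class_def)
qed

lemma tile_class_eq_iff:
  assumes "v \<subseteq> {..<m}" "w \<subseteq> {..<m}"
  shows "cls v x = cls w y \<longleftrightarrow> x = y \<and> sym_diff v w \<subseteq> sides_at x"
proof
  assume "cls v x = cls w y"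
  moreover have "(v, x) \<in> cls v x" by (simp add: tile_class_def)
  ultimately have "(v, x) \<in> cls w y" by simp
  then show "x = y \<and> sym_diff v w \<subseteq> sides_at x" unfolding tile_class_eq[OF assms(2)] by auto
next
  assume *: "x = y \<and> sym_diff v w \<subseteq> sides_at x"
  have "sym_diff v u \<subseteq> sides_at x \<longleftrightarrow> sym_diff w u \<subseteq> sides_at x" for u
    using * by blast
  then show "cls v x = cls w y"
    unfolding tile_class_eq[OF assms(1)] tile_class_eq[OF assms(2)] using * by simp
qed

lemma topspace_tiles_space: "topspace (tiles_space m) = tiles \<times> polygon m"
  by (simp add: tiles_space_def)

lemma topspace_surface: "topspace (surface m) = {cls v x | v x. v \<subseteq> {..<m} \<and> x \<in> polygon m}"
proof -
  have "openin (surface m) (tile_class m ` topspace (tiles_space m))"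
  proof -
    have "{x \<in> topspace (tiles_space m). tile_class m x \<in> tile_class m ` topspace (tiles_space m)} =
        topspace (tiles_space m)" by blast
    then show ?thesis unfolding surface_def openin_quotient_topology by simp
  qed
  moreover have "openin (surface m) U \<Longrightarrow> U \<subseteq> tile_class m ` topspace (tiles_space m)" for U
    unfolding surface_def openin_quotient_topology by simp
  ultimately have "topspace (surface m) = tile_class m ` topspace (tiles_space m)"
    by (meson openin_topspace openin_subset subset_antisym)
  then show ?thesis by (auto simp: topspace_tiles_space)
qed

text \<open>The distance to the line through a side, with a sign that changes when that side is crossed,
  is globally well defined on the surface and 1-Lipschitz; it is what bounds \<open>surface_dist\<close>
  from below.\<close>

definition signed_dist :: "nat \<Rightarrow> surface_point \<Rightarrow> real" where
  "signed_dist j c = (let p = SOME p. p \<in> c in (if j \<in> fst p then -1 else 1) * line_dist j (snd p))"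

text \<open>The choice of representative is harmless: two representatives can differ at
  \<open>j\<close> only if \<open>x\<close> lies on side \<open>j\<close>, and there the distance is
  0.\<close>

lemma signed_dist_class:
  assumes "v \<subseteq> {..<m}" "j < m"
  shows "signed_dist j (cls v x) = (if j \<in> v then -1 else 1) * line_dist j x"
proof -
  define p where "p = (SOME p. p \<in> cls v x)"
  have "(v, x) \<in> cls v x" by (simp add: tile_class_def)
  then have "p \<in> cls v x" unfolding p_def by (rule someI)
  then obtain w where p: "p = (w, x)" "sym_diff v w \<subseteq> sides_at x"
    unfolding tile_class_eq[OF assms(1)] by auto
  have "line_dist j x = 0" if "j \<in> sym_diff v w"
    using that p(2) assms(2) line_dist_side by (auto simp: sides_at_def)
  then show ?thesis
    unfolding signed_dist_def p_def[symmetric] by (auto simp: p(1) Let_def)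
qed

lemma segment_chain_nonneg: "segment_chain m a b l \<Longrightarrow> 0 \<le> l"
  by (induction rule: segment_chain.induct) (auto simp: hyp_dist_nonneg)

lemma segment_chain_lipschitz:
  assumes "segment_chain m a b l" "j < m"
  shows "\<bar>signed_dist j a - signed_dist j b\<bar> \<le> l"
  using assms
proof (induction rule: segment_chain.induct)
  case (step v x l y)
  have "\<bar>signed_dist j (cls v x) - signed_dist j (cls v y)\<bar> = \<bar>line_dist j x - line_dist j y\<bar>"
    using step by (auto simp: signed_dist_class)
  also have "\<dots> \<le> hyp_dist x y"
    using step polygon_in_disc by (intro line_dist_lipschitz) auto
  finally show ?case using step by linarith
qed auto

lemma surface_dist_le:
  assumes "segment_chain m a b l"
  shows "surface_dist m a b \<le> l"
  unfolding surface_dist_def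
  by (rule cInf_lower) (use assms segment_chain_nonneg in \<open>auto intro!: bdd_belowI[of _ 0]\<close>)

text \<open>The given chain guarantees that the infimum is taken over a nonempty set of lengths; the
  bound itself holds for every chain.\<close>

lemma surface_dist_ge:
  assumes "segment_chain m a b l" "j < m"
  shows "\<bar>signed_dist j a - signed_dist j b\<bar> \<le> surface_dist m a b"
  unfolding surface_dist_def
  by (rule cInf_greatest) (use assms segment_chain_lipschitz in auto)

lemma surface_dist_tile_le:
  assumes "v \<subseteq> {..<m}" "x \<in> polygon m" "y \<in> polygon m"
  shows "segment_chain m (cls v x) (cls v y) (hyp_dist x y)"
    and "surface_dist m (cls v x) (cls v y) \<le> hyp_dist x y"
proof -
  have "cls v x \<in> topspace (surface m)" using assms by (auto simp: topspace_surface)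
  from segment_chain.step[OF segment_chain.start[OF this] assms]
  show "segment_chain m (cls v x) (cls v y) (hyp_dist x y)" by simp
  then show "surface_dist m (cls v x) (cls v y) \<le> hyp_dist x y" by (rule surface_dist_le)
qed

lemma line_dist_next: "i < m \<Longrightarrow> line_dist (next_side i) (side_point i t) = half_side - t"
  using line_dist_Suc[of i t] by (simp add: line_dist_def normal_next)

lemma line_dist_prev_side: "i < m \<Longrightarrow> line_dist (prev_side i) (side_point i t) = half_side + t"
  using line_dist_prev[of "prev_side i" t] side_point_next[of "prev_side i"] by simp

lemma sides_at_side_point:
  assumes "i < m" "\<bar>t\<bar> \<le> half_side"
  shows "sides_at (side_point i t) = insert i ((if t = half_side then {next_side i} else {}) \<union>
     (if t = - half_side then {prev_side i} else {}))"
  using side_point_in_side_iff[OF assms(1) _ assms(2)] assms(1) next_prev(1,2)[of i]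
  by (auto simp: sides_at_def)

text \<open>Walking straight along the geodesic through side \<open>i\<close> of tile \<open>v\<close>, the \<open>n\<close>-th edge is side
  \<open>i\<close> of \<open>line_tile n v i\<close>, traversed in the direction \<open>line_sgn n\<close>; both have period 4.\<close>

definition line_tile :: "int \<Rightarrow> nat set \<Rightarrow> nat \<Rightarrow> nat set" where
  "line_tile n v i = sym_diff v ({j. j = next_side i \<and> (n mod 4 = 1 \<or> n mod 4 = 2)} \<union>
     {j. j = prev_side i \<and> (n mod 4 = 2 \<or> n mod 4 = 3)})"

definition line_sgn :: "int \<Rightarrow> int" where "line_sgn n = (if even n then 1 else -1)"

definition edge_line :: "nat set \<Rightarrow> nat \<Rightarrow> real \<Rightarrow> surface_point" where
  "edge_line v i t = (let n = \<lfloor>(t + half_side) / (2 * half_side)\<rfloor> in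
     cls (line_tile n v i) (side_point i (line_sgn n * (t - 2 * half_side * n))))"

section \<open>Straight lines of edges are closed geodesics\<close>

lemma line_tile_subset: "v \<subseteq> {..<m} \<Longrightarrow> line_tile n v i \<subseteq> {..<m}"
  by (auto simp: line_tile_def)

lemma line_tile_0 [simp]: "line_tile 0 v i = v" by (auto simp: line_tile_def)

lemma line_tile_4 [simp]: "line_tile 4 v i = v" by (auto simp: line_tile_def)

lemma line_sgn_cases: "line_sgn n = 1 \<or> line_sgn n = -1" by (simp add: line_sgn_def)

lemma line_tile_step:
  assumes "i < m"
  shows "sym_diff (line_tile n v i) (line_tile (n + 1) v i) = (if even n then {next_side i} else {prev_side i})"
proof -
  have "(n + 1) mod 4 = 1 \<or> (n + 1) mod 4 = 2 \<longleftrightarrow> \<not> (n mod 4 = 2 \<or> n mod 4 = 3)"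
    "(n + 1) mod 4 = 2 \<or> (n + 1) mod 4 = 3 \<longleftrightarrow> (n mod 4 = 1 \<or> n mod 4 = 2)" by presburger+
  moreover have "n mod 4 = 0 \<or> n mod 4 = 1 \<or> n mod 4 = 2 \<or> n mod 4 = 3" by presburger
  moreover have "even n \<longleftrightarrow> n mod 4 = 0 \<or> n mod 4 = 2" by presburger
  ultimately show ?thesis
    unfolding line_tile_def using next_neq[OF assms] by (elim disjE) auto
qed

text \<open>The tiles run through a 4-cycle in which the next and the previous side are flipped
  alternately. At odd \<open>n\<close> the side is traversed backwards, so \<open>k\<close> further
  steps are \<open>- k\<close> steps as seen from the tile reached.\<close>

lemma line_tile_add:
  assumes "i < m"
  shows "line_tile (n + k) v i = line_tile (line_sgn n * k) (line_tile n v i) i"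
proof -
  define A where "A n \<longleftrightarrow> n mod 4 = 1 \<or> n mod 4 = 2" for n :: int
  define B where "B n \<longleftrightarrow> n mod 4 = 2 \<or> n mod 4 = 3" for n :: int
  have "A (n + k) \<longleftrightarrow> A n \<noteq> A (line_sgn n * k)" "B (n + k) \<longleftrightarrow> B n \<noteq> B (line_sgn n * k)"
  proof -
    have mod: "(n + k) mod 4 = (n mod 4 + k mod 4) mod 4" "(- k) mod 4 = (- (k mod 4)) mod 4"
      by (simp_all add: mod_add_eq mod_minus_eq)
    have even: "even n \<longleftrightarrow> n mod 4 = 0 \<or> n mod 4 = 2" by presburger
    have n4: "n mod 4 = 0 \<or> n mod 4 = 1 \<or> n mod 4 = 2 \<or> n mod 4 = 3"
      and k4: "k mod 4 = 0 \<or> k mod 4 = 1 \<or> k mod 4 = 2 \<or> k mod 4 = 3" by presburger+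
    show "A (n + k) \<longleftrightarrow> A n \<noteq> A (line_sgn n * k)" "B (n + k) \<longleftrightarrow> B n \<noteq> B (line_sgn n * k)"
      unfolding A_def B_def line_sgn_def mod even using n4 k4
      by (elim disjE; simp add: mod)+
  qed
  then show ?thesis
    unfolding line_tile_def A_def[symmetric] B_def[symmetric]
    using next_neq(3)[OF assms] by auto
qed

lemma line_index: "\<exists>n::int. \<bar>t - 2 * half_side * n\<bar> \<le> half_side"
proof -
  define n where "n = \<lfloor>(t + half_side) / (2 * half_side)\<rfloor>"
  have "n \<le> (t + half_side) / (2 * half_side)" "(t + half_side) / (2 * half_side) < n + 1"
    by (simp_all add: n_def)
  then have "2 * half_side * n \<le> t + half_side" "t + half_side < 2 * half_side * (n + 1)"
    using half_side_pos by (simp_all add: field_simps)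
  then show ?thesis by (intro exI[of _ n]) (simp add: abs_le_iff algebra_simps)
qed

text \<open>The rounding in \<open>edge_line\<close> picks one of two possible edges at a vertex.
  Both give the same point, because the two tiles differ only in a side through that vertex.\<close>

lemma edge_line_eq:
  assumes i: "i < m" and v: "v \<subseteq> {..<m}" and n: "\<bar>t - 2 * half_side * n\<bar> \<le> half_side"
  shows "edge_line v i t = cls (line_tile n v i) (side_point i (line_sgn n * (t - 2 * half_side * n)))"
proof -
  define N where "N = \<lfloor>(t + half_side) / (2 * half_side)\<rfloor>"
  have N: "edge_line v i t = cls (line_tile N v i) (side_point i (line_sgn N * (t - 2 * half_side * N)))"
    by (simp add: edge_line_def N_def Let_def)
  have "N \<le> (t + half_side) / (2 * half_side)" "(t + half_side) / (2 * half_side) < N + 1"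
    by (simp_all add: N_def)
  then have NN: "2 * half_side * N \<le> t + half_side" "t + half_side < 2 * half_side * (N + 1)"
    using half_side_pos by (simp_all add: field_simps)
  have n': "2 * half_side * n \<le> t + half_side" "t + half_side \<le> 2 * half_side * (n + 1)"
    using n by (simp_all add: abs_le_iff algebra_simps)
  have "2 * half_side * n < 2 * half_side * (N + 1)" "2 * half_side * N \<le> 2 * half_side * (n + 1)"
    using NN n' by linarith+
  then have "real_of_int n < N + 1" "real_of_int N \<le> n + 1"
    using half_side_pos by auto
  then have "N = n \<or> N = n + 1" by linarith
  then show ?thesis
  proof
    assume "N = n + 1"
    then have t: "t - 2 * half_side * n = half_side" "t - 2 * half_side * N = - half_side"
      using NN n' by (auto simp: algebra_simps)
    have sg: "line_sgn N = - line_sgn n" by (simp add: \<open>N = n + 1\<close> line_sgn_def)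
    have pos: "side_point i (line_sgn N * (t - 2 * half_side * N)) = side_point i (line_sgn n * half_side)"
      unfolding t sg by simp
    have "sym_diff (line_tile N v i) (line_tile n v i) = (if even n then {next_side i} else {prev_side i})"
      unfolding \<open>N = n + 1\<close> by (subst Un_commute) (rule line_tile_step[OF i])
    also have "\<dots> \<subseteq> sides_at (side_point i (line_sgn n * half_side))"
      using half_side_pos sides_at_side_point[OF i, of half_side] sides_at_side_point[OF i, of "- half_side"]
      by (cases "even n") (simp_all add: line_sgn_def)
    finally have "sym_diff (line_tile N v i) (line_tile n v i) \<subseteq> sides_at (side_point i (line_sgn n * half_side))" .
    then show ?thesis
      unfolding N pos t(1) using tile_class_eq_iff[OF line_tile_subset[OF v] line_tile_subset[OF v]] by blast
  qed (simp add: N)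
qed

lemma edge_line_shift:
  fixes z :: real
  assumes i: "i < m" and v: "v \<subseteq> {..<m}"
  shows "edge_line v i (2 * half_side * n + z) = edge_line (line_tile n v i) i (line_sgn n * z)"
proof -
  obtain k :: int where k: "\<bar>z - 2 * half_side * k\<bar> \<le> half_side" using line_index by blast
  have 1: "edge_line v i (2 * half_side * n + z) =
      cls (line_tile (n + k) v i) (side_point i (line_sgn (n + k) * (z - 2 * half_side * k)))"
    using k by (subst edge_line_eq[OF i v, of _ "n + k"]) (simp_all add: algebra_simps)
  have "\<bar>line_sgn n * z - 2 * half_side * (line_sgn n * k)\<bar> \<le> half_side"
    using k line_sgn_cases[of n] by (auto simp: abs_minus_commute)
  then have 2: "edge_line (line_tile n v i) i (line_sgn n * z) =
     cls (line_tile (line_sgn n * k) (line_tile n v i) i)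
       (side_point i (line_sgn (line_sgn n * k) * (line_sgn n * z - 2 * half_side * (line_sgn n * k))))"
    using edge_line_eq[OF i line_tile_subset[OF v], of "line_sgn n * z" "line_sgn n * k"] by simp
  have "line_sgn (line_sgn n * k) * (line_sgn n * z - 2 * half_side * (line_sgn n * k)) =
      line_sgn (n + k) * (z - 2 * half_side * k)"
    by (auto simp: line_sgn_def algebra_simps)
  then show ?thesis unfolding 1 2 line_tile_add[OF i] by simp
qed

lemma edge_line_base:
  assumes "i < m" "v \<subseteq> {..<m}" "\<bar>t\<bar> \<le> half_side"
  shows "edge_line v i t = cls v (side_point i t)"
  using edge_line_eq[OF assms(1,2), of t 0] assms(3) by (simp add: line_sgn_def)

lemma edge_line_next:
  assumes "i < m" "v \<subseteq> {..<m}" "\<bar>t - 2 * half_side\<bar> \<le> half_side"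
  shows "edge_line v i t = cls (sym_diff v {next_side i}) (side_point i (2 * half_side - t))"
  using edge_line_eq[OF assms(1,2), of t 1] assms(3) by (simp add: line_sgn_def line_tile_def)

lemma edge_line_prev:
  assumes "i < m" "v \<subseteq> {..<m}" "\<bar>t + 2 * half_side\<bar> \<le> half_side"
  shows "edge_line v i t = cls (sym_diff v {prev_side i}) (side_point i (- t - 2 * half_side))"
  using edge_line_eq[OF assms(1,2), of t "-1"] assms(3) by (simp add: line_sgn_def line_tile_def)

lemma edge_line_in_surface:
  assumes "i < m" "v \<subseteq> {..<m}"
  shows "edge_line v i t \<in> topspace (surface m)" "edge_line v i t \<in> edge_union m"
proof -
  obtain n :: int where n: "\<bar>t - 2 * half_side * n\<bar> \<le> half_side" using line_index by blast
  then have p: "\<bar>line_sgn n * (t - 2 * half_side * n)\<bar> \<le> half_side"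
    using line_sgn_cases[of n] by auto
  show "edge_line v i t \<in> topspace (surface m)"
    unfolding edge_line_eq[OF assms n] topspace_surface
    using line_tile_subset[OF assms(2)] side_point_in_polygon[OF p] by blast
  show "edge_line v i t \<in> edge_union m"
    unfolding edge_line_eq[OF assms n] edge_union_def polygon_side_eq
    using line_tile_subset[OF assms(2)] assms(1) p by (fastforce simp: abs_le_iff)
qed

lemma edge_line_chain_step:
  assumes "i < m" "v \<subseteq> {..<m}" "segment_chain m a (edge_line v i s) l"
    "\<bar>s - 2 * half_side * n\<bar> \<le> half_side" "\<bar>t - 2 * half_side * of_int n\<bar> \<le> half_side"
  shows "segment_chain m a (edge_line v i t) (l + \<bar>s - t\<bar>)"
proof -
  define p where "p t = line_sgn n * (t - 2 * half_side * n)" for t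
  have p: "\<bar>p s\<bar> \<le> half_side" "\<bar>p t\<bar> \<le> half_side" "\<bar>p s - p t\<bar> = \<bar>s - t\<bar>"
    using assms(4,5) line_sgn_cases[of n] by (auto simp: p_def)
  have "segment_chain m a (cls (line_tile n v i) (side_point i (p t)))
      (l + hyp_dist (side_point i (p s)) (side_point i (p t)))"
    using assms(3) unfolding edge_line_eq[OF assms(1,2,4)] p_def[symmetric]
    by (rule segment_chain.step)
      (use line_tile_subset[OF assms(2)] side_point_in_polygon p in auto)
  then show ?thesis
    unfolding edge_line_eq[OF assms(1,2,5)] p_def[symmetric] hyp_dist_side_point p .
qed

lemma edge_line_chain:
  assumes iv: "i < m" "v \<subseteq> {..<m}" and st: "s \<in> {2 * half_side * n - half_side..2 * half_side * n + 3 * half_side}"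
    "t \<in> {2 * half_side * n - half_side..2 * half_side * of_int n + 3 * half_side}"
  shows "segment_chain m (edge_line v i s) (edge_line v i t) \<bar>s - t\<bar>"
proof -
  \<comment> \<open>The time of the vertex between edges \<open>n\<close> and \<open>n + 1\<close>.
    A chain must be broken there, since each of its segments has to lie in one tile.\<close>
  define c where "c = 2 * half_side * n + half_side"
  have piece: "\<exists>k::int. \<bar>s - 2 * half_side * k\<bar> \<le> half_side \<and> \<bar>t - 2 * half_side * k\<bar> \<le> half_side"
    if "s \<le> c \<and> t \<le> c \<or> s \<ge> c \<and> t \<ge> c"
      "s \<in> {2 * half_side * n - half_side..2 * half_side * n + 3 * half_side}"
      "t \<in> {2 * half_side * n - half_side..2 * half_side * of_int n + 3 * half_side}" for s t
    using that(1)
  proof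
    assume "s \<le> c \<and> t \<le> c"
    then show ?thesis using that(2,3) by (intro exI[of _ n]) (auto simp: c_def abs_le_iff)
  next
    assume "s \<ge> c \<and> t \<ge> c"
    then show ?thesis using that(2,3) by (intro exI[of _ "n + 1"]) (auto simp: c_def abs_le_iff algebra_simps)
  qed
  have c: "c \<in> {2 * half_side * n - half_side..2 * half_side * of_int n + 3 * half_side}"
    using half_side_pos by (auto simp: c_def)
  note start = segment_chain.start[OF edge_line_in_surface(1)[OF iv]]
  show ?thesis
  proof (cases "s \<le> c \<and> t \<le> c \<or> s \<ge> c \<and> t \<ge> c")
    case True
    then show ?thesis using piece[OF _ st] edge_line_chain_step[OF iv start[of s]] by fastforce
  next
    case False
    obtain k :: int where k: "\<bar>s - 2 * half_side * k\<bar> \<le> half_side" "\<bar>c - 2 * half_side * k\<bar> \<le> half_side"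
      using piece[OF _ st(1) c] by fastforce
    obtain k' :: int where k': "\<bar>c - 2 * half_side * k'\<bar> \<le> half_side" "\<bar>t - 2 * half_side * k'\<bar> \<le> half_side"
      using piece[OF _ c st(2)] by fastforce
    have "segment_chain m (edge_line v i s) (edge_line v i t) (0 + \<bar>s - c\<bar> + \<bar>c - t\<bar>)"
      using edge_line_chain_step[OF iv edge_line_chain_step[OF iv start[of s] k] k'] .
    moreover have "0 + \<bar>s - c\<bar> + \<bar>c - t\<bar> = \<bar>s - t\<bar>" using False by auto
    ultimately show ?thesis by simp
  qed
qed

text \<open>Past the vertex the position on the side turns back to \<open>2 * half_side - z\<close>,
  but the tile has also crossed the next side and the sign changes. The two effects cancel and the
  formula stays linear across the vertex.\<close>

lemma edge_line_signed_next:
  assumes "i < m" "v \<subseteq> {..<m}" "z \<in> {- half_side..3 * half_side}"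
  shows "signed_dist (next_side i) (edge_line v i z) = (if next_side i \<in> v then -1 else 1) * (half_side - z)"
proof (cases "z \<le> half_side")
  case True
  then show ?thesis using assms
    by (subst edge_line_base) (auto simp: signed_dist_class line_dist_next)
next
  case False
  have "sym_diff v {next_side i} \<subseteq> {..<m}" using assms by auto
  then show ?thesis using assms False
    by (subst edge_line_next) (auto simp: signed_dist_class line_dist_next)
qed

lemma edge_line_signed_prev:
  assumes "i < m" "v \<subseteq> {..<m}" "z \<in> {- 3 * half_side..half_side}"
  shows "signed_dist (prev_side i) (edge_line v i z) = (if prev_side i \<in> v then -1 else 1) * (half_side + z)"
proof (cases "z \<ge> - half_side")
  case True
  then show ?thesis using assms
    by (subst edge_line_base) (auto simp: signed_dist_class line_dist_prev_side)
next
  case False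
  have "sym_diff v {prev_side i} \<subseteq> {..<m}" using assms by auto
  then show ?thesis using assms False
    by (subst edge_line_prev) (auto simp: signed_dist_class line_dist_prev_side)
qed

text \<open>The interval consists of two consecutive edges. The signed distance to the line crossing
  perpendicularly at their common vertex equals arc length up to sign, and being 1-Lipschitz it
  shows that no chain is shorter than the edges.\<close>

lemma edge_line_isometric:
  assumes iv: "i < m" "v \<subseteq> {..<m}" and st: "s \<in> {2 * half_side * n - half_side..2 * half_side * n + 3 * half_side}"
    "t \<in> {2 * half_side * n - half_side..2 * half_side * of_int n + 3 * half_side}"
  shows "surface_dist m (edge_line v i s) (edge_line v i t) = \<bar>s - t\<bar>"
proof (rule antisym)
  note chain = edge_line_chain[OF assms]
  show "surface_dist m (edge_line v i s) (edge_line v i t) \<le> \<bar>s - t\<bar>"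
    by (rule surface_dist_le[OF chain])
  define a b where "a = s - 2 * half_side * n" and "b = t - 2 * half_side * n"
  let ?w = "line_tile n v i"
  have w: "?w \<subseteq> {..<m}" by (rule line_tile_subset[OF iv(2)])
  have ab: "a \<in> {- half_side..3 * half_side}" "b \<in> {- half_side..3 * half_side}"
    using st by (auto simp: a_def b_def)
  have eq: "edge_line v i s = edge_line ?w i (line_sgn n * a)" "edge_line v i t = edge_line ?w i (line_sgn n * b)"
    using edge_line_shift[OF iv, where n = n and z = a] edge_line_shift[OF iv, where n = n and z = b] by (auto simp: a_def b_def)
  have "\<exists>j<m. \<bar>signed_dist j (edge_line v i s) - signed_dist j (edge_line v i t)\<bar> = \<bar>s - t\<bar>"
  \<comment> \<open>Edges \<open>n\<close> and \<open>n + 1\<close> meet at the next side for even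
    \<open>n\<close> and at the previous side for odd \<open>n\<close>.\<close>
  proof (cases "even n")
    case True
    then show ?thesis
      using edge_line_signed_next[OF iv(1) w ab(1)] edge_line_signed_next[OF iv(1) w ab(2)]
      by (intro exI[of _ "next_side i"]) (auto simp: eq line_sgn_def a_def b_def)
  next
    case False
    then show ?thesis
      using edge_line_signed_prev[OF iv(1) w, of "- a"] edge_line_signed_prev[OF iv(1) w, of "- b"] ab
      by (intro exI[of _ "prev_side i"]) (auto simp: eq line_sgn_def a_def b_def)
  qed
  then show "\<bar>s - t\<bar> \<le> surface_dist m (edge_line v i s) (edge_line v i t)"
    using surface_dist_ge[OF chain] by metis
qed

lemma edge_line_geodesic:
  assumes iv: "i < m" "v \<subseteq> {..<m}"
  shows "geodesic_line m (edge_line v i)"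
  unfolding geodesic_line_def
proof (intro conjI allI)
  show "edge_line v i t \<in> topspace (surface m)" for t by (rule edge_line_in_surface(1)[OF iv])
  fix t
  obtain n :: int where n: "\<bar>t - 2 * half_side * n\<bar> \<le> half_side" using line_index by blast
  define N where "N = 2 * half_side * n"
  have n: "t \<le> N + half_side" "N - half_side \<le> t" using n unfolding N_def abs_le_iff by linarith+
  have "\<exists>k::int. \<forall>s\<in>ball t half_side. s \<in> {2 * half_side * k - half_side..2 * half_side * k + 3 * half_side}"
  \<comment> \<open>\<open>N\<close> is the midpoint of the edge containing \<open>t\<close>. In its
    first half the ball reaches back at most to the preceding edge, in its second half forward at
    most to the following one.\<close>
  proof (cases "t < N")
    case True
    have k: "2 * half_side * of_int (n - 1) = N - 2 * half_side" 
      unfolding N_def of_int_diff of_int_1 right_diff_distrib by simp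
    show ?thesis
    proof (intro exI[of _ "n - 1"] ballI)
      fix s assume "s \<in> ball t half_side"
      then have "s < t + half_side" "t - half_side < s"
        unfolding mem_ball dist_real_def by linarith+
      then show "s \<in> {2 * half_side * of_int (n - 1) - half_side..2 * half_side * of_int (n - 1) + 3 * half_side}"
        unfolding k atLeastAtMost_iff using n True half_side_pos by linarith
    qed
  next
    case False
    show ?thesis
    proof (intro exI[of _ n] ballI)
      fix s assume "s \<in> ball t half_side"
      then have "s < t + half_side" "t - half_side < s"
        unfolding mem_ball dist_real_def by linarith+
      then show "s \<in> {2 * half_side * n - half_side..2 * half_side * n + 3 * half_side}"
        unfolding N_def[symmetric] atLeastAtMost_iff using n False half_side_pos by linarith
    qed
  qed
  then obtain k :: int where k: "\<And>s. s \<in> ball t half_side \<Longrightarrow>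
      s \<in> {2 * half_side * k - half_side..2 * half_side * k + 3 * half_side}"
    by blast
  show "\<exists>\<epsilon>>0. \<forall>s\<in>ball t \<epsilon>. \<forall>s'\<in>ball t \<epsilon>. surface_dist m (edge_line v i s) (edge_line v i s') = \<bar>s - s'\<bar>"
  proof (rule exI[of _ half_side], rule conjI[OF half_side_pos], intro ballI)
    fix s s' assume "s \<in> ball t half_side" "s' \<in> ball t half_side"
    from edge_line_isometric[OF iv k[OF this(1)] k[OF this(2)]]
    show "surface_dist m (edge_line v i s) (edge_line v i s') = \<bar>s - s'\<bar>" .
  qed
qed

lemma edge_line_periodic:
  assumes iv: "i < m" "v \<subseteq> {..<m}"
  shows "edge_line v i (t + 8 * half_side) = edge_line v i t"
proof -
  have sg: "line_sgn 4 = 1" by (simp add: line_sgn_def)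
  have "edge_line v i (2 * half_side * of_int 4 + t) = edge_line v i (of_int 1 * t)"
    using edge_line_shift[OF iv, of 4 t] unfolding line_tile_4 sg .
  moreover have "2 * half_side * of_int 4 + t = t + 8 * half_side" by simp
  ultimately show ?thesis by (simp only: of_int_1 mult_1)
qed

text \<open>Time 0 is the midpoint of a side, where only side \<open>i\<close> may be flipped. A
  return to it after 1, 2 or 3 edges would have flipped the next or the previous side.\<close>

lemma edge_line_no_shorter_period:
  assumes iv: "i < m" "v \<subseteq> {..<m}" and T: "0 < T" "T < 8 * half_side"
  shows "edge_line v i T \<noteq> edge_line v i 0"
proof
  obtain n :: int where n: "\<bar>T - 2 * half_side * n\<bar> \<le> half_side" using line_index by blast
  assume "edge_line v i T = edge_line v i 0"
  then have "cls (line_tile n v i) (side_point i (line_sgn n * (T - 2 * half_side * n))) =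
      cls v (side_point i 0)"
    using edge_line_eq[OF iv n] edge_line_base[OF iv, of 0] half_side_pos by simp
  then have *: "side_point i (line_sgn n * (T - 2 * half_side * n)) = side_point i 0"
    "sym_diff (line_tile n v i) v \<subseteq> sides_at (side_point i 0)"
    using tile_class_eq_iff[OF line_tile_subset[OF iv(2)] iv(2)] by metis+
  then have T': "T = 2 * half_side * n" using line_sgn_cases[of n] by (auto simp: side_point_inj)
  have "sides_at (side_point i 0) = {i}"
    using sides_at_side_point[OF iv(1), of 0] half_side_pos by auto
  then have sub: "{j. j = next_side i \<and> (n mod 4 = 1 \<or> n mod 4 = 2)} \<union>
     {j. j = prev_side i \<and> (n mod 4 = 2 \<or> n mod 4 = 3)} \<subseteq> {i}"
    using *(2) unfolding line_tile_def by blast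
  have "0 < real_of_int n" "real_of_int n < 4"
    using T half_side_pos unfolding T' by (auto simp: zero_less_mult_iff)
  then have "n = 1 \<or> n = 2 \<or> n = 3" by linarith
  then show False using sub next_neq[OF iv(1)] by auto
qed

lemma edge_line_closed_geodesic:
  assumes iv: "i < m" "v \<subseteq> {..<m}"
  shows "closed_geodesic m (edge_line v i) (8 * half_side)"
  unfolding closed_geodesic_def
  using edge_line_geodesic[OF iv] half_side_pos edge_line_periodic[OF iv] edge_line_no_shorter_period[OF iv]
  by (metis add_0 mult_pos_pos zero_less_numeral)

end

section \<open>Geodesics contained in the edges\<close>

lemma sym_diff_swap: "sym_diff A B = C \<Longrightarrow> A = sym_diff B C"
  by (drule sym) auto

lemma real_isometry_ball:
  fixes f :: "real \<Rightarrow> real"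
  assumes e: "e > 0" and f: "\<And>s s'. s \<in> ball t e \<Longrightarrow> s' \<in> ball t e \<Longrightarrow> \<bar>f s - f s'\<bar> = \<bar>s - s'\<bar>"
  shows "\<exists>\<sigma>\<in>{1, -1}. \<forall>s\<in>ball t e. f s = f t + \<sigma> * (s - t)"
proof -
  \<comment> \<open>On the real line, the distances of \<open>f s\<close> to two different values
    determine it, so one extra point \<open>u\<close> fixes the direction for the whole
    ball.\<close>
  define u where "u = t + e / 2"
  have u: "u \<in> ball t e" "t \<in> ball t e" "u > t" using e by (auto simp: u_def dist_real_def)
  have "\<bar>f u - f t\<bar> = u - t" using f[OF u(1,2)] u(3) by simp
  then consider "f u = f t + (u - t)" | "f u = f t - (u - t)" by linarith
  then show ?thesis
  proof cases
    case 1
    have "f s = f t + 1 * (s - t)" if s: "s \<in> ball t e" for s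
      using f[OF s u(2)] f[OF s u(1)] 1 u(3) by (auto simp: abs_if split: if_splits)
    then show ?thesis by blast
  next
    case 2
    have "f s = f t + -1 * (s - t)" if s: "s \<in> ball t e" for s
      using f[OF s u(2)] f[OF s u(1)] 2 u(3) by (auto simp: abs_if split: if_splits)
    then show ?thesis by blast
  qed
qed

context right_angled_polygon begin

text \<open>Coordinates are flipped one at a time: from vertex 0 walk to the midpoint of side
  \<open>j\<close>, pass through it into the neighbouring tile, and return to vertex 0
  there.\<close>

lemma segment_chain_exists:
  assumes "a \<in> topspace (surface m)" "b \<in> topspace (surface m)"
  shows "\<exists>l. segment_chain m a b l"
proof -
  obtain v x where a: "a = cls v x" "v \<subseteq> {..<m}" "x \<in> polygon m"
    using assms(1) by (auto simp: topspace_surface)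
  obtain w y where b: "b = cls w y" "w \<subseteq> {..<m}" "y \<in> polygon m"
    using assms(2) by (auto simp: topspace_surface)
  have "\<exists>l. segment_chain m a (cls (sym_diff v D) (vertex m 0)) l" if "finite D" "D \<subseteq> {..<m}" for D
    using that
  proof (induction D rule: finite_induct)
    case empty
    have "segment_chain m a (cls v (vertex m 0)) (hyp_dist x (vertex m 0))"
      using surface_dist_tile_le(1)[OF a(2,3) vertex_in_polygon] a(1) by simp
    then show ?case by auto
  next
    case (insert j D)
    define u where "u = sym_diff v D"
    define p where "p = side_point j 0"
    have p: "p \<in> polygon m" using half_side_pos by (simp add: p_def side_point_in_polygon)
    have j: "j \<in> sides_at p"
      using insert.prems half_side_pos sides_at_side_point[of j 0] by (simp add: p_def)
    have u: "u \<subseteq> {..<m}" "sym_diff v (insert j D) \<subseteq> {..<m}" using insert.prems a(2) by (auto simp: u_def)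
    have "sym_diff u (sym_diff v (insert j D)) \<subseteq> {j}" by (auto simp: u_def)
    then have eq: "cls u p = cls (sym_diff v (insert j D)) p"
      using tile_class_eq_iff[OF u] j by blast
    obtain l where "segment_chain m a (cls u (vertex m 0)) l" using insert u_def by auto
    then have "segment_chain m a (cls u p) (l + hyp_dist (vertex m 0) p)"
      by (rule segment_chain.step[OF _ u(1) vertex_in_polygon p])
    from segment_chain.step[OF this[unfolded eq] u(2) p vertex_in_polygon] show ?case by blast
  qed
  from this[of "sym_diff v w"] obtain l where
    "segment_chain m a (cls (sym_diff v (sym_diff v w)) (vertex m 0)) l"
    using a(2) b(2) by (meson Diff_subset Un_least finite_lessThan finite_subset subset_trans)
  moreover have "sym_diff v (sym_diff v w) = w" by auto
  ultimately have "segment_chain m a (cls w (vertex m 0)) l" by simp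
  from segment_chain.step[OF this b(2) vertex_in_polygon b(3)] show ?thesis using b(1) by blast
qed

lemma signed_dist_lipschitz:
  assumes "a \<in> topspace (surface m)" "b \<in> topspace (surface m)" "j < m"
  shows "\<bar>signed_dist j a - signed_dist j b\<bar> \<le> surface_dist m a b"
  using segment_chain_exists[OF assms(1,2)] surface_dist_ge assms(3) by blast

text \<open>At the given point the lines of all sides not through it are at positive distance.
  Moving by less than that, one can neither reach such a side nor change the sign of its signed
  distance, so a tile containing the new point differs only in sides through the old one.\<close>

lemma nearby_edge_points:
  assumes v: "v \<subseteq> {..<m}" and i: "i < m" and t: "\<bar>t\<bar> \<le> half_side"
  shows "\<exists>\<eta>>0. \<forall>w y k. w \<subseteq> {..<m} \<longrightarrow> k < m \<longrightarrow> y \<in> polygon_side m k \<longrightarrow>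
       surface_dist m (cls v (side_point i t)) (cls w y) < \<eta> \<longrightarrow>
       k \<in> sides_at (side_point i t) \<and> sym_diff v w \<subseteq> sides_at (side_point i t)"
proof -
  let ?x = "side_point i t"
  \<comment> \<open>The element 1 makes \<open>Min\<close> range over a nonempty set without a case
    distinction.\<close>
  define \<eta> where "\<eta> = Min (insert 1 ((\<lambda>j. line_dist j ?x) ` ({..<m} - sides_at ?x)))"
  have x: "?x \<in> polygon m" by (rule side_point_in_polygon[OF t])
  have \<eta>0: "\<eta> > 0"
    unfolding \<eta>_def using line_dist_side_point_pos[OF i _ t] by (subst Min_gr_iff) (auto simp: sides_at_def)
  have \<eta>: "\<eta> \<le> line_dist j ?x" if "j < m" "j \<notin> sides_at ?x" for j
    unfolding \<eta>_def using that by (intro Min_le) auto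
  have "\<forall>w y k. w \<subseteq> {..<m} \<longrightarrow> k < m \<longrightarrow> y \<in> polygon_side m k \<longrightarrow>
      surface_dist m (cls v ?x) (cls w y) < \<eta> \<longrightarrow> k \<in> sides_at ?x \<and> sym_diff v w \<subseteq> sides_at ?x"
  proof (intro allI impI)
    fix w y k
    assume w: "w \<subseteq> {..<m}" and k: "k < m" and y: "y \<in> polygon_side m k"
      and d: "surface_dist m (cls v ?x) (cls w y) < \<eta>"
    have yP: "y \<in> polygon m" using y polygon_side_subset by blast
    have top: "cls v ?x \<in> topspace (surface m)" "cls w y \<in> topspace (surface m)"
      using v w x yP by (auto simp: topspace_surface)
    have lip: "\<bar>(if j \<in> v then -1 else 1) * line_dist j ?x - (if j \<in> w then -1 else 1) * line_dist j y\<bar> < \<eta>"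
      if "j < m" for j
      using signed_dist_lipschitz[OF top that] d signed_dist_class[OF v that, of ?x]
        signed_dist_class[OF w that, of y] by simp
    have "k \<in> sides_at ?x"
    proof (rule ccontr)
      assume "k \<notin> sides_at ?x"
      then have "\<eta> \<le> line_dist k ?x" by (rule \<eta>[OF k])
      then show False using lip[OF k] line_dist_side[OF y k] by (auto split: if_splits)
    qed
    moreover have "j \<in> sides_at ?x" if "j \<in> sym_diff v w" for j
    proof (rule ccontr)
      assume j: "j \<notin> sides_at ?x"
      have jm: "j < m" using that v w by auto
      have "\<eta> \<le> line_dist j ?x" by (rule \<eta>[OF jm j])
      then show False using lip[OF jm] that line_dist_nonneg[OF yP jm] by (auto split: if_splits)
    qed
    ultimately show "k \<in> sides_at ?x \<and> sym_diff v w \<subseteq> sides_at ?x" by blast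
  qed
  with \<eta>0 show ?thesis by (intro exI[of _ \<eta>] conjI)
qed

lemma surface_dist_same_side:
  assumes "v \<subseteq> {..<m}" "i < m" "\<bar>s\<bar> \<le> half_side" "\<bar>t\<bar> \<le> half_side"
  shows "surface_dist m (cls v (side_point i s)) (cls v (side_point i t)) = \<bar>s - t\<bar>"
  using edge_line_isometric[OF assms(2,1), of s 0 t] edge_line_base[OF assms(2,1)] assms(3,4) half_side_pos
  by (simp add: abs_le_iff)

definition line_family :: "(real \<Rightarrow> surface_point) set" where
  "line_family = {\<lambda>s. edge_line v i (\<sigma> * s + c) | v i \<sigma> c. v \<subseteq> {..<m} \<and> i < m \<and> \<sigma> \<in> {1, -1}}"

lemma line_familyI:
  "\<lbrakk>v \<subseteq> {..<m}; i < m; \<sigma> \<in> {1, -1}\<rbrakk> \<Longrightarrow> (\<lambda>s. edge_line v i (\<sigma> * (s - a) + c)) \<in> line_family"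
proof -
  assume *: "v \<subseteq> {..<m}" "i < m" "\<sigma> \<in> {1, -1}"
  have "(\<lambda>s. edge_line v i (\<sigma> * (s - a) + c)) = (\<lambda>s. edge_line v i (\<sigma> * s + (c - \<sigma> * a)))"
    by (simp add: algebra_simps)
  then show ?thesis unfolding line_family_def using * by blast
qed

text \<open>Away from the vertices all nearby edge points lie on the same side of the same tile, so
  the curve becomes an isometry of an interval, hence a shift or a reflection.\<close>

lemma geodesic_local_side:
  assumes \<gamma>: "geodesic_line m \<gamma>" "range \<gamma> \<subseteq> edge_union m"
    and v: "v \<subseteq> {..<m}" and i: "i < m" and t: "\<bar>r\<bar> < half_side" and \<gamma>t: "\<gamma> t = cls v (side_point i r)"
  shows "\<exists>e>0. \<exists>\<tau>\<in>line_family. \<forall>s\<in>ball t e. \<gamma> s = \<tau> s"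
proof -
  obtain \<epsilon> where \<epsilon>: "\<epsilon> > 0" "\<And>s s'. s \<in> ball t \<epsilon> \<Longrightarrow> s' \<in> ball t \<epsilon> \<Longrightarrow> surface_dist m (\<gamma> s) (\<gamma> s') = \<bar>s - s'\<bar>"
    using \<gamma>(1) unfolding geodesic_line_def by blast
  have t': "\<bar>r\<bar> \<le> half_side" using t by simp
  obtain \<eta> where \<eta>: "\<eta> > 0" "\<forall>w y k. w \<subseteq> {..<m} \<longrightarrow> k < m \<longrightarrow> y \<in> polygon_side m k \<longrightarrow>
       surface_dist m (cls v (side_point i r)) (cls w y) < \<eta> \<longrightarrow>
       k \<in> sides_at (side_point i r) \<and> sym_diff v w \<subseteq> sides_at (side_point i r)"
    using nearby_edge_points[OF v i t'] by (elim exE conjE)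
  have sides: "sides_at (side_point i r) = {i}"
    using sides_at_side_point[OF i t'] t by auto
  define e where "e = min \<epsilon> \<eta>"
  have e: "e > 0" using \<epsilon> \<eta> by (simp add: e_def)
  have in_ball: "s \<in> ball t \<epsilon>" "\<bar>t - s\<bar> < \<eta>" if "s \<in> ball t e" for s
    using that by (auto simp: e_def dist_real_def)
  have "\<exists>p. \<bar>p\<bar> \<le> half_side \<and> \<gamma> s = cls v (side_point i p)" if s: "s \<in> ball t e" for s
  proof -
    obtain w y k where q: "\<gamma> s = cls w y" "w \<subseteq> {..<m}" "k < m" "y \<in> polygon_side m k"
      using \<gamma>(2) unfolding edge_union_def by blast
    have "surface_dist m (\<gamma> t) (\<gamma> s) < \<eta>"
      using \<epsilon>(2)[of t s] in_ball[OF s] \<epsilon>(1) by simp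
    then have "k = i" "sym_diff v w \<subseteq> {i}"
      using \<eta>(2)[rule_format, OF q(2-4)] sides unfolding \<gamma>t q(1) by auto
    then obtain p where p: "y = side_point i p" "\<bar>p\<bar> \<le> half_side"
      using q(4) by (auto simp: polygon_side_eq abs_le_iff)
    have "i \<in> sides_at y" using q(3,4) \<open>k = i\<close> by (simp add: sides_at_def)
    then have "cls v y = cls w y" using tile_class_eq_iff[OF v q(2)] \<open>sym_diff v w \<subseteq> {i}\<close> by blast
    then show ?thesis using p q(1) by metis
  qed
  then obtain p where p: "\<And>s. s \<in> ball t e \<Longrightarrow> \<bar>p s\<bar> \<le> half_side \<and> \<gamma> s = cls v (side_point i (p s))"
    by metis
  have iso: "\<bar>p s - p s'\<bar> = \<bar>s - s'\<bar>" if s: "s \<in> ball t e" "s' \<in> ball t e" for s s'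
    using surface_dist_same_side[OF v i, of "p s" "p s'"] p[OF s(1)] p[OF s(2)]
      \<epsilon>(2)[OF in_ball(1)[OF s(1)] in_ball(1)[OF s(2)]] by metis
  obtain \<sigma> where \<sigma>: "\<sigma> \<in> {1, -1}" "\<And>s. s \<in> ball t e \<Longrightarrow> p s = p t + \<sigma> * (s - t)"
    using real_isometry_ball[OF e iso] by blast
  have line: "\<gamma> s = edge_line v i (\<sigma> * (s - t) + p t)" if s: "s \<in> ball t e" for s
  proof -
    have "edge_line v i (p s) = cls v (side_point i (p s))"
      using edge_line_base[OF i v] p[OF s] by blast
    then show ?thesis using p[OF s] \<sigma>(2)[OF s] by (simp add: add.commute)
  qed
  show ?thesis
    by (rule exI[of _ e], rule conjI[OF e], rule bexI[OF _ line_familyI[OF v i \<sigma>(1)]], rule ballI, erule line)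
qed

text \<open>At a vertex four half-edges meet. Two points on the same or on perpendicular half-edges are
  closer than the sum of their distances to the vertex, so a geodesic has to go straight on.\<close>

definition half_edge :: "nat \<Rightarrow> bool \<Rightarrow> nat set \<Rightarrow> real \<Rightarrow> surface_point" where
  "half_edge i b w a = (if b then cls w (side_point i (half_side - a))
     else cls w (side_point (next_side i) (a - half_side)))"

lemma sides_at_corner:
  assumes "i < m"
  shows "sides_at (side_point i half_side) = {i, next_side i}"
    "side_point (next_side i) (- half_side) = side_point i half_side"
proof -
  show "sides_at (side_point i half_side) = {i, next_side i}"
    using sides_at_side_point[OF assms, of half_side] half_side_pos by auto
  show "side_point (next_side i) (- half_side) = side_point i half_side"
    using side_point_ends[of "next_side i"] side_point_ends[of i] vertex_next by simp
qed

text \<open>So \<open>a\<close> is arc length from the vertex shared by side \<open>i\<close> and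
  the next one, and it can be recovered from the metric.\<close>

lemma half_edge_dist_vertex:
  assumes i: "i < m" and w: "w \<subseteq> {..<m}" and a: "0 \<le> a" "a \<le> 2 * half_side"
  shows "surface_dist m (cls w (side_point i half_side)) (half_edge i b w a) = a"
proof (cases b)
  case True
  then show ?thesis
    using surface_dist_same_side[OF w i, of half_side "half_side - a"] a half_side_pos
    by (simp add: half_edge_def abs_le_iff)
next
  case False
  then show ?thesis
    using surface_dist_same_side[OF w next_prev(1), of "- half_side" "a - half_side" i] a half_side_pos
    by (simp add: half_edge_def abs_le_iff sides_at_corner[OF i])
qed

lemma half_edge_dist_same:
  assumes i: "i < m" and w: "w \<subseteq> {..<m}" and a: "0 < a" "a \<le> 2 * half_side" "0 < a'" "a' \<le> 2 * half_side"
  shows "surface_dist m (half_edge i b w a) (half_edge i b w a') < a + a'"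
proof (cases b)
  case True
  then show ?thesis
    using surface_dist_same_side[OF w i, of "half_side - a" "half_side - a'"] a
    by (simp add: half_edge_def abs_le_iff abs_less_iff)
next
  case False
  then show ?thesis
    using surface_dist_same_side[OF w next_prev(1), of "a - half_side" "a' - half_side" i] a
    by (simp add: half_edge_def abs_le_iff abs_less_iff)
qed

text \<open>A half-edge does not see the flip of the side it lies on. What distinguishes the two
  collinear half-edges is the flip of the other side at the vertex.\<close>

lemma half_edge_cong:
  assumes i: "i < m" and w: "w \<subseteq> {..<m}" "w' \<subseteq> {..<m}" and a: "0 \<le> a" "a \<le> 2 * half_side"
    and d: "sym_diff w w' \<subseteq> {if b then i else next_side i}"
  shows "half_edge i b w a = half_edge i b w' a"
proof (cases b)
  case True
  have "\<bar>half_side - a\<bar> \<le> half_side" using a by (simp add: abs_le_iff)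
  then have "i \<in> sides_at (side_point i (half_side - a))" using sides_at_side_point[OF i] by simp
  then show ?thesis using True d tile_class_eq_iff[OF w] by (auto simp: half_edge_def)
next
  case False
  have "\<bar>a - half_side\<bar> \<le> half_side" using a by (simp add: abs_le_iff)
  then have "next_side i \<in> sides_at (side_point (next_side i) (a - half_side))"
    using sides_at_side_point[OF next_prev(1)] by simp
  then show ?thesis using False d tile_class_eq_iff[OF w] by (auto simp: half_edge_def)
qed

text \<open>Perpendicular half-edges bound a common tile. There the hypotenuse arcosh (cosh b cosh
  b') is strictly shorter than b + b', because cosh (b + b') has the extra positive term sinh b sinh
  b'.\<close>

lemma half_edge_dist_corner:
  assumes i: "i < m" and w: "w \<subseteq> {..<m}" "w' \<subseteq> {..<m}" "sym_diff w w' \<subseteq> {i, next_side i}"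
    and a: "0 < a" "a \<le> 2 * half_side" "0 < a'" "a' \<le> 2 * half_side"
  shows "surface_dist m (half_edge i True w a) (half_edge i False w' a') < a + a'"
    and "surface_dist m (half_edge i False w a) (half_edge i True w' a') < a + a'"
proof -
  have corner: "arcosh (cosh b * cosh b') < b + b'" if b: "0 < b" "0 < b'" for b b' :: real
  proof -
    have "cosh b * cosh b' < cosh (b + b')" using b by (simp add: cosh_add)
    moreover have "1 \<le> cosh b * cosh b'"
      using mult_mono[of 1 "cosh b" 1 "cosh b'"] cosh_real_ge_1[of b] cosh_real_ge_1[of b'] by simp
    ultimately have "arcosh (cosh b * cosh b') < arcosh (cosh (b + b'))"
      by (subst arcosh_less_iff_real) auto
    then show ?thesis using b by (simp add: arcosh_cosh_real)
  qed
  have sym: "hyp_dist x y = hyp_dist y x" for x y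
    by (simp add: hyp_dist_def inner_commute mult.commute)
  have main: "surface_dist m (half_edge i True u b) (half_edge i False u b') < b + b'"
    "surface_dist m (half_edge i False u b') (half_edge i True u b) < b' + b"
    if u: "u \<subseteq> {..<m}" and b: "0 < b" "b \<le> 2 * half_side" "0 < b'" "b' \<le> 2 * half_side" for u b b'
  proof -
    have P: "side_point i (half_side - b) \<in> polygon m" "side_point (next_side i) (b' - half_side) \<in> polygon m"
      using b by (auto intro!: side_point_in_polygon simp: abs_le_iff)
    have "hyp_dist (side_point i (half_side - b)) (side_point (next_side i) (b' - half_side)) < b + b'"
      using corner[OF b(1,3)] hyp_dist_corner[of i "half_side - b" "b' - half_side"]
      by (simp add: side_point_next[OF i])
    then show "surface_dist m (half_edge i True u b) (half_edge i False u b') < b + b'"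
      "surface_dist m (half_edge i False u b') (half_edge i True u b) < b' + b"
      using surface_dist_tile_le(2)[OF u P] surface_dist_tile_le(2)[OF u P(2,1)] sym
      by (auto simp: half_edge_def)
  qed
  show "surface_dist m (half_edge i True w a) (half_edge i False w' a') < a + a'"
  proof -
    \<comment> \<open>A tile touching both half-edges: the one on side \<open>i\<close> does not see
      the flip of \<open>i\<close>, so that bit can be taken from \<open>w'\<close> and the others
      from \<open>w\<close>.\<close>
    define u where "u = {j. if j = i then j \<in> w' else j \<in> w}"
    have u: "u \<subseteq> {..<m}" using w i by (auto simp: u_def split: if_splits)
    have "half_edge i True w a = half_edge i True u a"
      by (rule half_edge_cong[OF i w(1) u]) (use a in \<open>auto simp: u_def\<close>)
    moreover have "half_edge i False w' a' = half_edge i False u a'"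
      by (rule half_edge_cong[OF i w(2) u]) (use a w(3) in \<open>auto simp: u_def\<close>)
    ultimately show ?thesis using main(1)[OF u a] by simp
  qed
  show "surface_dist m (half_edge i False w a) (half_edge i True w' a') < a + a'"
  proof -
    define u where "u = {j. if j = i then j \<in> w else j \<in> w'}"
    have u: "u \<subseteq> {..<m}" using w i by (auto simp: u_def split: if_splits)
    have "half_edge i True w' a' = half_edge i True u a'"
      by (rule half_edge_cong[OF i w(2) u]) (use a in \<open>auto simp: u_def\<close>)
    moreover have "half_edge i False w a = half_edge i False u a"
      by (rule half_edge_cong[OF i w(1) u]) (use a w(3) in \<open>auto simp: u_def\<close>)
    ultimately show ?thesis using main(2)[OF u a(3,4,1,2)] by simp
  qed
qed

lemma half_edge_line:
  assumes i: "i < m" and w: "w \<subseteq> {..<m}" and s: "\<bar>s\<bar> \<le> 2 * half_side"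
    and k: "k = (if b then next_side i else i)" and w': "w' = (if s \<ge> 0 then w else sym_diff w {k})"
  shows "half_edge i b w' \<bar>s\<bar> = edge_line w (if b then i else next_side i) ((if b then -1 else 1) * s + (if b then half_side else - half_side))"
proof (cases b; cases "s \<ge> 0")
  assume "b" "s \<ge> 0"
  then show ?thesis using s w' edge_line_base[OF i w, of "half_side - s"]
    by (simp add: half_edge_def abs_le_iff add.commute)
next
  assume "b" "\<not> s \<ge> 0"
  then show ?thesis using s w' k edge_line_next[OF i w, of "half_side - s"]
    by (simp add: half_edge_def abs_le_iff add.commute)
next
  assume "\<not> b" "s \<ge> 0"
  then show ?thesis using s w' edge_line_base[OF next_prev(1) w, of "s - half_side" i]
    by (simp add: half_edge_def abs_le_iff)
next
  assume "\<not> b" "\<not> s \<ge> 0"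
  then show ?thesis using s w' k i edge_line_prev[OF next_prev(1) w, of "s - half_side" i]
    by (simp add: half_edge_def abs_le_iff minus_diff_commute[of half_side s])
qed

lemma geodesic_local_vertex:
  assumes \<gamma>: "geodesic_line m \<gamma>" "range \<gamma> \<subseteq> edge_union m"
    and v: "v \<subseteq> {..<m}" and i: "i < m" and \<gamma>t: "\<gamma> t = cls v (side_point i half_side)"
  shows "\<exists>e>0. \<exists>\<tau>\<in>line_family. \<forall>s\<in>ball t e. \<gamma> s = \<tau> s"
proof -
  define k where "k b = (if b then next_side i else i)" for b
  obtain \<epsilon> where \<epsilon>: "\<epsilon> > 0" "\<And>s s'. s \<in> ball t \<epsilon> \<Longrightarrow> s' \<in> ball t \<epsilon> \<Longrightarrow> surface_dist m (\<gamma> s) (\<gamma> s') = \<bar>s - s'\<bar>"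
    using \<gamma>(1) unfolding geodesic_line_def by blast
  have hs: "\<bar>half_side\<bar> \<le> half_side" using half_side_pos by simp
  note sides = sides_at_corner(1)[OF i]
  obtain \<eta> where \<eta>: "\<eta> > 0" "\<forall>w y k. w \<subseteq> {..<m} \<longrightarrow> k < m \<longrightarrow> y \<in> polygon_side m k \<longrightarrow>
       surface_dist m (cls v (side_point i half_side)) (cls w y) < \<eta> \<longrightarrow>
       k \<in> {i, next_side i} \<and> sym_diff v w \<subseteq> {i, next_side i}"
    using nearby_edge_points[OF v i hs] unfolding sides by (elim exE conjE)
  define e where "e = min (min \<epsilon> \<eta>) (2 * half_side)"
  have e: "e > 0" using \<epsilon> \<eta> half_side_pos by (simp add: e_def)
  have in_ball: "s \<in> ball t \<epsilon>" "\<bar>t - s\<bar> < \<eta>" "\<bar>s - t\<bar> \<le> 2 * half_side" if "s \<in> ball t e" for s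
    using that by (auto simp: e_def dist_real_def)
  have half: "\<exists>b. \<exists>w. w \<subseteq> {..<m} \<and> sym_diff v w \<subseteq> {k b} \<and> \<gamma> s = half_edge i b w \<bar>s - t\<bar>"
    if s: "s \<in> ball t e" for s
  proof -
    obtain w y j where q: "\<gamma> s = cls w y" "w \<subseteq> {..<m}" "j < m" "y \<in> polygon_side m j"
      using \<gamma>(2) unfolding edge_union_def by blast
    have dist: "surface_dist m (\<gamma> t) (\<gamma> s) = \<bar>s - t\<bar>"
      using \<epsilon>(2)[of t s] in_ball[OF s] \<epsilon>(1) by simp
    then have j: "j = i \<or> j = next_side i" and d: "sym_diff v w \<subseteq> {i, next_side i}"
      using \<eta>(2)[rule_format, OF q(2-4)] in_ball(2)[OF s] unfolding \<gamma>t q(1) by auto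
    obtain b where b: "j = (if b then i else next_side i)" using j by (metis (full_types))
    obtain p where p: "y = side_point j p" "\<bar>p\<bar> \<le> half_side"
      using q(4) by (auto simp: polygon_side_eq abs_le_iff)
    define a where "a = (if b then half_side - p else p + half_side)"
    have a: "0 \<le> a" "a \<le> 2 * half_side" using p(2) by (auto simp: a_def abs_le_iff)
    have qa: "\<gamma> s = half_edge i b w a" using q(1) p(1) b by (auto simp: half_edge_def a_def)
    \<comment> \<open>The flip of the side \<open>j\<close> carrying the point is invisible, so it
      is reset to its value in \<open>v\<close>. Then only the crossing side \<open>k b\<close> can
      distinguish \<open>u\<close> from \<open>v\<close>.\<close>
    define u where "u = {l. if l = j then l \<in> v else l \<in> w}"
    have u: "u \<subseteq> {..<m}" "sym_diff v u \<subseteq> {k b}" "sym_diff w u \<subseteq> {j}"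
      using v q(2) d by (auto simp: u_def k_def b split: if_splits)
    have qu: "\<gamma> s = half_edge i b u a"
      unfolding qa by (rule half_edge_cong[OF i q(2) u(1) a]) (use u(3) b in auto)
    have "\<gamma> t = cls u (side_point i half_side)"
      unfolding \<gamma>t using tile_class_eq_iff[OF v u(1)] sides u(2) by (auto simp: k_def split: if_splits)
    then have "a = \<bar>s - t\<bar>"
      using half_edge_dist_vertex[OF i u(1) a, of b] dist qu by simp
    then show ?thesis using u qu by blast
  qed
  then obtain b w where bw: "\<And>s. s \<in> ball t e \<Longrightarrow> w s \<subseteq> {..<m} \<and> sym_diff v (w s) \<subseteq> {k (b s)} \<and>
      \<gamma> s = half_edge i (b s) (w s) \<bar>s - t\<bar>"
    by metis
  \<comment> \<open>For times before and after \<open>t\<close> the distances to the vertex must add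
    up. This excludes perpendicular and equal half-edges and leaves only the collinear one across
    the vertex.\<close>
  have opposite: "b s = b s' \<and> sym_diff (w s) (w s') = {k (b s)}"
    if s: "s \<in> ball t e" "s' \<in> ball t e" and tt: "s < t \<and> t < s' \<or> s' < t \<and> t < s" for s s'
  proof -
    have dist: "surface_dist m (half_edge i (b s) (w s) \<bar>s - t\<bar>) (half_edge i (b s') (w s') \<bar>s' - t\<bar>) = \<bar>s - t\<bar> + \<bar>s' - t\<bar>"
      using \<epsilon>(2)[OF in_ball(1)[OF s(1)] in_ball(1)[OF s(2)]] bw[OF s(1)] bw[OF s(2)] tt by (auto simp: abs_if)
    have pos: "0 < \<bar>s - t\<bar>" "\<bar>s - t\<bar> \<le> 2 * half_side" "0 < \<bar>s' - t\<bar>" "\<bar>s' - t\<bar> \<le> 2 * half_side"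
      using tt in_ball(3)[OF s(1)] in_ball(3)[OF s(2)] by auto
    have sub: "sym_diff (w s) (w s') \<subseteq> {k (b s), k (b s')}" "w s \<subseteq> {..<m}" "w s' \<subseteq> {..<m}"
      using bw[OF s(1)] bw[OF s(2)] by blast+
    have bb: "b s = b s'"
    proof (rule ccontr)
      assume "b s \<noteq> b s'"
      then have "sym_diff (w s) (w s') \<subseteq> {i, next_side i}"
        using sub(1) by (auto simp: k_def split: if_splits)
      from half_edge_dist_corner[OF i sub(2,3) this pos] show False
        using dist \<open>b s \<noteq> b s'\<close> by (cases "b s"; cases "b s'") auto
    qed
    moreover have "w s \<noteq> w s'"
      using half_edge_dist_same[OF i sub(2) pos, of "b s"] dist bb by auto
    moreover have "sym_diff (w s) (w s') \<subseteq> {k (b s)}" using sub(1) bb by simp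
    ultimately show ?thesis by blast
  qed
  \<comment> \<open>One reference time on each side of \<open>t\<close>: comparing all earlier times
    with \<open>s1\<close> and all later ones with \<open>s2\<close> makes the half-edge constant on
    both sides.\<close>
  define s1 where "s1 = t + e / 2"
  define s2 where "s2 = t - e / 2"
  have s12: "s1 \<in> ball t e" "s2 \<in> ball t e" "t < s1" "s2 < t"
    using e by (auto simp: s1_def s2_def dist_real_def)
  define B where "B = b s1"
  define W where "W = w s1"
  have W: "W \<subseteq> {..<m}" "sym_diff v W \<subseteq> {k B}" using bw[OF s12(1)] by (auto simp: W_def B_def)
  have left: "b s = B \<and> w s = sym_diff W {k B}" if s: "s \<in> ball t e" "s < t" for s
  proof -
    have o: "b s = b s1" "sym_diff (w s) (w s1) = {k (b s)}"
      using opposite[OF s(1) s12(1)] s(2) s12(3) by auto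
    show ?thesis using o(1) sym_diff_swap[OF o(2)] by (simp add: B_def W_def)
  qed
  have right: "b s = B \<and> w s = W" if s: "s \<in> ball t e" "t < s" for s
  proof -
    have o: "b s = b s2" "sym_diff (w s) (w s2) = {k (b s)}"
      using opposite[OF s(1) s12(2)] s(2) s12(4) by auto
    have "w s = sym_diff (sym_diff W {k B}) {k B}"
      using sym_diff_swap[OF o(2)] left[OF s12(2,4)] o(1) by simp
    then show ?thesis using o(1) left[OF s12(2,4)] by auto
  qed
  have line: "\<gamma> s = edge_line W (if B then i else next_side i)
      ((if B then -1 else 1) * (s - t) + (if B then half_side else - half_side))" if s: "s \<in> ball t e" for s
  proof -
    have "\<gamma> s = half_edge i B (if s - t \<ge> 0 then W else sym_diff W {k B}) \<bar>s - t\<bar>"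
    proof (cases "s = t")
      case True
      have "cls v (side_point i half_side) = cls W (side_point i half_side)"
        using tile_class_eq_iff[OF v W(1)] sides W(2) by (auto simp: k_def split: if_splits)
      then show ?thesis using True \<gamma>t by (simp add: half_edge_def sides_at_corner(2)[OF i])
    next
      case False
      then show ?thesis using bw[OF s] left[OF s] right[OF s] by (cases "s < t") auto
    qed
    also have "\<dots> = edge_line W (if B then i else next_side i)
      ((if B then -1 else 1) * (s - t) + (if B then half_side else - half_side))"
      by (rule half_edge_line[OF i W(1) in_ball(3)[OF s]]) (auto simp: k_def)
    finally show ?thesis .
  qed
  have family: "(\<lambda>s. edge_line W (if B then i else next_side i)
      ((if B then -1 else 1) * (s - t) + (if B then half_side else - half_side))) \<in> line_family"
    by (rule line_familyI[OF W(1)]) (use i in auto)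
  show ?thesis
    by (rule exI[of _ e], rule conjI[OF e], rule bexI[OF _ family], rule ballI, erule line)
qed

lemma geodesic_local:
  assumes \<gamma>: "geodesic_line m \<gamma>" "range \<gamma> \<subseteq> edge_union m"
  shows "\<exists>e>0. \<exists>\<tau>\<in>line_family. \<forall>s\<in>ball t e. \<gamma> s = \<tau> s"
proof -
  obtain v x i where q: "\<gamma> t = cls v x" "v \<subseteq> {..<m}" "i < m" "x \<in> polygon_side m i"
    using \<gamma>(2) unfolding edge_union_def by blast
  then obtain r where r: "x = side_point i r" "\<bar>r\<bar> \<le> half_side"
    by (auto simp: polygon_side_eq abs_le_iff)
  consider "\<bar>r\<bar> < half_side" | "r = half_side" | "r = - half_side" using r(2) by linarith
  then show ?thesis
  proof cases
    case 1 then show ?thesis using geodesic_local_side[OF \<gamma> q(2,3)] q(1) r(1) by blast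
  next
    case 2 then show ?thesis using geodesic_local_vertex[OF \<gamma> q(2,3)] q(1) r(1) by blast
  next
    case 3
    then have "x = side_point (prev_side i) half_side"
      using sides_at_corner(2)[OF next_prev(2), of i] q(3) r(1) by simp
    then show ?thesis using geodesic_local_vertex[OF \<gamma> q(2) next_prev(2)] q(1) by blast
  qed
qed

section \<open>From the local form of a geodesic to the global one\<close>

lemma edge_line_cong:
  assumes "v \<subseteq> {..<m}" "w \<subseteq> {..<m}" "i < m" "sym_diff v w \<subseteq> {i}"
  shows "edge_line v i = edge_line w i"
proof
  fix t
  obtain n :: int where n: "\<bar>t - 2 * half_side * n\<bar> \<le> half_side" using line_index by blast
  then have p: "\<bar>line_sgn n * (t - 2 * half_side * n)\<bar> \<le> half_side"
    using line_sgn_cases[of n] by auto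
  have "sym_diff (line_tile n v i) (line_tile n w i) \<subseteq> {i}" using assms(4) unfolding line_tile_def by blast
  then show "edge_line v i t = edge_line w i t"
    unfolding edge_line_eq[OF assms(3,1) n] edge_line_eq[OF assms(3,2) n]
    using tile_class_eq_iff[OF line_tile_subset[OF assms(1)] line_tile_subset[OF assms(2)]]
      sides_at_side_point[OF assms(3) p] by blast
qed

text \<open>Re-bases a line at the edge it traverses at time \<open>a\<close>, so that
  \<open>r\<close> is its position on that side.\<close>

lemma line_family_normal_form:
  assumes "\<tau> \<in> line_family"
  obtains v i \<sigma> r where "v \<subseteq> {..<m}" "i < m" "\<sigma> \<in> {1, -1}" "\<bar>r\<bar> \<le> half_side"
    "\<And>s. \<tau> s = edge_line v i (\<sigma> * (s - a) + r)"
proof -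
  obtain v i \<sigma> c where \<tau>: "\<tau> = (\<lambda>s. edge_line v i (\<sigma> * s + c))" "v \<subseteq> {..<m}" "i < m" "\<sigma> \<in> {1, -1}"
    using assms unfolding line_family_def by blast
  obtain n :: int where n: "\<bar>\<sigma> * a + c - 2 * half_side * n\<bar> \<le> half_side" using line_index by blast
  let ?g = "real_of_int (line_sgn n)"
  show ?thesis
  proof (rule that[of "line_tile n v i" i "?g * \<sigma>" "?g * (\<sigma> * a + c - 2 * half_side * n)"])
    show "line_tile n v i \<subseteq> {..<m}" by (rule line_tile_subset[OF \<tau>(2)])
    show "?g * \<sigma> \<in> {1, -1}" using \<tau>(4) line_sgn_cases[of n] by auto
    show "\<bar>?g * (\<sigma> * a + c - 2 * half_side * n)\<bar> \<le> half_side"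
      using n line_sgn_cases[of n] by auto
    show "\<tau> s = edge_line (line_tile n v i) i (?g * \<sigma> * (s - a) + ?g * (\<sigma> * a + c - 2 * half_side * n))" for s
    proof -
      have "\<sigma> * s + c = 2 * half_side * n + (\<sigma> * s + c - 2 * half_side * n)" by simp
      then have "\<tau> s = edge_line (line_tile n v i) i (?g * (\<sigma> * s + c - 2 * half_side * n))"
        unfolding \<tau>(1) using edge_line_shift[OF \<tau>(3,2)] by metis
      also have "?g * (\<sigma> * s + c - 2 * half_side * n) = ?g * \<sigma> * (s - a) + ?g * (\<sigma> * a + c - 2 * half_side * n)"
        by (simp add: algebra_simps)
      finally show ?thesis .
    qed
  qed (rule \<tau>(3))
qed

text \<open>Its use is to find, in any open interval, a time at which the line is not at a vertex,
  so that its position determines the side.\<close>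

lemma line_family_break_countable:
  assumes "\<tau> \<in> line_family"
  shows "countable {a. \<exists>v i. v \<subseteq> {..<m} \<and> i < m \<and> \<tau> a = cls v (side_point i half_side)}"
proof -
  obtain v i \<sigma> c where \<tau>: "\<tau> = (\<lambda>s. edge_line v i (\<sigma> * s + c))" "v \<subseteq> {..<m}" "i < m" "\<sigma> \<in> {1, -1}"
    using assms unfolding line_family_def by blast
  have "{a. \<exists>v i. v \<subseteq> {..<m} \<and> i < m \<and> \<tau> a = cls v (side_point i half_side)} \<subseteq>
     (\<Union>n::int. {\<sigma> * (2 * half_side * n + half_side - c), \<sigma> * (2 * half_side * n - half_side - c)})"
  proof
    fix a assume "a \<in> {a. \<exists>v i. v \<subseteq> {..<m} \<and> i < m \<and> \<tau> a = cls v (side_point i half_side)}"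
    then obtain w j where w: "w \<subseteq> {..<m}" "j < m" "\<tau> a = cls w (side_point j half_side)" by blast
    obtain n :: int where n: "\<bar>\<sigma> * a + c - 2 * half_side * n\<bar> \<le> half_side" using line_index by blast
    define p where "p = line_sgn n * (\<sigma> * a + c - 2 * half_side * n)"
    have p: "\<bar>p\<bar> \<le> half_side" using n line_sgn_cases[of n] by (auto simp: p_def)
    have "cls (line_tile n v i) (side_point i p) = cls w (side_point j half_side)"
      using w(3) unfolding \<tau>(1) edge_line_eq[OF \<tau>(3,2) n] p_def .
    then have "side_point i p = side_point j half_side"
      using tile_class_eq_iff[OF line_tile_subset[OF \<tau>(2)] w(1)] by blast
    then have "sides_at (side_point i p) = {j, next_side j}" using sides_at_corner(1)[OF w(2)] by simp
    then have "\<bar>p\<bar> = half_side"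
      using sides_at_side_point[OF \<tau>(3) p] next_neq(1)[OF w(2)] half_side_pos by (auto split: if_splits)
    then have "\<sigma> * a + c - 2 * half_side * n = half_side \<or> \<sigma> * a + c - 2 * half_side * n = - half_side"
      using line_sgn_cases[of n] by (auto simp: p_def)
    then have "a = \<sigma> * (2 * half_side * n + half_side - c) \<or> a = \<sigma> * (2 * half_side * n - half_side - c)"
      using \<tau>(4) by auto
    then show "a \<in> (\<Union>n::int. {\<sigma> * (2 * half_side * n + half_side - c), \<sigma> * (2 * half_side * n - half_side - c)})"
      by blast
  qed
  then show ?thesis by (rule countable_subset) auto
qed

text \<open>At a time away from the vertices the point determines the side, its position and the
  tile up to a flip of that very side, which does not change the line. A second point on the same
  edge then determines the direction.\<close>

lemma line_family_unique:
  assumes \<tau>: "\<tau> \<in> line_family" "\<tau>' \<in> line_family" and e: "e > 0"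
    and agree: "\<And>s. s \<in> ball t e \<Longrightarrow> \<tau> s = \<tau>' s"
  shows "\<tau> = \<tau>'"
proof -
  let ?S = "{a. \<exists>v i. v \<subseteq> {..<m} \<and> i < m \<and> \<tau> a = cls v (side_point i half_side)}"
  have unc: "uncountable {t - e<..<t + e}" using e by (simp add: uncountable_open_interval)
  have "\<not> {t - e<..<t + e} \<subseteq> ?S"
    using countable_subset[OF _ line_family_break_countable[OF \<tau>(1)]] unc by auto
  then obtain a where a: "a \<in> {t - e<..<t + e}" "a \<notin> ?S" by blast
  have aball: "a \<in> ball t e" using a(1) by (auto simp: dist_real_def)
  obtain v i \<sigma> r where 1: "v \<subseteq> {..<m}" "i < m" "\<sigma> \<in> {1, -1}" "\<bar>r\<bar> \<le> half_side"
    "\<And>s. \<tau> s = edge_line v i (\<sigma> * (s - a) + r)" using line_family_normal_form[OF \<tau>(1), of a] by blast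
  obtain v' i' \<sigma>' r' where 2: "v' \<subseteq> {..<m}" "i' < m" "\<sigma>' \<in> {1, -1}" "\<bar>r'\<bar> \<le> half_side"
    "\<And>s. \<tau>' s = edge_line v' i' (\<sigma>' * (s - a) + r')" using line_family_normal_form[OF \<tau>(2), of a] by blast
  have \<tau>a: "\<tau> a = cls v (side_point i r)" "\<tau>' a = cls v' (side_point i' r')"
    using 1(5)[of a] 2(5)[of a] edge_line_base[OF 1(2,1,4)] edge_line_base[OF 2(2,1,4)] by auto
  have not_end: "\<bar>p\<bar> < half_side" if p: "\<tau> a = cls w (side_point j p)" "w \<subseteq> {..<m}" "j < m" "\<bar>p\<bar> \<le> half_side" for w j p
  proof -
    have "p \<noteq> half_side" using a(2) p(1-3) by blast
    moreover have "p \<noteq> - half_side"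
    proof
      assume "p = - half_side"
      then have "side_point j p = side_point (prev_side j) half_side"
        using sides_at_corner(2)[OF next_prev(2), of j] p(3) by simp
      then have "\<tau> a = cls w (side_point (prev_side j) half_side)" using p(1) by simp
      then have "a \<in> ?S" using p(2) next_prev(2)[of j] by blast
      then show False using a(2) by blast
    qed
    ultimately show ?thesis using p(4) by linarith
  qed
  have r: "\<bar>r\<bar> < half_side" by (rule not_end[OF \<tau>a(1) 1(1,2,4)])
  have r': "\<bar>r'\<bar> < half_side"
    using not_end[of v' i' r'] \<tau>a(2) agree[OF aball] 2 by simp
  have eq: "side_point i r = side_point i' r'" "sym_diff v v' \<subseteq> sides_at (side_point i r)"
    using tile_class_eq_iff[OF 1(1) 2(1)] agree[OF aball] \<tau>a by metis+
  have s1: "sides_at (side_point i r) = {i}" using sides_at_side_point[OF 1(2,4)] r by auto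
  moreover have "sides_at (side_point i' r') = {i'}" using sides_at_side_point[OF 2(2,4)] r' by auto
  ultimately have ii: "i' = i" using eq(1) by simp
  then have rr: "r' = r" using eq(1) side_point_inj by simp
  have lines: "edge_line v' i = edge_line v i"
    by (rule edge_line_cong[OF 2(1) 1(1,2)]) (use eq(2) s1 in blast)
  \<comment> \<open>Small enough that time \<open>a + d\<close> is still in the ball and the
    position, moving in either direction, is still on the same side.\<close>
  define d where "d = min ((t + e - a) / 2) ((half_side - \<bar>r\<bar>) / 2)"
  have d: "0 < d" "a + d \<in> ball t e" "\<bar>r\<bar> + d \<le> half_side"
  proof -
    have *: "d \<le> (t + e - a) / 2" "d \<le> (half_side - \<bar>r\<bar>) / 2"
      unfolding d_def by (rule min.cobounded1, rule min.cobounded2)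
    show d0: "0 < d" using a(1) r by (simp add: d_def)
    have "a + d < t + e" "t - e < a + d" using * d0 a(1) by (auto simp: field_simps)
    then show "a + d \<in> ball t e" by (auto simp: dist_real_def abs_less_iff)
    show "\<bar>r\<bar> + d \<le> half_side" using *(2) r by (simp add: field_simps)
  qed
  have "edge_line v i (\<sigma> * d + r) = edge_line v i (\<sigma>' * d + r)"
    using agree[OF d(2)] 1(5)[of "a + d"] 2(5)[of "a + d"] ii rr lines by simp
  moreover have "\<bar>\<sigma> * d + r\<bar> \<le> half_side" "\<bar>\<sigma>' * d + r\<bar> \<le> half_side"
    using d 1(3) 2(3) by auto
  ultimately have "cls v (side_point i (\<sigma> * d + r)) = cls v (side_point i (\<sigma>' * d + r))"
    using edge_line_base[OF 1(2,1)] by simp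
  then have "side_point i (\<sigma> * d + r) = side_point i (\<sigma>' * d + r)"
    using tile_class_eq_iff[OF 1(1) 1(1)] by blast
  then have "\<sigma>' = \<sigma>" using d(1) by (simp add: side_point_inj)
  then show ?thesis using 1(5) 2(5) ii rr lines by (simp add: fun_eq_iff)
qed

text \<open>The line that agrees with the curve near \<open>t\<close> is a locally constant function
  of \<open>t\<close>, by uniqueness on overlaps, and the real line is connected.\<close>

lemma geodesic_in_edges:
  assumes \<gamma>: "geodesic_line m \<gamma>" "range \<gamma> \<subseteq> edge_union m"
  shows "\<gamma> \<in> line_family"
proof -
  obtain \<tau> where \<tau>: "\<And>t. \<exists>e>0. \<tau> t \<in> line_family \<and> (\<forall>s\<in>ball t e. \<gamma> s = \<tau> t s)"
    using geodesic_local[OF \<gamma>] by metis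
  have "\<tau> a = \<tau> b" for a b
  proof (rule connected_local_const[of UNIV])
    show "\<forall>a\<in>UNIV. \<forall>\<^sub>F b in at a within UNIV. \<tau> a = \<tau> b"
    proof
      fix a
      obtain e where e: "e > 0" "\<tau> a \<in> line_family" "\<forall>s\<in>ball a e. \<gamma> s = \<tau> a s" using \<tau> by blast
      have "\<tau> a = \<tau> b" if b: "b \<in> ball a e" for b
      proof -
        obtain e' where e': "e' > 0" "\<tau> b \<in> line_family" "\<forall>s\<in>ball b e'. \<gamma> s = \<tau> b s" using \<tau> by blast
        have "e - dist a b > 0" using b by simp
        moreover have "ball b (min e' (e - dist a b)) \<subseteq> ball a e \<inter> ball b e'"
        proof
          fix x assume "x \<in> ball b (min e' (e - dist a b))"
          then show "x \<in> ball a e \<inter> ball b e'" using dist_triangle[of a x b] by auto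
        qed
        ultimately show ?thesis
          using line_family_unique[OF e(2) e'(2), of "min e' (e - dist a b)" b] e(3) e'(1,3)
          by (metis IntD1 IntD2 min_less_iff_conj subsetD)
      qed
      then show "\<forall>\<^sub>F b in at a within UNIV. \<tau> a = \<tau> b"
        unfolding eventually_at using e(1) by (auto simp: dist_commute intro!: exI[of _ e])
    qed
  qed auto
  then have "\<gamma> s = \<tau> 0 s" for s using \<tau>[of s] by (metis centre_in_ball)
  then have "\<gamma> = \<tau> 0" by auto
  then show ?thesis using \<tau>[of 0] by auto
qed

lemma line_family_period:
  assumes "\<tau> \<in> line_family"
  shows "\<tau> (t + 8 * half_side) = \<tau> t" "0 < T \<Longrightarrow> T < 8 * half_side \<Longrightarrow> \<exists>t. \<tau> (t + T) \<noteq> \<tau> t"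
proof -
  obtain v i \<sigma> c where \<tau>: "\<tau> = (\<lambda>s. edge_line v i (\<sigma> * s + c))" "v \<subseteq> {..<m}" "i < m" "\<sigma> \<in> {1, -1}"
    using assms unfolding line_family_def by blast
  note per = edge_line_periodic[OF \<tau>(3,2)]
  show "\<tau> (t + 8 * half_side) = \<tau> t"
    using \<tau>(4) per[of "t + c"] per[of "- t + c - 8 * half_side"] by (auto simp: \<tau>(1) algebra_simps)
  assume T: "0 < T" "T < 8 * half_side"
  have "\<tau> (- \<sigma> * c + T) \<noteq> \<tau> (- \<sigma> * c)"
    using \<tau>(4) edge_line_no_shorter_period[OF \<tau>(3,2) T] per[of "- T"] T
      edge_line_no_shorter_period[OF \<tau>(3,2), of "8 * half_side - T"]
    by (auto simp: \<tau>(1) algebra_simps)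
  then show "\<exists>t. \<tau> (t + T) \<noteq> \<tau> t" by blast
qed

lemma closed_geodesic_in_edges:
  assumes "closed_geodesic m \<gamma> L" "range \<gamma> \<subseteq> edge_union m"
  shows "\<gamma> \<in> line_family" "L = 8 * half_side"
proof -
  show \<gamma>: "\<gamma> \<in> line_family"
    by (rule geodesic_in_edges[OF _ assms(2)]) (use assms(1) in \<open>simp add: closed_geodesic_def\<close>)
  have L: "0 < L" "\<And>t. \<gamma> (t + L) = \<gamma> t" "\<And>T. 0 < T \<Longrightarrow> T < L \<Longrightarrow> \<exists>t. \<gamma> (t + T) \<noteq> \<gamma> t"
    using assms(1) by (auto simp: closed_geodesic_def)
  have "\<not> 8 * half_side < L" using L(3)[of "8 * half_side"] line_family_period(1)[OF \<gamma>] half_side_pos by auto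
  moreover have "\<not> L < 8 * half_side" using line_family_period(2)[OF \<gamma> L(1)] L(2) by auto
  ultimately show "L = 8 * half_side" by simp
qed

text \<open>The midpoint of a side lies on no other side, so it determines the line through it up to
  direction. This recovers an arbitrarily chosen parametrization from its trace.\<close>

lemma line_family_through_center:
  assumes \<tau>: "\<tau> \<in> line_family" and v: "v \<subseteq> {..<m}" and i: "i < m" and a: "\<tau> a = cls v (side_point i 0)"
  shows "\<exists>\<sigma>\<in>{1, -1}. \<forall>s. \<tau> s = edge_line v i (\<sigma> * (s - a))"
proof -
  obtain v' i' \<sigma> r where 2: "v' \<subseteq> {..<m}" "i' < m" "\<sigma> \<in> {1, -1}" "\<bar>r\<bar> \<le> half_side"
    "\<And>s. \<tau> s = edge_line v' i' (\<sigma> * (s - a) + r)" using line_family_normal_form[OF \<tau>, of a] by blast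
  have "cls v' (side_point i' r) = cls v (side_point i 0)"
    using 2(5)[of a] edge_line_base[OF 2(2,1,4)] a by simp
  then have eq: "side_point i' r = side_point i 0" "sym_diff v' v \<subseteq> sides_at (side_point i' r)"
    using tile_class_eq_iff[OF 2(1) v] by auto
  have "sides_at (side_point i 0) = {i}" using sides_at_side_point[OF i, of 0] half_side_pos by auto
  moreover have "i' \<in> sides_at (side_point i' r)" using sides_at_side_point[OF 2(2,4)] by simp
  ultimately have ii: "i' = i" and "sym_diff v' v \<subseteq> {i}" using eq by auto
  then have "edge_line v' i = edge_line v i" "r = 0"
    using edge_line_cong[OF 2(1) v i] eq(1) side_point_inj by auto
  then show ?thesis using 2(3,5) ii by auto
qed

section \<open>Edge cycles in the homology of the surface\<close>


lemma continuous_tile: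
  assumes "v \<subseteq> {..<m}"
  shows "continuous_map (top_of_set (polygon m)) (surface m) (cls v)"
proof -
  have 1: "continuous_map (tiles_space m) (surface m) (tile_class m)"
    unfolding continuous_map_def surface_def
  proof (intro conjI allI impI)
    show "tile_class m \<in> topspace (tiles_space m) \<rightarrow> topspace (quotient_topology (tiles_space m) (tile_class m))"
      using topspace_surface by (auto simp: surface_def topspace_tiles_space)
  qed (simp add: openin_quotient_topology)
  have 2: "continuous_map (top_of_set (polygon m)) (tiles_space m) (\<lambda>x. (v, x))"
    unfolding tiles_space_def using assms by (auto simp: continuous_map_pairwise o_def)
  show ?thesis using continuous_map_compose[OF 2 1] by (simp add: o_def)
qed

lemma continuous_from_surface:
  assumes "\<And>v. v \<subseteq> {..<m} \<Longrightarrow> continuous_map (top_of_set (polygon m)) Y (\<lambda>x. f (cls v x))"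
  shows "continuous_map (surface m) Y f"
  unfolding continuous_map_def
proof (intro conjI allI impI)
  show "f \<in> topspace (surface m) \<rightarrow> topspace Y"
    using assms unfolding topspace_surface continuous_map_def by auto
  fix U assume U: "openin Y U"
  have eq: "{p \<in> topspace (tiles_space m). tile_class m p \<in> {c \<in> topspace (surface m). f c \<in> U}} =
      (\<Union>v\<in>tiles. {v} \<times> {x \<in> polygon m. f (cls v x) \<in> U})"
    unfolding topspace_surface topspace_tiles_space by auto
  have "openin (tiles_space m) ({v} \<times> {x \<in> polygon m. f (cls v x) \<in> U})" if "v \<in> tiles" for v
    using assms[of v] that U unfolding continuous_map_def
    by (auto simp: tiles_space_def openin_prod_Times_iff)
  then have "openin (tiles_space m) {p \<in> topspace (tiles_space m). tile_class m p \<in> {c \<in> topspace (surface m). f c \<in> U}}"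
    unfolding eq by auto
  moreover have "{c \<in> topspace (surface m). f c \<in> U} \<subseteq> tile_class m ` topspace (tiles_space m)"
    unfolding topspace_surface topspace_tiles_space by auto
  ultimately show "openin (surface m) {c \<in> topspace (surface m). f c \<in> U}"
    unfolding surface_def openin_quotient_topology by simp
qed

lemma continuous_side_point: "continuous_on S (side_point i)"
  unfolding side_point_def by (intro continuous_intros) auto

text \<open>On each edge the line is a path in the polygon followed by a tile map. The edges form a
  locally finite closed cover of the line of times, so these pieces can be pasted.\<close>

lemma continuous_edge_line:
  assumes iv: "i < m" "v \<subseteq> {..<m}"
  shows "continuous_map (top_of_set UNIV) (surface m) (edge_line v i)"
proof (rule pasting_lemma_locally_finite[where I = "UNIV :: int set"
      and T = "\<lambda>n. {2 * half_side * n - half_side..2 * half_side * n + half_side}" and f = "\<lambda>_. edge_line v i"])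
  fix x :: real
  define q where "q = x / (2 * half_side)"
  let ?V = "{x - half_side<..<x + half_side}"
  have near: "\<lfloor>q\<rfloor> - 1 \<le> n \<and> n \<le> \<lfloor>q\<rfloor> + 2"
    if n: "{2 * half_side * of_int n - half_side..2 * half_side * of_int n + half_side} \<inter> ?V \<noteq> {}" for n :: int
  proof -
    obtain y where y: "2 * half_side * n - half_side \<le> y" "y \<le> 2 * half_side * n + half_side"
      "x - half_side < y" "y < x + half_side"
      using n by auto
    have "2 * half_side * (n - 1) < x" "x < 2 * half_side * (n + 1)"
      using y by (auto simp: algebra_simps)
    then have "real_of_int n - 1 < q" "q < real_of_int n + 1"
      using half_side_pos by (auto simp: q_def field_simps)
    then show ?thesis by linarith
  qed
  have "{n \<in> UNIV. {2 * half_side * of_int n - half_side..2 * half_side * of_int n + half_side} \<inter> ?V \<noteq> {}}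
      \<subseteq> {\<lfloor>q\<rfloor> - 1..\<lfloor>q\<rfloor> + 2}"
  proof (rule subsetI, elim CollectE conjE)
    fix n :: int
    assume "{2 * half_side * of_int n - half_side..2 * half_side * of_int n + half_side} \<inter> ?V \<noteq> {}"
    from near[OF this] show "n \<in> {\<lfloor>q\<rfloor> - 1..\<lfloor>q\<rfloor> + 2}" by simp
  qed
  then have "finite {n \<in> UNIV. {2 * half_side * of_int n - half_side..2 * half_side * of_int n + half_side} \<inter> ?V \<noteq> {}}"
    by (rule finite_subset) simp
  then show "\<exists>V. openin (top_of_set UNIV) V \<and> x \<in> V \<and>
      finite {n \<in> UNIV. {2 * half_side * real_of_int n - half_side..2 * half_side * real_of_int n + half_side} \<inter> V \<noteq> {}}"
    using half_side_pos by (intro exI[of _ ?V]) auto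
next
  fix n :: int
  let ?T = "{2 * half_side * n - half_side..2 * half_side * n + half_side}"
  let ?e = "\<lambda>t. side_point i (line_sgn n * (t - 2 * half_side * n))"
  have "continuous_on ?T ?e"
    by (rule continuous_on_compose2[OF continuous_side_point[of UNIV]]) (auto intro!: continuous_intros)
  moreover have "?e t \<in> polygon m" if "t \<in> ?T" for t
    using that line_sgn_cases[of n] by (intro side_point_in_polygon) (auto simp: abs_le_iff)
  ultimately have "continuous_map (top_of_set ?T) (top_of_set (polygon m)) ?e"
    by (auto simp: continuous_map_in_subtopology)
  from continuous_map_compose[OF this continuous_tile[OF line_tile_subset[OF iv(2)], of n i]]
  have "continuous_map (top_of_set ?T) (surface m) (edge_line v i)"
    by (rule continuous_map_eq) (auto simp: edge_line_eq[OF iv, of _ n] abs_le_iff)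
  then show "continuous_map (subtopology (top_of_set UNIV) ?T) (surface m) (edge_line v i)"
    by (simp add: subtopology_subtopology)
next
  fix x :: real
  obtain n :: int where "\<bar>x - 2 * half_side * n\<bar> \<le> half_side" using line_index by blast
  then show "\<exists>j. j \<in> UNIV \<and> x \<in> {2 * half_side * real_of_int j - half_side..2 * half_side * real_of_int j + half_side} \<and>
      edge_line v i x = edge_line v i x"
    by (intro exI[of _ n]) (auto simp: abs_le_iff)
qed auto

section \<open>Singular chains of edges and of full geodesics\<close>

definition edge_chain :: "nat set \<Rightarrow> nat \<Rightarrow> surface_point rat_chain" where
  "edge_chain v i = path_chain (cls v) (vertex m i) (vertex m (Suc i))"

text \<open>The four edges of the straight line through side \<open>i\<close> of \<open>v\<close>,
  in the order of \<open>line_tile\<close> and with the signs \<open>line_sgn\<close>, all oriented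
  by the side of the polygon.\<close>

definition circle_chain :: "nat set \<Rightarrow> nat \<Rightarrow> surface_point rat_chain" where
  "circle_chain v i = edge_chain v i - edge_chain (sym_diff v {next_side i}) i +
     edge_chain (sym_diff v {next_side i, prev_side i}) i - edge_chain (sym_diff v {prev_side i}) i"

text \<open>The two tile maps coincide on side \<open>i\<close>, so the chains are equal and not
  merely homologous. The vanishing of half of the isotypic parts depends on it.\<close>

lemma edge_chain_cong:
  assumes "i < m" "v \<subseteq> {..<m}" "w \<subseteq> {..<m}" "sym_diff v w \<subseteq> {i}"
  shows "edge_chain v i = edge_chain w i"
proof -
  have "cls v (x 0 *\<^sub>R vertex m i + x 1 *\<^sub>R vertex m (Suc i)) = cls w (x 0 *\<^sub>R vertex m i + x 1 *\<^sub>R vertex m (Suc i))"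
    if x: "x \<in> standard_simplex 1" for x
  proof -
    have x': "x 0 = 1 - x 1" "0 \<le> x 1" "x 1 \<le> 1" using x unfolding standard_simplex_1_iff by auto
    have "x 0 *\<^sub>R vertex m i + x 1 *\<^sub>R vertex m (Suc i) \<in> polygon_side m i"
      unfolding polygon_side_def closed_segment_def x'(1) using x'(2,3) by auto
    then have "i \<in> sides_at (x 0 *\<^sub>R vertex m i + x 1 *\<^sub>R vertex m (Suc i))"
      using assms(1) by (simp add: sides_at_def)
    then have "sym_diff v w \<subseteq> sides_at (x 0 *\<^sub>R vertex m i + x 1 *\<^sub>R vertex m (Suc i))"
      using assms(4) by blast
    then show ?thesis by (simp only: tile_class_eq_iff[OF assms(2,3)])
  qed
  then show ?thesis
    unfolding edge_chain_def path_chain_def segment_simplex_def by (simp cong: restrict_cong)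
qed

lemma homologous_polygon_boundary:
  assumes "v \<subseteq> {..<m}"
  shows "homologous (surface m) (\<Sum>i<m. edge_chain v i) 0"
proof -
  have "homologous (surface m) (\<Sum>i<m. edge_chain v i) (path_chain (cls v) (vertex m 0) (vertex m m))"
    unfolding edge_chain_def
    by (rule homologous_segment_polygon[OF convex_polygon continuous_tile[OF assms]]) (rule vertex_in_polygon)
  moreover have "vertex m m = vertex m 0" using vertex_add_m[of 0] by simp
  ultimately show ?thesis
    using homologous_trans homologous_segment_refl[OF convex_polygon continuous_tile[OF assms] vertex_in_polygon[of 0]]
    by metis
qed

text \<open>The line has unit hyperbolic speed while the edge chain is affine in the Klein disc.
  \<open>\<phi>\<close> is the change of parameter between the two, read off from
  \<open>side_point_convex\<close>.\<close>

lemma homologous_base_edge: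
  assumes iv: "i < m" "v \<subseteq> {..<m}"
  shows "homologous (surface m) (path_chain (edge_line v i) (- half_side) half_side) (edge_chain v i)"
proof -
  define \<phi> where "\<phi> t = (tanh (half_side * (2 * t - 1)) + tanh half_side) / (2 * tanh half_side)" for t
  have th: "tanh half_side > 0" using half_side_pos by simp
  have bnd: "\<bar>half_side * (2 * t - 1)\<bar> \<le> half_side" if "0 \<le> t" "t \<le> 1" for t
  proof -
    have "\<bar>2 * t - 1\<bar> \<le> 1" using that by (auto simp: abs_le_iff)
    then show ?thesis using half_side_pos by (simp add: abs_mult mult_left_le)
  qed
  have hom: "homologous (surface m)
      (Poly_Mapping.single (restrict (\<lambda>x. cls v ((1 - \<phi> (x 1)) *\<^sub>R vertex m i + \<phi> (x 1) *\<^sub>R vertex m (Suc i)))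
           (standard_simplex 1)) 1) (path_chain (cls v) (vertex m i) (vertex m (Suc i)))"
  proof (rule homologous_segment_reparametrize[OF convex_polygon continuous_tile[OF iv(2)]])
    show "continuous_on {0..1} \<phi>" unfolding \<phi>_def using th by (intro continuous_intros) auto
    show "\<phi> ` {0..1} \<subseteq> {0..1}"
    proof
      fix y assume "y \<in> \<phi> ` {0..1}"
      then obtain t where "0 \<le> t" "t \<le> 1" "y = \<phi> t" by auto
      then show "y \<in> {0..1}" using side_fraction_bounds[OF bnd] by (simp add: \<phi>_def)
    qed
    show "\<phi> 0 = 0" "\<phi> 1 = 1" using th by (simp_all add: \<phi>_def)
  qed (auto simp: vertex_in_polygon)
  have "restrict (\<lambda>x. cls v ((1 - \<phi> (x 1)) *\<^sub>R vertex m i + \<phi> (x 1) *\<^sub>R vertex m (Suc i))) (standard_simplex 1) =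
      segment_simplex (edge_line v i) (- half_side) half_side"
    unfolding segment_simplex_def
  proof (rule restrict_ext)
    fix x assume "x \<in> standard_simplex 1"
    then have x: "x 0 = 1 - x 1" "0 \<le> x 1" "x 1 \<le> 1" unfolding standard_simplex_1_iff by auto
    have p: "x 0 *\<^sub>R - half_side + x 1 *\<^sub>R half_side = half_side * (2 * x 1 - 1)"
      unfolding x(1) by (simp add: algebra_simps)
    show "cls v ((1 - \<phi> (x 1)) *\<^sub>R vertex m i + \<phi> (x 1) *\<^sub>R vertex m (Suc i)) =
        edge_line v i (x 0 *\<^sub>R - half_side + x 1 *\<^sub>R half_side)"
      unfolding p edge_line_base[OF iv bnd[OF x(2,3)]] side_point_convex \<phi>_def ..
  qed
  then show ?thesis using hom unfolding path_chain_def edge_chain_def by simp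
qed

lemma path_chain_shift:
  assumes iv: "i < m" "v \<subseteq> {..<m}"
  shows "path_chain (edge_line v i) (2 * half_side * of_int n + a) (2 * half_side * of_int n + b) =
    path_chain (edge_line (line_tile n v i) i) (of_int (line_sgn n) * a) (of_int (line_sgn n) * b)"
proof -
  have "edge_line v i (x 0 *\<^sub>R (2 * half_side * of_int n + a) + x 1 *\<^sub>R (2 * half_side * of_int n + b)) =
     edge_line (line_tile n v i) i (x 0 *\<^sub>R (of_int (line_sgn n) * a) + x 1 *\<^sub>R (of_int (line_sgn n) * b))"
    if "x \<in> standard_simplex 1" for x
  proof -
    have x: "x 0 = 1 - x 1" using that unfolding standard_simplex_1_iff by auto
    have 1: "x 0 *\<^sub>R (2 * half_side * of_int n + a) + x 1 *\<^sub>R (2 * half_side * of_int n + b) =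
        2 * half_side * of_int n + (x 0 * a + x 1 * b)" unfolding x by (simp add: algebra_simps)
    have 2: "x 0 *\<^sub>R (of_int (line_sgn n) * a) + x 1 *\<^sub>R (of_int (line_sgn n) * b) =
        of_int (line_sgn n) * (x 0 * a + x 1 * b)" by (simp add: algebra_simps)
    show ?thesis unfolding 1 2 by (rule edge_line_shift[OF iv])
  qed
  then show ?thesis unfolding path_chain_def segment_simplex_def by (simp cong: restrict_cong)
qed

lemma homologous_edge_piece:
  assumes iv: "i < m" "v \<subseteq> {..<m}"
  shows "homologous (surface m)
    (path_chain (edge_line v i) (2 * half_side * of_int n - half_side) (2 * half_side * of_int n + half_side))
    (rat_scale (of_int (line_sgn n)) (edge_chain (line_tile n v i) i))"
proof -
  let ?w = "line_tile n v i"
  have w: "?w \<subseteq> {..<m}" by (rule line_tile_subset[OF iv(2)])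
  have eq: "path_chain (edge_line v i) (2 * half_side * of_int n - half_side) (2 * half_side * of_int n + half_side) =
    path_chain (edge_line ?w i) (of_int (line_sgn n) * - half_side) (of_int (line_sgn n) * half_side)"
    using path_chain_shift[OF iv, of n "- half_side" half_side] by simp
  show ?thesis
  proof (cases "line_sgn n = 1")
    case True
    then show ?thesis unfolding eq using homologous_base_edge[OF iv(1) w] by simp
  next
    case False
    then have s: "line_sgn n = -1" using line_sgn_cases[of n] by simp
    have "homologous (surface m) (path_chain (edge_line ?w i) half_side (- half_side))
        (- path_chain (edge_line ?w i) (- half_side) half_side)"
      by (rule homologous_segment_reverse[OF convex_UNIV continuous_edge_line[OF iv(1) w]]) auto
    also have "homologous (surface m) \<dots> (- edge_chain ?w i)"
      by (rule homologous_uminus[OF homologous_base_edge[OF iv(1) w]])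
    finally show ?thesis unfolding eq by (simp add: s)
  qed
qed

lemma homologous_full_circle:
  assumes iv: "i < m" "v \<subseteq> {..<m}"
  shows "homologous (surface m) (path_chain (edge_line v i) (- half_side) (7 * half_side)) (circle_chain v i)"
proof -
  define p where "p k = 2 * half_side * real k - half_side" for k :: nat
  have 1: "homologous (surface m) (\<Sum>k<4. path_chain (edge_line v i) (p k) (p (Suc k)))
      (path_chain (edge_line v i) (p 0) (p 4))"
    by (rule homologous_segment_polygon[OF convex_UNIV continuous_edge_line[OF iv]]) auto
  have 2: "homologous (surface m) (\<Sum>k<4. path_chain (edge_line v i) (p k) (p (Suc k)))
      (\<Sum>k<(4::nat). rat_scale (of_int (line_sgn (int k))) (edge_chain (line_tile (int k) v i) i))"
  proof (rule homologous_sum)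
    fix k :: nat
    show "homologous (surface m) (path_chain (edge_line v i) (p k) (p (Suc k)))
      (rat_scale (of_int (line_sgn (int k))) (edge_chain (line_tile (int k) v i) i))"
      using homologous_edge_piece[OF iv, of "int k"] by (simp add: p_def algebra_simps)
  qed
  have 3: "(\<Sum>k<(4::nat). rat_scale (of_int (line_sgn (int k))) (edge_chain (line_tile (int k) v i) i)) = circle_chain v i"
  proof -
    have t: "line_tile 1 v i = sym_diff v {next_side i}" "line_tile 2 v i = sym_diff v {next_side i, prev_side i}"
      "line_tile 3 v i = sym_diff v {prev_side i}" by (auto simp: line_tile_def)
    have four: "{..<4} = {0, 1, 2, 3::nat}" by auto
    show ?thesis
      unfolding four circle_chain_def by (simp add: line_sgn_def t)
  qed
  have 4: "p 0 = - half_side" "p 4 = 7 * half_side" by (simp_all add: p_def)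
  show ?thesis using homologous_trans[OF homologous_sym[OF 1] 2] unfolding 3 4 .
qed

lemma path_chain_cycle:
  fixes g :: "real \<Rightarrow> 'a"
  assumes "continuous_map (top_of_set UNIV) X g" "g a = g b"
  shows "path_chain g a b \<in> rat_cycles 1 X"
proof -
  have "singular_simplex 1 X (segment_simplex g a b)"
    by (rule singular_segment_simplex[OF convex_UNIV assms(1)]) auto
  moreover have "singular_face 1 0 (segment_simplex g a b) = singular_face 1 1 (segment_simplex g a b)"
  proof
    fix x :: "nat \<Rightarrow> real"
    show "singular_face 1 0 (segment_simplex g a b) x = singular_face 1 1 (segment_simplex g a b) x"
    proof (cases "x \<in> standard_simplex 0")
      case True
      then have x: "x = (\<lambda>j. if j = 0 then 1 else 0)" by (simp add: standard_simplex_0)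
      have "simplical_face 0 x \<in> standard_simplex 1" "simplical_face 1 x \<in> standard_simplex 1"
        using True by (auto intro!: simplical_face_in_standard_simplex)
      then show ?thesis
        using True assms(2) by (simp add: singular_face_def segment_simplex_def) (simp add: simplical_face_def x)
    qed (simp add: singular_face_def)
  qed
  ultimately show ?thesis
    unfolding rat_cycles_iff path_chain_def
    by (auto simp: rat_chains_single rat_boundary_single single_uminus)
qed

lemma circle_chain_cycle:
  assumes iv: "i < m" "v \<subseteq> {..<m}"
  shows "circle_chain v i \<in> rat_cycles 1 (surface m)"
proof -
  have "edge_line v i (- half_side) = edge_line v i (7 * half_side)"
    using edge_line_periodic[OF iv, of "- half_side"] by simp
  then have "path_chain (edge_line v i) (- half_side) (7 * half_side) \<in> rat_cycles 1 (surface m)"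
    by (rule path_chain_cycle[OF continuous_edge_line[OF iv]])
  then show ?thesis by (rule homologous_cycle[OF homologous_sym[OF homologous_full_circle[OF iv]]])
qed

text \<open>Starting point and direction of the loop are arbitrary. Moving the starting point
  \<open>c\<close> to \<open>- half_side\<close> inserts a connecting path and its translate by the
  period, which cancel in homology; reversing the direction only changes the sign.\<close>

lemma homologous_loop_chain:
  assumes iv: "i < m" "v \<subseteq> {..<m}" and \<sigma>: "\<sigma> \<in> {1, -1}" and \<gamma>: "\<And>s. \<gamma> s = edge_line v i (\<sigma> * (s - a))"
  shows "\<exists>\<epsilon>\<in>{1, -1}. homologous (surface m) (loop_chain \<gamma> (8 * half_side)) (rat_scale \<epsilon> (circle_chain v i))"
proof -
  define c where "c = - \<sigma> * a"
  define d where "d = \<sigma> * (8 * half_side)"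
  note split = homologous_segment_split[OF convex_UNIV continuous_edge_line[OF iv] UNIV_I UNIV_I UNIV_I]
  let ?S = "path_chain (edge_line v i)"
  have loop: "loop_chain \<gamma> (8 * half_side) = ?S c (c + d)"
  proof -
    have "\<gamma> (8 * half_side * x 1) = edge_line v i (x 0 *\<^sub>R c + x 1 *\<^sub>R (c + d))" if "x \<in> standard_simplex 1" for x
    proof -
      have x: "x 0 = 1 - x 1" using that unfolding standard_simplex_1_iff by auto
      have "\<sigma> * (8 * half_side * x 1 - a) = x 0 *\<^sub>R c + x 1 *\<^sub>R (c + d)"
        unfolding x by (simp add: c_def d_def algebra_simps)
      then show ?thesis unfolding \<gamma> by (rule arg_cong)
    qed
    then show ?thesis
      unfolding loop_chain_def path_chain_def segment_simplex_def by (simp cong: restrict_cong)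
  qed
  have shift: "?S (- half_side + d) (c + d) = ?S (- half_side) c"
  proof -
    have per: "edge_line v i (t + d) = edge_line v i t" for t
      using \<sigma> edge_line_periodic[OF iv, of t] edge_line_periodic[OF iv, of "t - 8 * half_side"]
      by (auto simp: d_def)
    have "edge_line v i (x 0 *\<^sub>R (- half_side + d) + x 1 *\<^sub>R (c + d)) = edge_line v i (x 0 *\<^sub>R - half_side + x 1 *\<^sub>R c)"
      if "x \<in> standard_simplex 1" for x
    proof -
      have x: "x 0 = 1 - x 1" using that unfolding standard_simplex_1_iff by auto
      have "x 0 *\<^sub>R (- half_side + d) + x 1 *\<^sub>R (c + d) = x 0 *\<^sub>R - half_side + x 1 *\<^sub>R c + d"
        unfolding x by (simp add: algebra_simps)
      then show ?thesis by (simp only: per)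
    qed
    then show ?thesis unfolding path_chain_def segment_simplex_def by (simp cong: restrict_cong)
  qed
  have 1: "homologous (surface m) (?S c (c + d)) (?S c (- half_side) + ?S (- half_side) (c + d))"
    by (rule split)
  have 2: "homologous (surface m) (?S c (- half_side)) (- ?S (- half_side) c)"
    by (rule homologous_segment_reverse[OF convex_UNIV continuous_edge_line[OF iv]]) auto
  have 3: "homologous (surface m) (?S (- half_side) (c + d)) (?S (- half_side) (- half_side + d) + ?S (- half_side) c)"
    using split[of "- half_side" "c + d" "- half_side + d"] unfolding shift .
  have "homologous (surface m) (?S c (c + d))
      (- ?S (- half_side) c + (?S (- half_side) (- half_side + d) + ?S (- half_side) c))"
    by (rule homologous_trans[OF 1 homologous_add[OF 2 3]])
  then have main: "homologous (surface m) (loop_chain \<gamma> (8 * half_side)) (?S (- half_side) (- half_side + d))"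
    unfolding loop by simp
  show ?thesis
  proof (cases "\<sigma> = 1")
    case True
    then have "homologous (surface m) (loop_chain \<gamma> (8 * half_side)) (circle_chain v i)"
      using homologous_trans[OF main] homologous_full_circle[OF iv] by (simp add: d_def)
    then show ?thesis by (intro bexI[of _ 1]) auto
  next
    case False
    \<comment> \<open>A backward turn ends one period before its start; shifted forward by the
      period it becomes the reversed standard turn from \<open>7 * half_side\<close> to
      \<open>- half_side\<close>.\<close>
    then have d: "- half_side + d = - 9 * half_side" using \<sigma> by (simp add: d_def)
    have "path_chain (edge_line v i) (- half_side) (- 9 * half_side) = path_chain (edge_line v i) (7 * half_side) (- half_side)"
      using path_chain_shift[OF iv, of 4 "- half_side" "- 9 * half_side"] by (simp add: line_sgn_def)
    also have "homologous (surface m) \<dots> (- path_chain (edge_line v i) (- half_side) (7 * half_side))"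
      by (rule homologous_segment_reverse[OF convex_UNIV continuous_edge_line[OF iv]]) auto
    also have "homologous (surface m) \<dots> (- circle_chain v i)"
      by (rule homologous_uminus[OF homologous_full_circle[OF iv]])
    finally have "homologous (surface m) (loop_chain \<gamma> (8 * half_side)) (- circle_chain v i)"
      using homologous_trans[OF main] unfolding d by blast
    then show ?thesis by (intro bexI[of _ "-1"]) auto
  qed
qed

section \<open>Character decomposition\<close>


text \<open>The character of the group of tiles belonging to \<open>A\<close>, that is -1 to the
  power of the number of elements of \<open>A\<close> in \<open>v\<close>. In product form its
  multiplicativity can be checked factor by factor.\<close>

definition char :: "nat set \<Rightarrow> nat set \<Rightarrow> rat" where
  "char A v = (\<Prod>j<m. if j \<in> A \<and> j \<in> v then -1 else 1)"

lemma char_commute: "char A v = char v A"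
  unfolding char_def by (intro prod.cong) auto

lemma char_sym_diff: "char A (sym_diff v w) = char A v * char A w"
  unfolding char_def prod.distrib[symmetric] by (intro prod.cong) auto

lemma char_sq: "char A v * char A v = 1"
  unfolding char_def prod.distrib[symmetric] by (intro prod.neutral) auto

lemma char_cases: "char A v = 1 \<or> char A v = -1"
  using char_sq[of A v] by (metis power2_eq_square power2_eq_1_iff)

lemma char_single: "j < m \<Longrightarrow> char A {j} = (if j \<in> A then -1 else 1)"
proof -
  assume "j < m"
  have "char A {j} = (\<Prod>l<m. if l = j then (if j \<in> A then -1 else 1) else 1)"
    unfolding char_def by (intro prod.cong) auto
  then show ?thesis using \<open>j < m\<close> by simp
qed

lemma char_disjoint: "A \<inter> v = {} \<Longrightarrow> char A v = 1"
  unfolding char_def by (intro prod.neutral) auto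

lemma sum_tiles_shift:
  assumes "D \<subseteq> {..<m}"
  shows "(\<Sum>v\<in>tiles. f (sym_diff v D)) = (\<Sum>v\<in>tiles. f v)"
  by (rule sum.reindex_bij_witness[of _ "\<lambda>v. sym_diff v D" "\<lambda>v. sym_diff v D"])
    (use assms in auto)

text \<open>If \<open>A\<close> and \<open>B\<close> differ at \<open>j\<close>, flipping
  \<open>j\<close> permutes the tiles and reverses the sign of every term.\<close>

lemma char_orthogonal:
  assumes "A \<subseteq> {..<m}" "B \<subseteq> {..<m}"
  shows "(\<Sum>v\<in>tiles. char A v * char B v) = (if A = B then 2 ^ m else 0)"
proof (cases "A = B")
  case True
  then show ?thesis by (simp add: char_sq card_Pow)
next
  case False
  then obtain j where j: "j \<in> sym_diff A B" by blast
  then have jm: "j < m" using assms by auto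
  have "(\<Sum>v\<in>tiles. char A v * char B v) = (\<Sum>v\<in>tiles. char A (sym_diff v {j}) * char B (sym_diff v {j}))"
    using sum_tiles_shift[of "{j}" "\<lambda>v. char A v * char B v"] jm by simp
  also have "\<dots> = (\<Sum>v\<in>tiles. - (char A v * char B v))"
    unfolding char_sym_diff char_single[OF jm] using j by (intro sum.cong) auto
  also have "\<dots> = - (\<Sum>v\<in>tiles. char A v * char B v)" by (rule sum_negf)
  finally show ?thesis using False by simp
qed

text \<open>Up to the factor 2^m, the projection of side \<open>i\<close> of the empty tile to the
  part of the chains on which the group acts by the character of \<open>A\<close>.\<close>

definition isotypic :: "nat set \<Rightarrow> nat \<Rightarrow> surface_point rat_chain" where
  "isotypic A i = (\<Sum>v\<in>tiles. rat_scale (char A v) (edge_chain v i))"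

lemma isotypic_shift:
  assumes "D \<subseteq> {..<m}"
  shows "(\<Sum>v\<in>tiles. rat_scale (char A v) (edge_chain (sym_diff v D) i)) = rat_scale (char A D) (isotypic A i)"
proof -
  have DD: "sym_diff (sym_diff v D) D = v" for v by auto
  have "(\<Sum>v\<in>tiles. rat_scale (char A v) (edge_chain (sym_diff v D) i)) =
      (\<Sum>v\<in>tiles. rat_scale (char A (sym_diff v D)) (edge_chain v i))"
    using sum_tiles_shift[OF assms, of "\<lambda>v. rat_scale (char A (sym_diff v D)) (edge_chain v i)"]
    by (simp only: DD)
  then show ?thesis by (simp add: char_sym_diff isotypic_def rat_scale_sum mult.commute)
qed

text \<open>Flipping \<open>i\<close> fixes every edge chain of side \<open>i\<close> but reverses
  the character, so the sum equals its own negative.\<close>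

lemma isotypic_0:
  assumes "i < m" "i \<in> A"
  shows "isotypic A i = 0"
proof -
  have "isotypic A i = (\<Sum>v\<in>tiles. rat_scale (char A v) (edge_chain (sym_diff v {i}) i))"
    unfolding isotypic_def
  proof (intro sum.cong refl arg_cong[where f = "rat_scale _"])
    fix v assume "v \<in> tiles"
    then show "edge_chain v i = edge_chain (sym_diff v {i}) i"
      using assms(1) by (intro edge_chain_cong) auto
  qed
  also have "\<dots> = - isotypic A i"
    using isotypic_shift[of "{i}" A i] assms by (simp add: char_single)
  finally have eq: "isotypic A i = - isotypic A i" .
  show ?thesis
  proof (rule poly_mapping_eqI)
    fix f
    have "Poly_Mapping.lookup (isotypic A i) f = - Poly_Mapping.lookup (isotypic A i) f"
      by (subst eq) (rule lookup_uminus)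
    then show "Poly_Mapping.lookup (isotypic A i) f = Poly_Mapping.lookup 0 f" by simp
  qed
qed

text \<open>The four signed terms contribute the factor (1 - x) (1 - y), with x and y the characters
  of the next and the previous side. It is 4 if both are -1 and 0 otherwise.\<close>

lemma circle_sum:
  assumes "i < m"
  shows "(\<Sum>v\<in>tiles. rat_scale (char A v) (circle_chain v i)) =
    (if next_side i \<in> A \<and> prev_side i \<in> A then rat_scale 4 (isotypic A i) else 0)"
proof -
  have pair: "char A {next_side i, prev_side i} = char A {next_side i} * char A {prev_side i}"
  proof -
    have "{next_side i, prev_side i} = sym_diff {next_side i} {prev_side i}"
      using next_neq(3)[OF assms] by auto
    then show ?thesis by (simp only: char_sym_diff)
  qed
  have sub: "{next_side i} \<subseteq> {..<m}" "{prev_side i} \<subseteq> {..<m}" "{next_side i, prev_side i} \<subseteq> {..<m}" by auto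
  have "(\<Sum>v\<in>tiles. rat_scale (char A v) (circle_chain v i)) =
      isotypic A i - rat_scale (char A {next_side i}) (isotypic A i) +
      rat_scale (char A {next_side i, prev_side i}) (isotypic A i) - rat_scale (char A {prev_side i}) (isotypic A i)"
    unfolding circle_chain_def rat_scale_add_right rat_scale_diff_right sum.distrib sum_subtractf
      isotypic_shift[OF sub(1)] isotypic_shift[OF sub(2)] isotypic_shift[OF sub(3)]
    by (simp add: isotypic_def)
  also have "\<dots> = rat_scale (1 - char A {next_side i} + char A {next_side i, prev_side i} - char A {prev_side i}) (isotypic A i)"
    by (rule poly_mapping_eqI) (simp add: lookup_add lookup_minus algebra_simps)
  finally show ?thesis by (simp add: pair char_single)
qed

text \<open>Fourier inversion on the group of tiles. Of all characters only those survive for which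
  \<open>i\<close> is an isolated gap: the condition on the neighbours comes from
  \<open>circle_sum\<close>, the one on \<open>i\<close> from \<open>isotypic_0\<close>.\<close>

lemma circle_expand:
  assumes iv: "i < m" "v \<subseteq> {..<m}"
  shows "circle_chain v i = (\<Sum>A | A \<subseteq> {..<m} \<and> i \<notin> A \<and> next_side i \<in> A \<and> prev_side i \<in> A.
     rat_scale (4 * char A v / 2 ^ m) (isotypic A i))"
proof -
  have fin: "finite tiles" by simp
  have "(\<Sum>A\<in>tiles. rat_scale (char A v) (\<Sum>w\<in>tiles. rat_scale (char A w) (circle_chain w i))) =
      (\<Sum>w\<in>tiles. \<Sum>A\<in>tiles. rat_scale (char A v * char A w) (circle_chain w i))"
    unfolding rat_scale_sum by (subst sum.swap) simp
  also have "\<dots> = (\<Sum>w\<in>tiles. rat_scale (if v = w then 2 ^ m else 0) (circle_chain w i))"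
  proof (rule sum.cong[OF refl])
    fix w assume "w \<in> tiles"
    then show "(\<Sum>A\<in>tiles. rat_scale (char A v * char A w) (circle_chain w i)) =
        rat_scale (if v = w then 2 ^ m else 0) (circle_chain w i)"
      unfolding sum_rat_scale_const using char_orthogonal[OF iv(2), of w]
      by (simp add: char_commute[of _ v] char_commute[of _ w])
  qed
  also have "\<dots> = (\<Sum>w\<in>tiles. if v = w then rat_scale (2 ^ m) (circle_chain w i) else 0)"
    by (intro sum.cong) auto
  also have "\<dots> = rat_scale (2 ^ m) (circle_chain v i)" using iv(2) by simp
  finally have inv: "(\<Sum>A\<in>tiles. rat_scale (char A v) (\<Sum>w\<in>tiles. rat_scale (char A w) (circle_chain w i))) =
      rat_scale (2 ^ m) (circle_chain v i)" .
  have "circle_chain v i = rat_scale (1 / 2 ^ m) (rat_scale (2 ^ m) (circle_chain v i))" by simp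
  also have "\<dots> = (\<Sum>A\<in>tiles. rat_scale (char A v / 2 ^ m) (\<Sum>w\<in>tiles. rat_scale (char A w) (circle_chain w i)))"
    unfolding inv[symmetric] by (subst rat_scale_sum) simp
  finally have "circle_chain v i = (\<Sum>A\<in>tiles. rat_scale (char A v / 2 ^ m)
      (if next_side i \<in> A \<and> prev_side i \<in> A then rat_scale 4 (isotypic A i) else 0))"
    unfolding circle_sum[OF iv(1)] by simp
  also have "\<dots> = (\<Sum>A | A \<subseteq> {..<m} \<and> i \<notin> A \<and> next_side i \<in> A \<and> prev_side i \<in> A.
     rat_scale (4 * char A v / 2 ^ m) (isotypic A i))"
    by (rule sum.mono_neutral_cong_right) (auto simp: isotypic_0[OF iv(1)] mult.commute)
  finally show ?thesis .
qed

lemma isotypic_relation: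
  "homologous (surface m) (\<Sum>i<m. isotypic A i) 0"
proof -
  have "(\<Sum>i<m. isotypic A i) = (\<Sum>v\<in>tiles. rat_scale (char A v) (\<Sum>i<m. edge_chain v i))"
    unfolding isotypic_def rat_scale_sum by (rule sum.swap)
  moreover have "homologous (surface m) (\<Sum>v\<in>tiles. rat_scale (char A v) (\<Sum>i<m. edge_chain v i))
      (\<Sum>v\<in>tiles. rat_scale (char A v) 0)"
    by (intro homologous_sum homologous_scale homologous_polygon_boundary) auto
  ultimately show ?thesis by simp
qed

section \<open>Dual functionals\<close>

text \<open>A chord through the sides \<open>i\<close> and \<open>j\<close> separates the vertices i
  + 1, ..., j from the others. A clipped affine function of the distance to this chord is 1/2 beyond
  it and 0 before it, with the transition confined to a strip so thin that no other side enters
  it.\<close>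

lemma separating_function:
  assumes ij: "i < m" "j < m" "i \<noteq> j"
  shows "\<exists>u :: complex \<Rightarrow> real. continuous_on UNIV u \<and>
    (\<forall>l<m. l \<noteq> i \<longrightarrow> l \<noteq> j \<longrightarrow> (\<forall>x\<in>polygon_side m l. u x = 0 \<or> u x = 1 / 2) \<and> u (vertex m (Suc l)) = u (vertex m l)) \<and>
    u (vertex m (Suc i)) \<noteq> u (vertex m i)"
proof -
  have main: "\<exists>u :: complex \<Rightarrow> real. continuous_on UNIV u \<and>
      (\<forall>l<m. l \<noteq> i \<longrightarrow> l \<noteq> j \<longrightarrow> (\<forall>x\<in>polygon_side m l. u x = 0 \<or> u x = 1 / 2) \<and> u (vertex m (Suc l)) = u (vertex m l)) \<and>
      u (vertex m (Suc i)) \<noteq> u (vertex m i) \<and> u (vertex m (Suc j)) \<noteq> u (vertex m j)"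
    if ij: "i < j" "j < m" for i j
  proof -
    \<comment> \<open>The direction of the middle of the arc of vertices i + 1, ..., j. In units of
      \<pi> / m from it, the outermost vertices of the arc are at j - i - 1 and the nearest others
      at j - i + 1, so \<open>f\<close> below cuts at j - i.\<close>
    define n where "n = cis (real (i + j + 1) * pi / real m)"
    define f where "f x = x \<bullet> n - vertex_radius m * cos (real (j - i) * pi / real m)" for x
    have fV: "f (vertex m k) = vertex_radius m * (cos (\<bar>2 * real k - real (i + j + 1)\<bar> * pi / real m) -
        cos (real (j - i) * pi / real m))" for k
      unfolding f_def n_def vertex_inner_cis by (simp add: right_diff_distrib)
    have pos: "f (vertex m k) > 0" if k: "i < k" "k \<le> j" for k
    proof -
      have "cos (real (j - i) * pi / real m) < cos (\<bar>2 * real k - real (i + j + 1)\<bar> * pi / real m)"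
        by (rule cos_less) (use k ij in \<open>auto simp: of_nat_diff abs_if\<close>)
      then show ?thesis unfolding fV using radius_pos by simp
    qed
    have neg: "f (vertex m k) < 0" if k: "k < m" "\<not> (i < k \<and> k \<le> j)" for k
    proof -
      have "cos (\<bar>2 * real k - real (i + j + 1)\<bar> * pi / real m) < cos (real (j - i) * pi / real m)"
      proof (rule cos_less)
        show "real (j - i) < \<bar>2 * real k - real (i + j + 1)\<bar>"
          using k ij by (auto simp: of_nat_diff abs_if)
        show "\<bar>2 * real k - real (i + j + 1)\<bar> < 2 * real m - real (j - i)"
          using k ij by (auto simp: of_nat_diff abs_if)
      qed simp
      then show ?thesis unfolding fV using radius_pos by (simp add: mult_less_0_iff)
    qed
    define \<delta> where "\<delta> = Min ((\<lambda>k. \<bar>f (vertex m k)\<bar>) ` {..<m})"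
    have ne: "(\<lambda>k. \<bar>f (vertex m k)\<bar>) ` {..<m} \<noteq> {}" using m_pos(1) by blast
    have f0: "\<bar>f (vertex m k)\<bar> > 0" if "k < m" for k
      using pos[of k] neg[OF that] by (cases "i < k \<and> k \<le> j") auto
    then have \<delta>: "\<delta> > 0" unfolding \<delta>_def using ne by (subst Min_gr_iff) auto
    have \<delta>_le: "\<delta> \<le> \<bar>f (vertex m k)\<bar>" if "k < m" for k
      unfolding \<delta>_def using that by (intro Min_le) auto
    \<comment> \<open>The affine part takes the values 0 and 1/2 exactly where \<open>f\<close> is
      \<open>- \<delta>\<close> and \<open>\<delta>\<close>. All vertices lie outside this strip,
      and by convexity so do all sides whose ends lie on the same side of the chord.\<close>
    define u where "u x = max 0 (min (1 / 2) ((f x + \<delta>) / (4 * \<delta>)))" for x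
    have u1: "u x = 1 / 2" if "f x \<ge> \<delta>" for x
      using that \<delta> by (simp add: u_def min_def max_def field_simps)
    have u0: "u x = 0" if "f x \<le> - \<delta>" for x
      using that \<delta> by (simp add: u_def min_def max_def field_simps)
    define cl where "cl k \<longleftrightarrow> i < k \<and> k \<le> j" for k
    have fk: "f (vertex m k) \<ge> \<delta>" if "cl k" "k < m" for k
      using \<delta>_le[OF that(2)] pos[of k] that(1) by (auto simp: cl_def)
    have fk': "f (vertex m k) \<le> - \<delta>" if "\<not> cl k" "k < m" for k
      using \<delta>_le[OF that(2)] neg[OF that(2)] that(1) by (auto simp: cl_def)
    have next_cl: "cl (next_side l) \<longleftrightarrow> cl l" if "l < m" "l \<noteq> i" "l \<noteq> j" for l
      using that ij by (cases "Suc l = m") (auto simp: cl_def next_side_def)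
    have seg: "f ((1 - s) *\<^sub>R a + s *\<^sub>R b) = (1 - s) * f a + s * f b" for s a b
      by (simp add: f_def inner_add_left algebra_simps)
    have side: "(\<forall>x\<in>polygon_side m l. u x = (if cl l then 1 / 2 else 0)) \<and> u (vertex m (Suc l)) = u (vertex m l)"
      if l: "l < m" "l \<noteq> i" "l \<noteq> j" for l
    proof -
      have ux: "u x = (if cl l then 1 / 2 else 0)" if x: "x \<in> polygon_side m l" for x
      proof -
        obtain s where s: "0 \<le> s" "s \<le> 1" "x = (1 - s) *\<^sub>R vertex m l + s *\<^sub>R vertex m (next_side l)"
          using x by (auto simp: polygon_side_def closed_segment_def vertex_next)
        have fx: "f x = (1 - s) * f (vertex m l) + s * f (vertex m (next_side l))" unfolding s(3) by (rule seg)
        show ?thesis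
        proof (cases "cl l")
          case True
          then have "(1 - s) * \<delta> + s * \<delta> \<le> f x"
            unfolding fx using s fk[of l] fk[of "next_side l"] next_cl[OF l] l(1)
            by (intro add_mono mult_left_mono) auto
          then show ?thesis using True u1[of x] by (simp add: algebra_simps)
        next
          case False
          then have "f x \<le> (1 - s) * (- \<delta>) + s * (- \<delta>)"
            unfolding fx using s fk'[of l] fk'[of "next_side l"] next_cl[OF l] l(1)
            by (intro add_mono mult_left_mono) auto
          then show ?thesis using False u0[of x] by (simp add: algebra_simps)
        qed
      qed
      moreover have "vertex m l \<in> polygon_side m l" "vertex m (Suc l) \<in> polygon_side m l"
        by (simp_all add: polygon_side_def)
      ultimately show ?thesis by auto
    qed
    have uV: "u (vertex m k) = (if cl (k mod m) then 1 / 2 else 0)" for k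
      using u1[of "vertex m (k mod m)"] u0[of "vertex m (k mod m)"] fk[of "k mod m"] fk'[of "k mod m"]
      by (simp split: if_splits)
    have "u (vertex m (Suc i)) \<noteq> u (vertex m i)" "u (vertex m (Suc j)) \<noteq> u (vertex m j)"
      unfolding uV using ij by (cases "Suc j = m"; auto simp: cl_def)+
    moreover have "continuous_on UNIV u" unfolding u_def f_def by (intro continuous_intros) (use \<delta> in auto)
    ultimately show ?thesis using side by (intro exI[of _ u]) auto
  qed
  show ?thesis
  proof (cases "i < j")
    case True
    from main[OF True ij(2)] show ?thesis by blast
  next
    case False
    then have "j < i" using ij(3) by simp
    from main[OF this ij(1)] show ?thesis by blast
  qed
qed

definition circle_map :: "nat set \<Rightarrow> (complex \<Rightarrow> real) \<Rightarrow> surface_point \<Rightarrow> complex" where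
  "circle_map A u c = (let p = SOME p. p \<in> c in cis (2 * pi * of_rat (char A (fst p)) * u (snd p)))"

text \<open>Two representatives of a point with different signs differ by the flip of a side in
  \<open>A\<close> through \<open>x\<close>. There \<open>u\<close> is 0 or 1/2, the two values at
  which 2 \<pi> u and - 2 \<pi> u give the same point of the circle. So the chosen representative
  does not matter.\<close>

lemma circle_map_class:
  assumes v: "v \<subseteq> {..<m}" and u: "\<And>l x. \<lbrakk>l \<in> A; l < m; x \<in> polygon_side m l\<rbrakk> \<Longrightarrow> u x = 0 \<or> u x = 1 / 2"
  shows "circle_map A u (cls v x) = cis (2 * pi * of_rat (char A v) * u x)"
proof -
  define p where "p = (SOME p. p \<in> cls v x)"
  have "(v, x) \<in> cls v x" by (simp add: tile_class_def)
  then have "p \<in> cls v x" unfolding p_def by (rule someI)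
  then obtain w where p: "p = (w, x)" "sym_diff v w \<subseteq> sides_at x"
    unfolding tile_class_eq[OF v] by auto
  have "cis (2 * pi * of_rat (char A w) * u x) = cis (2 * pi * of_rat (char A v) * u x)"
  proof (cases "char A w = char A v")
    case False
    have "char A v * char A w \<noteq> 1" using False char_cases[of A v] char_cases[of A w] by auto
    then have "A \<inter> sym_diff v w \<noteq> {}" using char_disjoint[of A "sym_diff v w"] char_sym_diff by metis
    then obtain l where "l \<in> A" "l \<in> sides_at x" using p(2) by blast
    then have "u x = 0 \<or> u x = 1 / 2" using u by (auto simp: sides_at_def)
    then show ?thesis
    proof
      assume "u x = 1 / 2"
      then have half: "2 * pi * of_rat (char A y) * u x = of_rat (char A y) * pi" for y by simp
      show ?thesis
        unfolding half using char_cases[of A v] char_cases[of A w] by (auto simp: complex_eq_iff)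
    qed simp
  qed simp
  then show ?thesis unfolding circle_map_def p_def[symmetric] by (simp add: p(1) Let_def)
qed

lemma continuous_circle_map:
  assumes u: "continuous_on UNIV u" "\<And>l x. \<lbrakk>l \<in> A; l < m; x \<in> polygon_side m l\<rbrakk> \<Longrightarrow> u x = 0 \<or> u x = 1 / 2"
  shows "continuous_map (surface m) (top_of_set (- {0})) (circle_map A u)"
proof (rule continuous_from_surface)
  fix v assume v: "v \<subseteq> {..<m}"
  have "continuous_on (polygon m) (\<lambda>x. cis (2 * pi * of_rat (char A v) * u x))"
    by (intro continuous_intros continuous_on_cis continuous_on_subset[OF u(1)]) auto
  then show "continuous_map (top_of_set (polygon m)) (top_of_set (- {0})) (\<lambda>x. circle_map A u (cls v x))"
    by (simp add: circle_map_class[OF v u(2)] continuous_map_in_subtopology image_subset_iff)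
qed

lemma winding_edge_chain:
  assumes v: "v \<subseteq> {..<m}"
    and u: "continuous_on UNIV u" "\<And>l x. \<lbrakk>l \<in> A; l < m; x \<in> polygon_side m l\<rbrakk> \<Longrightarrow> u x = 0 \<or> u x = 1 / 2"
  shows "winding (circle_map A u) (edge_chain v k) =
    of_rat (char A v) * (\<i> * of_real (2 * pi * (u (vertex m (Suc k)) - u (vertex m k))))"
proof -
  define e where "e t = (1 - t) *\<^sub>R vertex m k + t *\<^sub>R vertex m (Suc k)" for t
  define q where "q t = \<i> * of_real (2 * pi * of_rat (char A v) * u (e t))" for t
  have "log_change (\<lambda>t. circle_map A u (segment_simplex (cls v) (vertex m k) (vertex m (Suc k)) (unit_path t))) = q 1 - q 0"
  proof (rule log_change_eq)
    have "continuous_on {0..1} (\<lambda>t. u (e t))"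
      by (rule continuous_on_compose2[OF u(1)]) (auto simp: e_def intro!: continuous_intros)
    then show "continuous_on {0..1} q" unfolding q_def by (intro continuous_intros)
    fix t :: real assume t: "t \<in> {0..1}"
    have "segment_simplex (cls v) (vertex m k) (vertex m (Suc k)) (unit_path t) = cls v (e t)"
      using unit_path_simplex[OF t] by (simp add: segment_simplex_def e_def unit_path_def)
    then show "circle_map A u (segment_simplex (cls v) (vertex m k) (vertex m (Suc k)) (unit_path t)) = exp (q t)"
      by (simp add: circle_map_class[OF v u(2)] q_def cis_conv_exp)
  qed
  then show ?thesis
    unfolding edge_chain_def path_chain_def winding_single
    using char_cases[of A v] by (auto simp: q_def e_def algebra_simps)
qed

text \<open>The sign in the exponent makes the winding along an edge proportional to the character
  of \<open>A\<close>, so orthogonality removes every other isotypic part.\<close>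

lemma winding_isotypic:
  assumes A: "A \<subseteq> {..<m}" and B: "B \<subseteq> {..<m}"
    and u: "continuous_on UNIV u" "\<And>l x. \<lbrakk>l \<in> A; l < m; x \<in> polygon_side m l\<rbrakk> \<Longrightarrow> u x = 0 \<or> u x = 1 / 2"
  shows "winding (circle_map A u) (isotypic B k) =
    (if A = B then 2 ^ m * (\<i> * of_real (2 * pi * (u (vertex m (Suc k)) - u (vertex m k)))) else 0)"
proof -
  define z where "z = \<i> * complex_of_real (2 * pi * (u (vertex m (Suc k)) - u (vertex m k)))"
  have "winding (circle_map A u) (isotypic B k) = (\<Sum>v\<in>tiles. of_rat (char A v * char B v) * z)"
    unfolding isotypic_def winding_sum winding_scale z_def
    by (intro sum.cong refl) (simp add: winding_edge_chain[OF _ u] of_rat_mult)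
  also have "\<dots> = of_rat (\<Sum>v\<in>tiles. char A v * char B v) * z"
    by (simp add: of_rat_sum sum_distrib_right)
  also have "\<dots> = (if A = B then 2 ^ m * z else 0)"
    unfolding char_orthogonal[OF A B] by (simp add: of_rat_power)
  finally show ?thesis unfolding z_def .
qed

end

section \<open>The dimension of the span\<close>

text \<open>Lets span arguments be carried out on cycles instead of cosets: the cycles whose class
  lies in a span are closed under linear combinations and under homology.\<close>

lemma span_class_closed:
  fixes S :: "'a rat_chain set set" and X :: "'a topology"
  assumes S: "S \<subseteq> carrier (rat_homology 1 X)"
  defines "T \<equiv> {z \<in> rat_cycles 1 X. rat_homology_class 1 X z \<in> LinearCombinations.module.span rat_field (rat_homology 1 X) S}"
  shows span_class_0: "0 \<in> T"
    and span_class_add: "\<And>z w. z \<in> T \<Longrightarrow> w \<in> T \<Longrightarrow> z + w \<in> T"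
    and span_class_scale: "\<And>z r. z \<in> T \<Longrightarrow> rat_scale r z \<in> T"
    and span_class_homologous: "\<And>z w. homologous X z w \<Longrightarrow> w \<in> T \<Longrightarrow> z \<in> T"
    and span_class_sum: "\<And>z I. (\<And>i. i \<in> I \<Longrightarrow> z i \<in> T) \<Longrightarrow> (\<Sum>i\<in>I. z i) \<in> T"
proof -
  interpret V: vectorspace rat_field "rat_homology 1 X" by (rule vectorspace_rat_homology)
  interpret W: submodule rat_field "V.span S" "rat_homology 1 X" by (rule V.span_is_submodule[OF S])
  show 0: "0 \<in> T"
    using W.zero_closed by (simp add: T_def rat_cycles_0 zero_rat_homology)
  show add: "z + w \<in> T" if "z \<in> T" "w \<in> T" for z w
    using that W.m_closed by (auto simp: T_def rat_cycles_add simp flip: add_rat_homology)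
  show "rat_scale r z \<in> T" if "z \<in> T" for z r
    using that W.smult_closed[of r] by (auto simp: T_def rat_cycles_scale simp flip: smult_rat_homology)
  show "z \<in> T" if "homologous X z w" "w \<in> T" for z w
    using that homologous_cycle[OF that(1)] homologous_class[OF that(1)] by (auto simp: T_def)
  show "(\<Sum>i\<in>I. z i) \<in> T" if "\<And>i. i \<in> I \<Longrightarrow> z i \<in> T" for z and I :: "'b set"
    using that by (induction I rule: infinite_finite_induct) (auto intro: 0 add)
qed

definition class_winding :: "('a \<Rightarrow> complex) \<Rightarrow> 'a rat_chain set \<Rightarrow> complex" where
  "class_winding h c = winding h (SOME z. z \<in> c)"

lemma class_winding_eq:
  assumes "continuous_map X (top_of_set (- {0})) h"
  shows "class_winding h (rat_homology_class 1 X z) = winding h z"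
proof -
  have "z \<in> rat_homology_class 1 X z"
    using rat_boundaries_0[of 1 X] by (force simp: rat_homology_class_eq)
  then have "(SOME y. y \<in> rat_homology_class 1 X z) \<in> rat_homology_class 1 X z" by (rule someI)
  then obtain b where "b \<in> rat_boundaries 1 X" "(SOME y. y \<in> rat_homology_class 1 X z) = b + z"
    by (auto simp: rat_homology_class_eq)
  then show ?thesis by (simp add: class_winding_def winding_add winding_boundary[OF assms])
qed

context right_angled_polygon begin

definition isolated_gaps :: "(nat set \<times> nat) set" where
  "isolated_gaps = {(A, i). A \<subseteq> {..<m} \<and> i < m \<and> i \<notin> A \<and> next_side i \<in> A \<and> prev_side i \<in> A}"

text \<open>If every gap of \<open>A\<close> is isolated, the cycles \<open>isotypic A i\<close> of its gaps sum to zero in homology;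
  exactly then the last one is dropped.\<close>

definition basis_index :: "(nat set \<times> nat) set" where
  "basis_index = {(A, i) \<in> isolated_gaps. \<exists>j<m. j \<notin> A \<and> ((A, j) \<notin> isolated_gaps \<or> i < j)}"

lemma finite_basis_index: "finite basis_index"
  by (rule finite_subset[of _ "tiles \<times> {..<m}"]) (auto simp: basis_index_def isolated_gaps_def)

lemma isotypic_via_circles:
  assumes "(A, i) \<in> isolated_gaps"
  shows "isotypic A i = (\<Sum>v\<in>tiles. rat_scale (char A v / 4) (circle_chain v i))"
proof -
  have "rat_scale (1 / 4) (\<Sum>v\<in>tiles. rat_scale (char A v) (circle_chain v i)) = isotypic A i"
    using circle_sum[of i A] assms by (simp add: isolated_gaps_def)
  then show ?thesis by (simp add: rat_scale_sum)
qed

lemma isotypic_cycle: "(A, i) \<in> isolated_gaps \<Longrightarrow> isotypic A i \<in> rat_cycles 1 (surface m)"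
  unfolding isotypic_via_circles
  by (intro rat_cycles_sum rat_cycles_scale circle_chain_cycle) (auto simp: isolated_gaps_def)

text \<open>The map to the circle built from \<open>u\<close> changes only along the sides
  \<open>i\<close> and \<open>j\<close>, and winding around it necessarily involves two sides. Hence
  \<open>j\<close> must be a second gap of \<open>A\<close> whose pair is absent from the basis;
  then the functional sees no basis element but (A, i).\<close>

lemma dual_functional:
  assumes Ai: "(A, i) \<in> basis_index"
  shows "\<exists>h. continuous_map (surface m) (top_of_set (- {0})) h \<and> winding h (isotypic A i) \<noteq> 0 \<and>
    (\<forall>B k. (B, k) \<in> basis_index \<longrightarrow> (B, k) \<noteq> (A, i) \<longrightarrow> winding h (isotypic B k) = 0)"
proof -
  have A: "A \<subseteq> {..<m}" and i: "i < m" "i \<notin> A" and iso: "(A, i) \<in> isolated_gaps"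
    using Ai by (auto simp: basis_index_def isolated_gaps_def)
  \<comment> \<open>If some gap is not isolated, it serves as \<open>j\<close>. Otherwise
    \<open>j\<close> is the largest gap, which is the dropped one; it differs from \<open>i\<close>
    because membership of (A, i) then provides a gap beyond \<open>i\<close>.\<close>
  obtain j where j: "j < m" "j \<notin> A" "j \<noteq> i" "(A, j) \<notin> basis_index"
  proof (cases "\<exists>j<m. j \<notin> A \<and> (A, j) \<notin> isolated_gaps")
    case True
    then show ?thesis using that iso by (auto simp: basis_index_def)
  next
    case False
    define j where "j = Max ({..<m} - A)"
    have fin: "finite ({..<m} - A)" by simp
    have "j \<in> {..<m} - A" unfolding j_def using i by (intro Max_in) auto
    moreover have le: "l \<le> j" if "l < m" "l \<notin> A" for l
      unfolding j_def using that by (intro Max_ge) auto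
    moreover obtain l where "l < m" "l \<notin> A" "i < l" using Ai False by (auto simp: basis_index_def)
    ultimately show ?thesis
      using that[of j] False by (fastforce simp: basis_index_def)
  qed
  obtain u :: "complex \<Rightarrow> real" where u: "continuous_on UNIV u"
    "\<forall>l<m. l \<noteq> i \<longrightarrow> l \<noteq> j \<longrightarrow> (\<forall>x\<in>polygon_side m l. u x = 0 \<or> u x = 1 / 2) \<and> u (vertex m (Suc l)) = u (vertex m l)"
    "u (vertex m (Suc i)) \<noteq> u (vertex m i)"
    using separating_function[OF i(1) j(1) j(3)[symmetric]] by (elim exE conjE)
  have uA: "u x = 0 \<or> u x = 1 / 2" if "l \<in> A" "l < m" "x \<in> polygon_side m l" for l x
  proof -
    have "l \<noteq> i" "l \<noteq> j" using that(1) i(2) j(2) by auto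
    then show ?thesis using u(2) that(2,3) by blast
  qed
  show ?thesis
  proof (intro exI[of _ "circle_map A u"] conjI allI impI)
    show "continuous_map (surface m) (top_of_set (- {0})) (circle_map A u)"
      by (rule continuous_circle_map[OF u(1) uA])
    have "winding (circle_map A u) (isotypic A i) =
        (if A = A then 2 ^ m * (\<i> * of_real (2 * pi * (u (vertex m (Suc i)) - u (vertex m i)))) else 0)"
      by (rule winding_isotypic[OF A A u(1) uA])
    then show "winding (circle_map A u) (isotypic A i) \<noteq> 0" using u(3) by simp
    fix B k assume Bk: "(B, k) \<in> basis_index" "(B, k) \<noteq> (A, i)"
    then have B: "B \<subseteq> {..<m}" "k < m" by (auto simp: basis_index_def isolated_gaps_def)
    have w: "winding (circle_map A u) (isotypic B k) =
        (if A = B then 2 ^ m * (\<i> * of_real (2 * pi * (u (vertex m (Suc k)) - u (vertex m k)))) else 0)"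
      by (rule winding_isotypic[OF A B(1) u(1) uA])
    show "winding (circle_map A u) (isotypic B k) = 0"
    proof (cases "A = B")
      case True
      then have "k \<noteq> i" "k \<noteq> j" using Bk j(4) by auto
      then have "u (vertex m (Suc k)) = u (vertex m k)" using u(2) B(2) by blast
      then show ?thesis unfolding w by simp
    next
      case False
      then show ?thesis unfolding w by (rule if_not_P)
    qed
  qed
qed

lemma isotypic_spanned:
  assumes Ai: "(A, i) \<in> isolated_gaps"
    and T: "T = {z \<in> rat_cycles 1 (surface m). rat_homology_class 1 (surface m) z \<in>
       LinearCombinations.module.span rat_field (rat_homology 1 (surface m)) S}"
    and S: "S \<subseteq> carrier (rat_homology 1 (surface m))"
    and basis: "\<And>B k. (B, k) \<in> basis_index \<Longrightarrow> isotypic B k \<in> T"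
  shows "isotypic A i \<in> T"
proof (cases "(A, i) \<in> basis_index")
  case False
  have i: "i < m" using Ai by (simp add: isolated_gaps_def)
  have others: "isotypic A j \<in> T" if j: "j < m" "j \<noteq> i" for j
  proof (cases "j \<in> A")
    case True
    then show ?thesis using isotypic_0[OF j(1)] span_class_0[OF S] T by simp
  next
    case jA: False
    \<comment> \<open>An isolated gap outside the basis means that every gap of \<open>A\<close> is
      isolated and none exceeds \<open>i\<close>. So all other gaps are basis elements, and the
      relation among the isotypic parts expresses the remaining one through them.\<close>
    then have "(A, j) \<in> isolated_gaps" "j \<le> i" using False Ai j by (auto simp: basis_index_def)
    then have "(A, j) \<in> basis_index" using Ai j(2) by (auto simp: basis_index_def isolated_gaps_def)
    then show ?thesis by (rule basis)
  qed
  have "(\<Sum>j<m. isotypic A j) = isotypic A i + (\<Sum>j\<in>{..<m} - {i}. isotypic A j)"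
    using i by (simp add: sum.remove)
  then have "homologous (surface m) (isotypic A i) (rat_scale (-1) (\<Sum>j\<in>{..<m} - {i}. isotypic A j))"
    using isotypic_relation[of A] by (simp add: homologous_def)
  moreover have "rat_scale (-1) (\<Sum>j\<in>{..<m} - {i}. isotypic A j) \<in> T"
    unfolding T by (intro span_class_scale[OF S] span_class_sum[OF S]) (use others T in auto)
  ultimately show ?thesis unfolding T by (rule span_class_homologous[OF S])
qed (rule basis)

text \<open>Valid for every m \<ge> 5; only the value of the cardinality is computed case by case.
  The function \<open>\<gamma>\<close> stands for an arbitrary choice of orientation and starting
  point on each geodesic.\<close>

theorem span_dim_edge_geodesics:
  fixes \<gamma> :: "surface_point set \<Rightarrow> real \<Rightarrow> surface_point" and L :: "surface_point set \<Rightarrow> real"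
  assumes \<gamma>: "\<And>c. c \<in> edge_geodesics m \<Longrightarrow> closed_geodesic m (\<gamma> c) (L c) \<and> range (\<gamma> c) = c"
  shows "span_dim (rat_homology 1 (surface m))
           ((\<lambda>c. rat_homology_class 1 (surface m) (loop_chain (\<gamma> c) (L c))) ` edge_geodesics m) =
         card basis_index"
proof -
  let ?S = "surface m" and ?H = "rat_homology 1 (surface m)"
  let ?cl = "rat_homology_class 1 (surface m)"
  let ?l = "\<lambda>c. loop_chain (\<gamma> c) (L c)"
  define Loops where "Loops = (\<lambda>c. ?cl (?l c)) ` edge_geodesics m"
  have family: "\<gamma> c \<in> line_family" "L c = 8 * half_side" if c: "c \<in> edge_geodesics m" for c
  proof -
    have "range (\<gamma> c) \<subseteq> edge_union m" using \<gamma>[OF c] c by (auto simp: edge_geodesics_def)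
    moreover have "closed_geodesic m (\<gamma> c) (L c)" using \<gamma>[OF c] by simp
    ultimately show "\<gamma> c \<in> line_family" "L c = 8 * half_side"
      by (simp_all add: closed_geodesic_in_edges)
  qed
  have loop_circle: "\<exists>v i \<epsilon>. v \<subseteq> {..<m} \<and> i < m \<and> homologous ?S (?l c) (rat_scale \<epsilon> (circle_chain v i))"
    if c: "c \<in> edge_geodesics m" for c
  proof -
    obtain v i \<sigma> d where \<tau>: "\<gamma> c = (\<lambda>s. edge_line v i (\<sigma> * s + d))" "v \<subseteq> {..<m}" "i < m" "\<sigma> \<in> {1, -1}"
      using family(1)[OF c] unfolding line_family_def by blast
    have "\<gamma> c s = edge_line v i (\<sigma> * (s - (- \<sigma> * d)))" for s
      using \<tau>(4) unfolding \<tau>(1) by (auto simp: algebra_simps)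
    from homologous_loop_chain[OF \<tau>(3,2,4) this] obtain \<epsilon> where
      "homologous ?S (loop_chain (\<gamma> c) (8 * half_side)) (rat_scale \<epsilon> (circle_chain v i))" by blast
    then show ?thesis unfolding family(2)[OF c] using \<tau>(2,3) by blast
  qed
  have circle_loop: "\<exists>c\<in>edge_geodesics m. \<exists>\<epsilon>\<in>{1, -1}. homologous ?S (?l c) (rat_scale \<epsilon> (circle_chain v i))"
    if v: "v \<subseteq> {..<m}" and i: "i < m" for v i
  proof -
    define c where "c = range (edge_line v i)"
    have c: "c \<in> edge_geodesics m"
      unfolding edge_geodesics_def c_def
      by (intro CollectI exI[of _ "edge_line v i"] exI[of _ "8 * half_side"] conjI refl
          edge_line_closed_geodesic[OF i v] image_subsetI edge_line_in_surface(2)[OF i v])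
    \<comment> \<open>Only the trace of \<open>\<gamma> c\<close> is known. It contains this
      midpoint, and passing through it forces \<open>\<gamma> c\<close> to be the line through side
      \<open>i\<close> of \<open>v\<close> up to shift and reversal.\<close>
    have "cls v (side_point i 0) \<in> c"
      using edge_line_base[OF i v, of 0] half_side_pos unfolding c_def by (metis abs_zero less_imp_le rangeI)
    then obtain a where "\<gamma> c a = cls v (side_point i 0)" using \<gamma>[OF c] by (metis rangeE)
    from line_family_through_center[OF family(1)[OF c] v i this]
    obtain \<sigma> where "\<sigma> \<in> {1, -1}" "\<And>s. \<gamma> c s = edge_line v i (\<sigma> * (s - a))" by blast
    from homologous_loop_chain[OF i v this] obtain \<epsilon> where "\<epsilon> \<in> {1, -1}"
      "homologous ?S (?l c) (rat_scale \<epsilon> (circle_chain v i))" unfolding family(2)[OF c] by blast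
    then show ?thesis using c by blast
  qed
  have loop_cycle: "?l c \<in> rat_cycles 1 ?S" if c: "c \<in> edge_geodesics m" for c
  proof -
    obtain v i \<epsilon> where vi: "v \<subseteq> {..<m}" "i < m" "homologous ?S (?l c) (rat_scale \<epsilon> (circle_chain v i))"
      using loop_circle[OF c] by (elim exE conjE)
    show ?thesis by (rule homologous_cycle[OF vi(3) rat_cycles_scale[OF circle_chain_cycle[OF vi(2,1)]]])
  qed
  have Loops_carrier: "Loops \<subseteq> carrier ?H"
    unfolding Loops_def carrier_rat_homology using loop_cycle by blast
  define b where "b = (\<lambda>(A, i). ?cl (isotypic A i))"
  have b_carrier: "b ` basis_index \<subseteq> carrier ?H"
    unfolding b_def carrier_rat_homology using isotypic_cycle by (auto simp: basis_index_def)
  have "\<forall>g\<in>basis_index. \<exists>h. continuous_map ?S (top_of_set (- {0})) h \<and>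
      winding h (isotypic (fst g) (snd g)) \<noteq> 0 \<and>
      (\<forall>B k. (B, k) \<in> basis_index \<longrightarrow> (B, k) \<noteq> g \<longrightarrow> winding h (isotypic B k) = 0)"
  proof
    fix g assume g: "g \<in> basis_index"
    obtain A i where Ai: "g = (A, i)" by (cases g)
    show "\<exists>h. continuous_map ?S (top_of_set (- {0})) h \<and> winding h (isotypic (fst g) (snd g)) \<noteq> 0 \<and>
      (\<forall>B k. (B, k) \<in> basis_index \<longrightarrow> (B, k) \<noteq> g \<longrightarrow> winding h (isotypic B k) = 0)"
      unfolding Ai fst_conv snd_conv by (rule dual_functional) (use g Ai in simp)
  qed
  then obtain h where h: "\<forall>g\<in>basis_index. continuous_map ?S (top_of_set (- {0})) (h g) \<and>
      winding (h g) (isotypic (fst g) (snd g)) \<noteq> 0 \<and>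
      (\<forall>B k. (B, k) \<in> basis_index \<longrightarrow> (B, k) \<noteq> g \<longrightarrow> winding (h g) (isotypic B k) = 0)"
    by (elim exE[OF bchoice])
  have hw: "class_winding (h g) (?cl z) = winding (h g) z" if "g \<in> basis_index" for g z
    using class_winding_eq h that by blast
  interpret V: vectorspace rat_field ?H by (rule vectorspace_rat_homology)
  have "span_dim ?H Loops = card basis_index"
  proof (rule span_dim_eq_card[OF vectorspace_rat_homology Loops_carrier finite_basis_index, of b
        "\<lambda>g. class_winding (h g)"])
    let ?T = "{z \<in> rat_cycles 1 ?S. ?cl z \<in> V.span Loops}"
    fix g assume g: "g \<in> basis_index"
    obtain A i where Ai: "g = (A, i)" by (cases g)
    have iso: "(A, i) \<in> isolated_gaps" "i < m" using g by (auto simp: Ai basis_index_def isolated_gaps_def)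
    have "circle_chain v i \<in> ?T" if v: "v \<subseteq> {..<m}" for v
    proof -
      obtain c \<epsilon> where c: "c \<in> edge_geodesics m" "\<epsilon> \<in> {1, -1}" "homologous ?S (?l c) (rat_scale \<epsilon> (circle_chain v i))"
        using circle_loop[OF v iso(2)] by blast
      have "?cl (?l c) \<in> V.span Loops"
        using V.in_own_span[OF Loops_carrier] c(1) by (auto simp: Loops_def)
      then have "?l c \<in> ?T" using loop_cycle[OF c(1)] by simp
      then have "rat_scale \<epsilon> (?l c) \<in> ?T" by (rule span_class_scale[OF Loops_carrier])
      moreover have "homologous ?S (circle_chain v i) (rat_scale \<epsilon> (?l c))"
        using homologous_sym[OF homologous_scale[OF c(3), of \<epsilon>]] c(2) by auto
      ultimately show ?thesis by (rule span_class_homologous[OF Loops_carrier, rotated])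
    qed
    then have "isotypic A i \<in> ?T"
      unfolding isotypic_via_circles[OF iso(1)]
      by (intro span_class_sum[OF Loops_carrier] span_class_scale[OF Loops_carrier]) auto
    then show "b g \<in> V.span Loops" by (simp add: b_def Ai)
  next
    let ?T = "{z \<in> rat_cycles 1 ?S. ?cl z \<in> V.span (b ` basis_index)}"
    have basis: "isotypic B k \<in> ?T" if Bk: "(B, k) \<in> basis_index" for B k
    proof -
      have "b (B, k) \<in> V.span (b ` basis_index)" using V.in_own_span[OF b_carrier] Bk by blast
      then show ?thesis using isotypic_cycle[of B k] Bk by (simp add: b_def basis_index_def)
    qed
    show "Loops \<subseteq> V.span (b ` basis_index)"
    proof
      fix x assume "x \<in> Loops"
      then obtain c where c: "c \<in> edge_geodesics m" "x = ?cl (?l c)" by (auto simp: Loops_def)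
      obtain v i \<epsilon> where vi: "v \<subseteq> {..<m}" "i < m" "homologous ?S (?l c) (rat_scale \<epsilon> (circle_chain v i))"
        using loop_circle[OF c(1)] by blast
      have "circle_chain v i \<in> ?T"
        unfolding circle_expand[OF vi(2,1)]
      proof (intro span_class_sum[OF b_carrier] span_class_scale[OF b_carrier])
        fix A assume "A \<in> {A. A \<subseteq> {..<m} \<and> i \<notin> A \<and> next_side i \<in> A \<and> prev_side i \<in> A}"
        then have "(A, i) \<in> isolated_gaps" using vi(2) by (simp add: isolated_gaps_def)
        then show "isotypic A i \<in> ?T" by (rule isotypic_spanned[OF _ refl b_carrier basis])
      qed
      then have "?l c \<in> ?T"
        by (intro span_class_homologous[OF b_carrier vi(3)] span_class_scale[OF b_carrier])
      then show "x \<in> V.span (b ` basis_index)" using c(2) by simp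
    qed
  next
    fix g x y assume "g \<in> basis_index" "x \<in> carrier ?H" "y \<in> carrier ?H"
    then show "class_winding (h g) (x \<oplus>\<^bsub>?H\<^esub> y) = class_winding (h g) x + class_winding (h g) y"
      unfolding carrier_rat_homology by (auto simp del: One_nat_def simp: add_rat_homology hw winding_add)
  next
    fix g r x assume "g \<in> basis_index" "x \<in> carrier ?H"
    then show "class_winding (h g) (r \<odot>\<^bsub>?H\<^esub> x) = of_rat r * class_winding (h g) x"
      unfolding carrier_rat_homology by (auto simp del: One_nat_def simp: smult_rat_homology hw winding_scale)
  next
    fix g assume "g \<in> basis_index"
    then show "class_winding (h g) (b g) \<noteq> 0" using h by (auto simp del: One_nat_def simp: b_def hw case_prod_beta)
  next
    fix g g' assume "g \<in> basis_index" "g' \<in> basis_index" "g \<noteq> g'"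
    then show "class_winding (h g) (b g') = 0"
      using h by (cases g') (auto simp del: One_nat_def simp: b_def hw)
  qed
  then show ?thesis unfolding Loops_def .
qed

end

section \<open>Counting the basis\<close>

text \<open>Subsets of the sides are encoded as lists of bits so that the cardinality of the basis
  can be evaluated.\<close>

definition isolated_bit :: "nat \<Rightarrow> bool list \<Rightarrow> nat \<Rightarrow> bool" where
  "isolated_bit m bs i \<longleftrightarrow> \<not> bs ! i \<and> bs ! (Suc i mod m) \<and> bs ! ((i + m - 1) mod m)"

definition basis_bit :: "nat \<Rightarrow> bool list \<Rightarrow> nat \<Rightarrow> bool" where
  "basis_bit m bs i \<longleftrightarrow> isolated_bit m bs i \<and>
     (\<exists>j\<in>set [0..<m]. \<not> bs ! j \<and> (\<not> isolated_bit m bs j \<or> i < j))"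

definition basis_count :: "nat \<Rightarrow> nat" where
  "basis_count m = sum_list (map (\<lambda>bs. length (filter (basis_bit m bs) [0..<m])) (List.n_lists m [True, False]))"

text \<open>Evaluation over all 2^m bit lists; the results agree with m * 2^(m-3) - L_m + 1 for the
  Lucas numbers 11, 18, 29, 47.\<close>

lemma basis_count_values:
  "basis_count 5 = 10" "basis_count 6 = 31" "basis_count 7 = 84" "basis_count 8 = 210"
  by code_simp+

lemma (in right_angled_polygon) card_basis_index: "card basis_index = basis_count m"
proof -
  define bits where "bits A = map (\<lambda>i. i \<in> A) [0..<m]" for A
  have nth: "bits A ! i \<longleftrightarrow> i \<in> A" if "i < m" for A i using that by (simp add: bits_def)
  have iso: "isolated_bit m (bits A) i \<longleftrightarrow> (A, i) \<in> isolated_gaps" if "A \<subseteq> {..<m}" "i < m" for A i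
    using that by (simp add: isolated_bit_def isolated_gaps_def nth next_side_def prev_side_def)
  have bas: "basis_bit m (bits A) i \<longleftrightarrow> (A, i) \<in> basis_index" if "A \<subseteq> {..<m}" "i < m" for A i
    using that by (auto simp: basis_bit_def basis_index_def iso nth)
  have "basis_index = Sigma tiles (\<lambda>A. {i. i < m \<and> basis_bit m (bits A) i})"
    using bas by (auto simp: basis_index_def isolated_gaps_def)
  then have "card basis_index = (\<Sum>A\<in>tiles. card {i. i < m \<and> basis_bit m (bits A) i})"
    by (simp add: card_SigmaI)
  also have "\<dots> = (\<Sum>A\<in>tiles. length (filter (basis_bit m (bits A)) [0..<m]))"
  proof (rule sum.cong[OF refl])
    fix A
    have "card {i. i < m \<and> basis_bit m (bits A) i} = card (set (filter (basis_bit m (bits A)) [0..<m]))"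
      by (rule arg_cong[where f = card]) auto
    also have "\<dots> = length (filter (basis_bit m (bits A)) [0..<m])"
      by (rule distinct_card) simp
    finally show "card {i. i < m \<and> basis_bit m (bits A) i} = length (filter (basis_bit m (bits A)) [0..<m])" .
  qed
  also have "\<dots> = (\<Sum>bs\<in>set (List.n_lists m [True, False]). length (filter (basis_bit m bs) [0..<m]))"
  proof (rule sum.reindex_bij_witness[of _ "\<lambda>bs. {i. i < m \<and> bs ! i}" bits])
    show "bits A \<in> set (List.n_lists m [True, False])" for A by (auto simp: bits_def set_n_lists)
    show "{i. i < m \<and> bits A ! i} = A" if "A \<in> tiles" for A using that by (auto simp: nth)
    fix bs assume "bs \<in> set (List.n_lists m [True, False])"
    then have "length bs = m" by (simp add: set_n_lists)
    then show "bits {i. i < m \<and> bs ! i} = bs" by (auto simp: bits_def intro!: nth_equalityI)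
  qed auto
  also have "\<dots> = basis_count m"
    unfolding basis_count_def by (subst sum_list_distinct_conv_sum_set) (auto intro: distinct_n_lists)
  finally show ?thesis .
qed

theorem mainTheorem3:
  fixes m :: nat
    and \<gamma> :: "surface_point set \<Rightarrow> real \<Rightarrow> surface_point"
    and L :: "surface_point set \<Rightarrow> real"
  assumes "m \<in> {5, 6, 7, 8}"
    and "\<And>c. c \<in> edge_geodesics m \<Longrightarrow> closed_geodesic m (\<gamma> c) (L c) \<and> range (\<gamma> c) = c"
  shows "span_dim (rat_homology 1 (surface m))
           ((\<lambda>c. rat_homology_class 1 (surface m) (loop_chain (\<gamma> c) (L c))) ` edge_geodesics m) =
         (if m = 5 then 10 else if m = 6 then 31 else if m = 7 then 84 else 210)"
proof -
  interpret right_angled_polygon m using assms(1) by unfold_locales auto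
  show ?thesis
    using span_dim_edge_geodesics[OF assms(2)] card_basis_index basis_count_values assms(1) by auto
qed

end
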